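(* Let $a$ be a bounded operator on a complex Hilbert space $H$. Then $$a=\int_{Y} j\,dE,$$ where $E$ is a spectral measure on $Y$ and $j:Y\to B(H)$ is an operator valued function such that for every $y\in z^{-1}(\sigma(a))\subset Y$, $j(y)$ is a strongly spectral operator. Furthermore, there exist a spectral measure $E$ on $\Sigma(a)$ and an operator valued function $k:\Sigma(a)\to B(H)$ such that for every $\lambda\in\sigma(a)$, $k(\lambda)$ is a strongly spectral operator, and $$a=\int_{\Sigma(a)}k\,dE.$$
   Context: Let $A$ be the unital $C^*$-algebra generated by $\{1,a\}$, let $\overline{PS(A)}$ be the weak*-closure of the set of pure states of $A$, and let $P(A):=\overline{PS(A)}\setminus\{0\}$. Let $R(A)$ be the equivalence relation on $P(A)$ under which $\alpha,\beta$ are equivalent iff the corresponding Gelfand-Naimark-Segal representations are equivalent. Let $\tau:P(A)\to\mathbb{C}$ be $\tau(\alpha):=\alpha(a)$ and let $\Sigma(a):=\tau(P(A))$. (One has $\sigma(a)\subset\Sigma(a)$, where $\sigma(a)$ is the spectrum of $a$.) Let $T(a)$ be the equivalence relation on $P(A)$ defined by $\tau$ (i.e. $\alpha\sim\beta$ iff $\tau(\alpha)=\tau(\beta)$), and $R(a):=R(A)\cap T(a)$. Let $r:P(A)\to Y$ be the quotient map corresponding to $R(a)$, and let $z:Y\to\Sigma(a)$ be the map through which $\tau$ factors: $\tau=z\circ r$. A bounded operator $n$ on $H$ is quasi-nilpotent if $\|n^i\|^{1/i}\to 0$. An operator is quasi-scalar if it is a scalar multiple of a projection. An operator $b$ is strongly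 spectral if $b=q+n$ where $q$ is quasi-scalar and $n$ is quasi-nilpotent. A spectral measure on a space is a projection-valued measure on its Borel sets with values in $B(H)$. The integral of an operator valued function $f$ against $E$ is the norm limit of sums $\sum_i f(y_i)E(U_i)$ over finite Borel partitions $\{U_i\}$ of the space with $y_i\in U_i$. *)

theory Defs
  imports "HOL-Analysis.Analysis"
begin

section \<open>Complex Hilbert spaces and their bounded operators\<close>

text \<open>
  The complex inner product is linear in the first argument. The inherited real structure
  (\<open>scaleR\<close>, \<open>inner\<close>, \<open>norm\<close>) is the underlying one, so the norm is the Hilbert space norm.
\<close>

class complex_hilbert = real_inner + banach +
  fixes scaleC :: "complex \<Rightarrow> 'a \<Rightarrow> 'a" (infixr "*\<^sub>C" 75)
    and cinner :: "'a \<Rightarrow> 'a \<Rightarrow> complex"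
  assumes scaleC_add_right: "c *\<^sub>C (x + y) = c *\<^sub>C x + c *\<^sub>C y"
    and scaleC_add_left: "(c + d) *\<^sub>C x = c *\<^sub>C x + d *\<^sub>C x"
    and scaleC_scaleC: "c *\<^sub>C (d *\<^sub>C x) = (c * d) *\<^sub>C x"
    and scaleC_of_real: "complex_of_real t *\<^sub>C x = t *\<^sub>R x"
    and cinner_commute: "cinner x y = cnj (cinner y x)"
    and cinner_add_left: "cinner (x + y) z = cinner x z + cinner y z"
    and cinner_scaleC_left: "cinner (c *\<^sub>C x) y = c * cinner x y"
    and Re_cinner: "Re (cinner x y) = x \<bullet> y"

instantiation complex :: complex_hilbert
begin

definition scaleC_complex :: "complex \<Rightarrow> complex \<Rightarrow> complex"
  where "scaleC_complex c x = c * x"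

definition cinner_complex :: "complex \<Rightarrow> complex \<Rightarrow> complex"
  where "cinner_complex x y = x * cnj y"

instance
  by standard
    (auto simp: scaleC_complex_def cinner_complex_def algebra_simps scaleR_conv_of_real
      inner_complex_def)

end

text \<open>
  Elements of \<open>'h \<Rightarrow>\<^sub>L 'h\<close> are bounded real-linear maps; \<open>B(H)\<close> consists of the complex-linear
  ones, with the operator norm of \<open>'h \<Rightarrow>\<^sub>L 'h\<close>.
\<close>

definition bounded_ops :: "('h::complex_hilbert \<Rightarrow>\<^sub>L 'h) set"
  where "bounded_ops = {b. \<forall>c x. blinfun_apply b (c *\<^sub>C x) = c *\<^sub>C blinfun_apply b x}"

definition scale_op :: "complex \<Rightarrow> ('h::complex_hilbert \<Rightarrow>\<^sub>L 'h) \<Rightarrow> ('h \<Rightarrow>\<^sub>L 'h)"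
  where "scale_op c b = Blinfun (\<lambda>x. c *\<^sub>C blinfun_apply b x)"

definition adj :: "('h::complex_hilbert \<Rightarrow>\<^sub>L 'h) \<Rightarrow> ('h \<Rightarrow>\<^sub>L 'h)"
  where "adj b = (THE d. \<forall>x y. cinner (blinfun_apply b x) y = cinner x (blinfun_apply d y))"

definition op_power :: "('h::complex_hilbert \<Rightarrow>\<^sub>L 'h) \<Rightarrow> nat \<Rightarrow> ('h \<Rightarrow>\<^sub>L 'h)"
  where "op_power b i = ((\<lambda>d. b o\<^sub>L d) ^^ i) id_blinfun"

definition is_projection :: "('h::complex_hilbert \<Rightarrow>\<^sub>L 'h) \<Rightarrow> bool"
  where "is_projection p \<longleftrightarrow> p \<in> bounded_ops \<and> p o\<^sub>L p = p \<and> adj p = p"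

definition quasi_nilpotent :: "('h::complex_hilbert \<Rightarrow>\<^sub>L 'h) \<Rightarrow> bool"
  where "quasi_nilpotent n \<longleftrightarrow>
    n \<in> bounded_ops \<and> (\<lambda>i. root i (norm (op_power n i))) \<longlonglongrightarrow> 0"

definition quasi_scalar :: "('h::complex_hilbert \<Rightarrow>\<^sub>L 'h) \<Rightarrow> bool"
  where "quasi_scalar q \<longleftrightarrow> (\<exists>c p. is_projection p \<and> q = scale_op c p)"

definition strongly_spectral :: "('h::complex_hilbert \<Rightarrow>\<^sub>L 'h) \<Rightarrow> bool"
  where "strongly_spectral b \<longleftrightarrow> (\<exists>q n. quasi_scalar q \<and> quasi_nilpotent n \<and> b = q + n)"

definition op_spectrum :: "('h::complex_hilbert \<Rightarrow>\<^sub>L 'h) \<Rightarrow> complex set"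
  where "op_spectrum b =
    {c. \<not> (\<exists>d \<in> bounded_ops. d o\<^sub>L (b - scale_op c id_blinfun) = id_blinfun \<and>
                            (b - scale_op c id_blinfun) o\<^sub>L d = id_blinfun)}"

definition cstar_subalgebra :: "('h::complex_hilbert \<Rightarrow>\<^sub>L 'h) set \<Rightarrow> bool"
  where "cstar_subalgebra A \<longleftrightarrow>
    A \<subseteq> bounded_ops \<and> closed A \<and> 0 \<in> A \<and>
    (\<forall>x\<in>A. \<forall>y\<in>A. x + y \<in> A \<and> x o\<^sub>L y \<in> A) \<and>
    (\<forall>c. \<forall>x\<in>A. scale_op c x \<in> A) \<and>
    (\<forall>x\<in>A. adj x \<in> A)"

definition gen_cstar :: "('h::complex_hilbert \<Rightarrow>\<^sub>L 'h) \<Rightarrow> ('h \<Rightarrow>\<^sub>L 'h) set"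
  where "gen_cstar a = cstar_subalgebra hull {id_blinfun, a}"


section \<open>States\<close>

text \<open>
  Functionals on \<open>A\<close> are extensional functions (undefined outside \<open>A\<close>), so that pointwise
  convergence on \<open>A\<close>, i.e. the weak* topology, is the product topology over the index set \<open>A\<close>.
\<close>

definition dual_space :: "('h::complex_hilbert \<Rightarrow>\<^sub>L 'h) set \<Rightarrow> (('h \<Rightarrow>\<^sub>L 'h) \<Rightarrow> complex) set"
  where "dual_space A = {\<phi> \<in> extensional A.
    (\<forall>x\<in>A. \<forall>y\<in>A. \<phi> (x + y) = \<phi> x + \<phi> y) \<and>
    (\<forall>c. \<forall>x\<in>A. \<phi> (scale_op c x) = c * \<phi> x) \<and>
    (\<exists>M. \<forall>x\<in>A. cmod (\<phi> x) \<le> M * norm x)}"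

definition weak_star :: "('h::complex_hilbert \<Rightarrow>\<^sub>L 'h) set \<Rightarrow> (('h \<Rightarrow>\<^sub>L 'h) \<Rightarrow> complex) topology"
  where "weak_star A = subtopology (product_topology (\<lambda>_. euclidean) A) (dual_space A)"

definition states :: "('h::complex_hilbert \<Rightarrow>\<^sub>L 'h) set \<Rightarrow> (('h \<Rightarrow>\<^sub>L 'h) \<Rightarrow> complex) set"
  where "states A = {\<phi> \<in> dual_space A.
    (\<forall>x\<in>A. \<phi> (adj x o\<^sub>L x) \<in> \<real>\<^sub>\<ge>\<^sub>0) \<and> \<phi> id_blinfun = 1}"

definition pure_states :: "('h::complex_hilbert \<Rightarrow>\<^sub>L 'h) set \<Rightarrow> (('h \<Rightarrow>\<^sub>L 'h) \<Rightarrow> complex) set"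
  where "pure_states A = {\<phi> \<in> states A.
    \<forall>\<psi>\<in>states A. \<forall>\<omega>\<in>states A. \<forall>t::real. 0 < t \<and> t < 1 \<and>
      (\<forall>x\<in>A. \<phi> x = of_real (1 - t) * \<psi> x + of_real t * \<omega> x) \<longrightarrow> \<psi> = \<phi> \<and> \<omega> = \<phi>}"

definition P_space :: "('h::complex_hilbert \<Rightarrow>\<^sub>L 'h) set \<Rightarrow> (('h \<Rightarrow>\<^sub>L 'h) \<Rightarrow> complex) set"
  where "P_space A = (weak_star A closure_of pure_states A) - {restrict (\<lambda>_. 0) A}"


section \<open>Gelfand-Naimark-Segal representations\<close>

record 'v hilbert_structure =
  hcarrier :: "'v set"
  hplus :: "'v \<Rightarrow> 'v \<Rightarrow> 'v"
  hscale :: "complex \<Rightarrow> 'v \<Rightarrow> 'v"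
  hinner :: "'v \<Rightarrow> 'v \<Rightarrow> complex"

definition unitary_map ::
    "'v hilbert_structure \<Rightarrow> 'w hilbert_structure \<Rightarrow> ('v \<Rightarrow> 'w) \<Rightarrow> bool"
  where "unitary_map V W U \<longleftrightarrow>
    bij_betw U (hcarrier V) (hcarrier W) \<and>
    (\<forall>u\<in>hcarrier V. \<forall>v\<in>hcarrier V. U (hplus V u v) = hplus W (U u) (U v)) \<and>
    (\<forall>c. \<forall>u\<in>hcarrier V. U (hscale V c u) = hscale W c (U u)) \<and>
    (\<forall>u\<in>hcarrier V. \<forall>v\<in>hcarrier V. hinner W (U u) (U v) = hinner V u v)"

definition equivalent_reps ::
    "'x set \<Rightarrow> 'v hilbert_structure \<Rightarrow> ('x \<Rightarrow> 'v \<Rightarrow> 'v) \<Rightarrow>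
     'w hilbert_structure \<Rightarrow> ('x \<Rightarrow> 'w \<Rightarrow> 'w) \<Rightarrow> bool"
  where "equivalent_reps A V \<pi> W \<rho> \<longleftrightarrow>
    (\<exists>U. unitary_map V W U \<and> (\<forall>x\<in>A. \<forall>v\<in>hcarrier V. U (\<pi> x v) = \<rho> x (U v)))"

lemma equivalent_reps_refl: "equivalent_reps A V \<pi> V \<pi>"
  unfolding equivalent_reps_def by (rule exI[of _ id]) (simp add: unitary_map_def)

text \<open>
  The GNS space of \<open>\<alpha>\<close> is the Hilbert space completion of \<open>A / {x. \<alpha> (x* x) = 0}\<close> for the
  inner product \<open>\<langle>x, y\<rangle> = \<alpha> (y* x)\<close>. Both steps are done at once: its elements are classes of
  sequences in \<open>A\<close> that are Cauchy for the seminorm, modulo sequences of seminorm tending to 0.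
\<close>

definition gns_seminorm ::
    "(('h::complex_hilbert \<Rightarrow>\<^sub>L 'h) \<Rightarrow> complex) \<Rightarrow> ('h \<Rightarrow>\<^sub>L 'h) \<Rightarrow> real"
  where "gns_seminorm \<alpha> x = sqrt (Re (\<alpha> (adj x o\<^sub>L x)))"

definition gns_cauchy ::
    "('h::complex_hilbert \<Rightarrow>\<^sub>L 'h) set \<Rightarrow> (('h \<Rightarrow>\<^sub>L 'h) \<Rightarrow> complex) \<Rightarrow> (nat \<Rightarrow> 'h \<Rightarrow>\<^sub>L 'h) set"
  where "gns_cauchy A \<alpha> = {s. range s \<subseteq> A \<and>
    (\<forall>e>0. \<exists>N. \<forall>m\<ge>N. \<forall>n\<ge>N. gns_seminorm \<alpha> (s m - s n) < e)}"

definition gns_rel ::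
    "('h::complex_hilbert \<Rightarrow>\<^sub>L 'h) set \<Rightarrow> (('h \<Rightarrow>\<^sub>L 'h) \<Rightarrow> complex) \<Rightarrow>
     ((nat \<Rightarrow> 'h \<Rightarrow>\<^sub>L 'h) \<times> (nat \<Rightarrow> 'h \<Rightarrow>\<^sub>L 'h)) set"
  where "gns_rel A \<alpha> = {(s, t) \<in> gns_cauchy A \<alpha> \<times> gns_cauchy A \<alpha>.
    (\<lambda>n. gns_seminorm \<alpha> (s n - t n)) \<longlonglongrightarrow> 0}"

definition gns_space ::
    "('h::complex_hilbert \<Rightarrow>\<^sub>L 'h) set \<Rightarrow> (('h \<Rightarrow>\<^sub>L 'h) \<Rightarrow> complex) \<Rightarrow>
     (nat \<Rightarrow> 'h \<Rightarrow>\<^sub>L 'h) set hilbert_structure"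
  where "gns_space A \<alpha> = \<lparr>
    hcarrier = gns_cauchy A \<alpha> // gns_rel A \<alpha>,
    hplus = (\<lambda>u v. \<Union>s\<in>u. \<Union>t\<in>v. gns_rel A \<alpha> `` {\<lambda>n. s n + t n}),
    hscale = (\<lambda>c u. \<Union>s\<in>u. gns_rel A \<alpha> `` {\<lambda>n. scale_op c (s n)}),
    hinner = (\<lambda>u v. THE c. \<forall>s\<in>u. \<forall>t\<in>v. (\<lambda>n. \<alpha> (adj (t n) o\<^sub>L s n)) \<longlonglongrightarrow> c) \<rparr>"

definition gns_rep ::
    "('h::complex_hilbert \<Rightarrow>\<^sub>L 'h) set \<Rightarrow> (('h \<Rightarrow>\<^sub>L 'h) \<Rightarrow> complex) \<Rightarrow>
     ('h \<Rightarrow>\<^sub>L 'h) \<Rightarrow> (nat \<Rightarrow> 'h \<Rightarrow>\<^sub>L 'h) set \<Rightarrow> (nat \<Rightarrow> 'h \<Rightarrow>\<^sub>L 'h) set"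
  where "gns_rep A \<alpha> x u = (\<Union>s\<in>u. gns_rel A \<alpha> `` {\<lambda>n. x o\<^sub>L s n})"

definition R_alg ::
    "('h::complex_hilbert \<Rightarrow>\<^sub>L 'h) set \<Rightarrow>
     ((('h \<Rightarrow>\<^sub>L 'h) \<Rightarrow> complex) \<times> (('h \<Rightarrow>\<^sub>L 'h) \<Rightarrow> complex)) set"
  where "R_alg A = {(\<alpha>, \<beta>) \<in> P_space A \<times> P_space A.
    equivalent_reps A (gns_space A \<alpha>) (gns_rep A \<alpha>) (gns_space A \<beta>) (gns_rep A \<beta>)}"


section \<open>The spaces \<open>Y\<close> and \<open>\<Sigma>(a)\<close>\<close>

definition quotient_topology :: "'x topology \<Rightarrow> ('x \<Rightarrow> 'y) \<Rightarrow> 'y topology"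
  where "quotient_topology X f =
    topology (\<lambda>U. U \<subseteq> f ` topspace X \<and> openin X {x \<in> topspace X. f x \<in> U})"

lemma openin_quotient_topology:
  "openin (quotient_topology X f) U \<longleftrightarrow>
    U \<subseteq> f ` topspace X \<and> openin X {x \<in> topspace X. f x \<in> U}"
proof -
  have "istopology (\<lambda>U. U \<subseteq> f ` topspace X \<and> openin X {x \<in> topspace X. f x \<in> U})"
    unfolding istopology_def
  proof (intro conjI allI impI)
    fix S T
    assume "S \<subseteq> f ` topspace X \<and> openin X {x \<in> topspace X. f x \<in> S}"
      and "T \<subseteq> f ` topspace X \<and> openin X {x \<in> topspace X. f x \<in> T}"
    moreover have "{x \<in> topspace X. f x \<in> S \<inter> T} =
        {x \<in> topspace X. f x \<in> S} \<inter> {x \<in> topspace X. f x \<in> T}"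
      by auto
    ultimately show "S \<inter> T \<subseteq> f ` topspace X" "openin X {x \<in> topspace X. f x \<in> S \<inter> T}"
      by auto
  next
    fix \<K>
    assume K: "\<forall>K\<in>\<K>. K \<subseteq> f ` topspace X \<and> openin X {x \<in> topspace X. f x \<in> K}"
    then show "\<Union>\<K> \<subseteq> f ` topspace X"
      by auto
    have "{x \<in> topspace X. f x \<in> \<Union>\<K>} = (\<Union>K\<in>\<K>. {x \<in> topspace X. f x \<in> K})"
      by auto
    then show "openin X {x \<in> topspace X. f x \<in> \<Union>\<K>}"
      using K by auto
  qed
  then show ?thesis
    by (simp add: quotient_topology_def topology_inverse')
qed

lemma topspace_quotient_topology: "topspace (quotient_topology X f) = f ` topspace X"
proof
  show "topspace (quotient_topology X f) \<subseteq> f ` topspace X"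
    using openin_topspace[of "quotient_topology X f"]
    unfolding openin_quotient_topology by (rule conjunct1)
  have "{x \<in> topspace X. f x \<in> f ` topspace X} = topspace X"
    by blast
  then have "openin (quotient_topology X f) (f ` topspace X)"
    unfolding openin_quotient_topology by (metis openin_topspace order_refl)
  then show "f ` topspace X \<subseteq> topspace (quotient_topology X f)"
    by (rule openin_subset)
qed

lemma quotient_map_quotient_topology: "quotient_map X (quotient_topology X f) f"
  by (simp add: quotient_map_def topspace_quotient_topology openin_quotient_topology)

definition tau ::
    "('h::complex_hilbert \<Rightarrow>\<^sub>L 'h) \<Rightarrow> (('h \<Rightarrow>\<^sub>L 'h) \<Rightarrow> complex) \<Rightarrow> complex"
  where "tau a \<alpha> = \<alpha> a"

definition Sigma_op :: "('h::complex_hilbert \<Rightarrow>\<^sub>L 'h) \<Rightarrow> complex set"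
  where "Sigma_op a = tau a ` P_space (gen_cstar a)"

definition T_op ::
    "('h::complex_hilbert \<Rightarrow>\<^sub>L 'h) \<Rightarrow>
     ((('h \<Rightarrow>\<^sub>L 'h) \<Rightarrow> complex) \<times> (('h \<Rightarrow>\<^sub>L 'h) \<Rightarrow> complex)) set"
  where "T_op a = {(\<alpha>, \<beta>) \<in> P_space (gen_cstar a) \<times> P_space (gen_cstar a). tau a \<alpha> = tau a \<beta>}"

definition R_op ::
    "('h::complex_hilbert \<Rightarrow>\<^sub>L 'h) \<Rightarrow>
     ((('h \<Rightarrow>\<^sub>L 'h) \<Rightarrow> complex) \<times> (('h \<Rightarrow>\<^sub>L 'h) \<Rightarrow> complex)) set"
  where "R_op a = R_alg (gen_cstar a) \<inter> T_op a"

definition r_map ::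
    "('h::complex_hilbert \<Rightarrow>\<^sub>L 'h) \<Rightarrow> (('h \<Rightarrow>\<^sub>L 'h) \<Rightarrow> complex) \<Rightarrow> (('h \<Rightarrow>\<^sub>L 'h) \<Rightarrow> complex) set"
  where "r_map a \<alpha> = R_op a `` {\<alpha>}"

definition Y_space ::
    "('h::complex_hilbert \<Rightarrow>\<^sub>L 'h) \<Rightarrow> (('h \<Rightarrow>\<^sub>L 'h) \<Rightarrow> complex) set topology"
  where "Y_space a = quotient_topology
    (subtopology (weak_star (gen_cstar a)) (P_space (gen_cstar a))) (r_map a)"

definition z_map ::
    "('h::complex_hilbert \<Rightarrow>\<^sub>L 'h) \<Rightarrow> (('h \<Rightarrow>\<^sub>L 'h) \<Rightarrow> complex) set \<Rightarrow> complex"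
  where "z_map a y = the_elem (tau a ` y)"

lemma z_map_r_map:
  assumes "\<alpha> \<in> P_space (gen_cstar a)"
  shows "z_map a (r_map a \<alpha>) = tau a \<alpha>"
proof -
  have "\<alpha> \<in> r_map a \<alpha>"
    unfolding r_map_def R_op_def R_alg_def T_op_def using assms equivalent_reps_refl by blast
  moreover have "tau a \<beta> = tau a \<alpha>" if "\<beta> \<in> r_map a \<alpha>" for \<beta>
    using that unfolding r_map_def R_op_def T_op_def by simp
  ultimately have "tau a ` r_map a \<alpha> = {tau a \<alpha>}"
    by blast
  then show ?thesis
    unfolding z_map_def by (simp only: the_elem_eq)
qed


section \<open>Spectral measures and integrals\<close>

definition borel_sets :: "'y topology \<Rightarrow> 'y set set"
  where "borel_sets X = sigma_sets (topspace X) {U. openin X U}"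

definition spectral_measure :: "'y topology \<Rightarrow> ('y set \<Rightarrow> ('h::complex_hilbert \<Rightarrow>\<^sub>L 'h)) \<Rightarrow> bool"
  where "spectral_measure X E \<longleftrightarrow>
    (\<forall>U\<in>borel_sets X. is_projection (E U)) \<and>
    E (topspace X) = id_blinfun \<and>
    (\<forall>U\<in>borel_sets X. \<forall>V\<in>borel_sets X. E (U \<inter> V) = E U o\<^sub>L E V) \<and>
    (\<forall>F :: nat \<Rightarrow> 'y set. range F \<subseteq> borel_sets X \<and> disjoint_family F \<longrightarrow>
      (\<forall>x. (\<lambda>n. blinfun_apply (E (F n)) x) sums blinfun_apply (E (\<Union>n. F n)) x))"

definition borel_partition :: "'y topology \<Rightarrow> 'y set set \<Rightarrow> bool"
  where "borel_partition X \<U> \<longleftrightarrow>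
    finite \<U> \<and> \<U> \<subseteq> borel_sets X \<and> partition_on (topspace X) \<U>"

text \<open>
  The limit is taken in norm along the finite Borel partitions directed by refinement, uniformly
  in the choice of the points \<open>y U \<in> U\<close> (the members of a \<open>partition_on\<close> are nonempty).
\<close>

definition has_spectral_integral ::
    "'y topology \<Rightarrow> ('y set \<Rightarrow> ('h::complex_hilbert \<Rightarrow>\<^sub>L 'h)) \<Rightarrow> ('y \<Rightarrow> ('h \<Rightarrow>\<^sub>L 'h)) \<Rightarrow>
     ('h \<Rightarrow>\<^sub>L 'h) \<Rightarrow> bool"
  where "has_spectral_integral X E f b \<longleftrightarrow>
    (\<forall>e>0. \<exists>\<U>\<^sub>0. borel_partition X \<U>\<^sub>0 \<and>
      (\<forall>\<U> y. borel_partition X \<U> \<and> refines (topspace X) \<U> \<U>\<^sub>0 \<and> (\<forall>U\<in>\<U>. y U \<in> U) \<longrightarrow>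
        norm ((\<Sum>U\<in>\<U>. f (y U) o\<^sub>L E U) - b) < e))"

end

theory Submission
  imports Defs
begin

text \<open>
  The measure is not asked to commute with \<open>a\<close>, and its integrand may take values outside the
  algebra generated by \<open>a\<close>. This makes room for a triangular decomposition of \<open>a\<close> along
  projections that are read off from compressions of \<open>a\<close>.

  Bisecting in turn the real and the imaginary part of compressions of \<open>a\<close> gives a binary tree of
  projections, \<open>node a s\<close>, in which the two children of a node are orthogonal and add up to it.
  The compression of \<open>a\<close> to a node of depth \<open>p\<close> is scalar up to an error that decreases
  geometrically in \<open>p\<close> (\<open>node_compression\<close>). The tree carries a projection-valued measure on its
  branches, \<open>branch_op a\<close>. Let \<open>F\<^sub>p\<close> be the nodes along a branch. The scalars belonging to \<open>F\<^sub>p\<close>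
  converge to a number \<open>\<lambda>\<close>, and the corners \<open>(F\<^sub>p - F\<^sub>p\<^sub>+\<^sub>1) a F\<^sub>p\<^sub>+\<^sub>1\<close> sum up to an operator \<open>n\<close>, which
  is strictly triangular with respect to the decreasing sequence \<open>F\<^sub>p\<close> and has geometrically small
  tails; so \<open>n\<close> is quasi-nilpotent (\<open>quasi_nilpotent_strict_part\<close>), and \<open>\<lambda> + n\<close> is strongly
  spectral. On \<open>F\<^sub>m\<close> the operator \<open>n\<close> reproduces the part of \<open>a\<close> that leaves \<open>F\<^sub>m\<close>, and \<open>\<lambda>\<close> the
  part that does not, up to small errors. Since corners below different parents have orthogonal
  ranges and domains, the errors do not add up over the members of a partition, however fine it is,
  and \<open>\<lambda> + n\<close> integrates to \<open>a\<close> (\<open>riemann_sum_branch_fun\<close>).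

  It remains to transport the measure from the branches to \<open>Y\<close> and \<open>\<Sigma>(a)\<close>. It is enough to have
  a measurable map from the branches to \<open>Y\<close> such that \<open>z\<close> remembers the branch.

  If \<open>a\<close> is not normal, some pure state \<open>\<alpha>\<close> does not vanish on a commutator \<open>ah - ha\<close> with \<open>h\<close>
  self-adjoint; it exists because closed faces of the weak*-compact state space contain pure states.
  Conjugating \<open>\<alpha>\<close> by unitaries \<open>1 + ith + \<dots>\<close> gives a continuous curve of pure states on which \<open>\<tau>\<close>
  is not constant (\<open>nonconstant_pure_state_path\<close>). A real function of \<open>\<tau>\<close> maps this curve onto an
  interval, which has room for the Cantor set of all branches.

  If \<open>a\<close> is normal, its nodes commute with it, so \<open>n = 0\<close>, and a branch without zero nodes
  determines a character of \<open>C*(1, a)\<close> with value \<open>\<lambda>\<close> at \<open>a\<close>. Characters are pure states, and the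
  one belonging to a branch depends on the branch continuously (\<open>branch_state_preimage_sets\<close>).
  This is the spectral theorem, with \<open>z\<close> as integrand.
\<close>

section \<open>Adjoints and projections\<close>

lemma cinner_scaleC_right: "cinner x (c *\<^sub>C y) = cnj c * cinner x y"
  for x y :: "'h::complex_hilbert"
  by (metis cinner_commute cinner_scaleC_left complex_cnj_cnj complex_cnj_mult)

lemma inner_scaleC_left: "(c *\<^sub>C x) \<bullet> y = x \<bullet> (cnj c *\<^sub>C y)"
  for x y :: "'h::complex_hilbert"
  by (metis Re_cinner cinner_scaleC_left cinner_scaleC_right complex_cnj_cnj)

lemma scaleC_one [simp]: "1 *\<^sub>C x = x" for x :: "'h::complex_hilbert"
  using scaleC_of_real[of 1 x] by simp

lemma scaleC_zero_left [simp]: "0 *\<^sub>C x = 0" for x :: "'h::complex_hilbert"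
  using scaleC_of_real[of 0 x] by simp

lemma scaleC_scaleR: "c *\<^sub>C (r *\<^sub>R x) = r *\<^sub>R (c *\<^sub>C x)" for x :: "'h::complex_hilbert"
  by (metis mult.commute scaleC_of_real scaleC_scaleC)

lemma norm_scaleC: "norm (c *\<^sub>C x) = cmod c * norm x" for x :: "'h::complex_hilbert"
proof -
  have "(c *\<^sub>C x) \<bullet> (c *\<^sub>C x) = x \<bullet> (complex_of_real ((cmod c)\<^sup>2) *\<^sub>C x)"
    by (simp add: inner_scaleC_left scaleC_scaleC mult.commute flip: complex_norm_square)
  also have "\<dots> = (cmod c * norm x)\<^sup>2"
    unfolding scaleC_of_real by (simp add: power_mult_distrib dot_square_norm)
  finally show ?thesis
    by (simp add: norm_eq_sqrt_inner real_sqrt_mult)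
qed

lemma bounded_linear_scaleC: "bounded_linear ((*\<^sub>C) c :: 'h::complex_hilbert \<Rightarrow> 'h)"
  by (rule bounded_linear_intro[where K = "cmod c"])
    (auto simp: scaleC_add_right scaleC_scaleR norm_scaleC mult.commute)

lemmas linear_scaleC = bounded_linear.linear[OF bounded_linear_scaleC]

lemmas scaleC_diff_right = linear_diff[OF linear_scaleC]
  and scaleC_minus_right = linear_neg[OF linear_scaleC]
  and scaleC_zero_right [simp] = linear_0[OF linear_scaleC]
  and scaleC_sum_right = linear_sum[OF linear_scaleC]

lemma scaleC_minus_left: "(- c) *\<^sub>C x = - (c *\<^sub>C x)" for x :: "'h::complex_hilbert"
proof -
  have "(- c) *\<^sub>C x + c *\<^sub>C x = 0" by (simp flip: scaleC_add_left)
  then show ?thesis by (simp add: eq_neg_iff_add_eq_0)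
qed

lemma scaleC_diff_left: "(c - d) *\<^sub>C x = c *\<^sub>C x - d *\<^sub>C x" for x :: "'h::complex_hilbert"
  using scaleC_add_left[of c "- d" x] by (simp add: scaleC_minus_left)

lemma cinner_eq: "cinner x y = Complex (x \<bullet> y) (- ((\<i> *\<^sub>C x) \<bullet> y))"
  for x y :: "'h::complex_hilbert"
  by (rule complex_eqI) (simp_all add: Re_cinner[symmetric] cinner_scaleC_left)

lemma cinner_self: "cinner x x = complex_of_real ((norm x)\<^sup>2)" for x :: "'h::complex_hilbert"
proof -
  have "Im (cinner x x) = 0"
    using arg_cong[OF cinner_commute[of x x], of Im] by simp
  then show ?thesis
    by (intro complex_eqI) (simp_all add: Re_cinner dot_square_norm)
qed

lemma norm_cinner_le: "cmod (cinner u v) \<le> 2 * (norm u * norm v)" for u v :: "'h::complex_hilbert"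
proof -
  have "\<bar>u \<bullet> v\<bar> \<le> norm u * norm v" "\<bar>(\<i> *\<^sub>C u) \<bullet> v\<bar> \<le> norm u * norm v"
    using Cauchy_Schwarz_ineq2[of u v] Cauchy_Schwarz_ineq2[of "\<i> *\<^sub>C u" v]
    by (simp_all add: norm_scaleC)
  then show ?thesis
    using cmod_le[of "cinner u v"] by (simp add: cinner_eq)
qed

lemma scale_op_apply [simp]: "blinfun_apply (scale_op c b) x = c *\<^sub>C blinfun_apply b x"
  unfolding scale_op_def
  by (subst bounded_linear_Blinfun_apply)
    (auto intro: bounded_linear_compose[OF bounded_linear_scaleC] blinfun.bounded_linear_right)

lemmas compose_apply = blinfun_apply_blinfun_compose

lemma compose_eqD: "S o\<^sub>L T = U o\<^sub>L V \<Longrightarrow>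
    blinfun_apply S (blinfun_apply T x) = blinfun_apply U (blinfun_apply V x)"
  by (metis compose_apply)

lemma compose_zeroD: "S o\<^sub>L T = 0 \<Longrightarrow> blinfun_apply S (blinfun_apply T x) = 0"
  using compose_apply[of S T x] by simp

lemma compose_assoc: "(f o\<^sub>L g) o\<^sub>L h = f o\<^sub>L (g o\<^sub>L h)"
  by (rule blinfun_eqI) simp

lemmas apply_simps = blinfun.add_left blinfun.diff_left blinfun.minus_left blinfun.scaleR_left
  blinfun.zero_left blinfun.sum_left
  blinfun.add_right blinfun.diff_right blinfun.minus_right blinfun.scaleR_right blinfun.sum_right

lemma norm_scale_op: "norm (scale_op c b) = cmod c * norm b"
proof (cases "c = 0")
  case True
  then have "scale_op c b = 0" by (intro blinfun_eqI) simp
  then show ?thesis using True by simp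
next
  case False
  have le: "norm (scale_op c b) \<le> cmod c * norm b" for c b
    by (rule norm_blinfun_bound)
      (auto simp: norm_scaleC mult.assoc intro!: mult_left_mono norm_blinfun)
  have "b = scale_op (inverse c) (scale_op c b)"
    using False by (intro blinfun_eqI) (simp add: scaleC_scaleC)
  then have "norm b \<le> cmod (inverse c) * norm (scale_op c b)"
    using le[of "inverse c" "scale_op c b"] by simp
  then have "cmod c * norm b \<le> norm (scale_op c b)"
    using False by (simp add: norm_divide field_simps)
  then show ?thesis by (intro order_antisym le)
qed

lemma bounded_opsD: "b \<in> bounded_ops \<Longrightarrow> blinfun_apply b (c *\<^sub>C x) = c *\<^sub>C blinfun_apply b x"
  by (simp add: bounded_ops_def)

lemma bounded_ops_zero: "0 \<in> bounded_ops"
  and bounded_ops_id: "id_blinfun \<in> bounded_ops"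
  and bounded_ops_add: "b \<in> bounded_ops \<Longrightarrow> d \<in> bounded_ops \<Longrightarrow> b + d \<in> bounded_ops"
  and bounded_ops_diff: "b \<in> bounded_ops \<Longrightarrow> d \<in> bounded_ops \<Longrightarrow> b - d \<in> bounded_ops"
  and bounded_ops_compose: "b \<in> bounded_ops \<Longrightarrow> d \<in> bounded_ops \<Longrightarrow> b o\<^sub>L d \<in> bounded_ops"
  and bounded_ops_scaleR: "b \<in> bounded_ops \<Longrightarrow> r *\<^sub>R b \<in> bounded_ops"
  and bounded_ops_scale: "b \<in> bounded_ops \<Longrightarrow> scale_op c b \<in> bounded_ops"
  by (auto simp: bounded_ops_def apply_simps scaleC_add_right scaleC_diff_right scaleC_scaleR
      scaleC_scaleC mult.commute)

lemma closed_bounded_ops: "closed (bounded_ops :: ('h::complex_hilbert \<Rightarrow>\<^sub>L 'h) set)"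
  unfolding bounded_ops_def
  by (intro closed_Collect_all closed_Collect_eq continuous_intros
      bounded_linear.continuous_on[OF bounded_linear_scaleC])

lemmas bounded_ops_intros = bounded_ops_zero bounded_ops_id bounded_ops_add bounded_ops_diff
  bounded_ops_compose bounded_ops_scaleR bounded_ops_scale

text \<open>
  A sequence in \<open>M\<close> that minimizes the distance to \<open>x\<close> is a Cauchy sequence by the parallelogram
  identity, and its limit is the foot of the perpendicular.
\<close>
lemma orthogonal_decomposition:
  fixes M :: "'a::{real_inner, banach} set"
  assumes "closed M" "subspace M"
  obtains p where "p \<in> M" "\<And>y. y \<in> M \<Longrightarrow> (x - p) \<bullet> y = 0"
proof -
  define D where "D = (INF y\<in>M. (norm (x - y))\<^sup>2)"
  have M0: "M \<noteq> {}" using subspace_0[OF assms(2)] by auto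
  have bdd: "bdd_below ((\<lambda>y. (norm (x - y))\<^sup>2) ` M)"
    by (rule bdd_belowI[where m = 0]) auto
  have D_le: "D \<le> (norm (x - y))\<^sup>2" if "y \<in> M" for y
    unfolding D_def by (rule cINF_lower[OF bdd that])
  have "\<exists>y\<in>M. (norm (x - y))\<^sup>2 < D + inverse (real (Suc n))" for n
    using cINF_less_iff[OF M0 bdd, of "D + inverse (real (Suc n))"] by (simp add: D_def)
  then obtain y where y: "\<And>n. y n \<in> M" "\<And>n. (norm (x - y n))\<^sup>2 < D + inverse (real (Suc n))"
    by metis
  have diff: "(norm (y n - y m))\<^sup>2 \<le> 2 * inverse (real (Suc n)) + 2 * inverse (real (Suc m))" for n m
  proof -
    have "(1/2) *\<^sub>R (y n + y m) \<in> M"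
      using y(1) assms(2) by (simp add: subspace_add subspace_scale)
    then have "D \<le> (norm (x - (1/2) *\<^sub>R (y n + y m)))\<^sup>2" by (rule D_le)
    moreover have "(norm (y n - y m))\<^sup>2 = 2 * (norm (x - y n))\<^sup>2 + 2 * (norm (x - y m))\<^sup>2
        - 4 * (norm (x - (1/2) *\<^sub>R (y n + y m)))\<^sup>2"
      unfolding power2_norm_eq_inner by (simp add: algebra_simps inner_commute)
    ultimately show ?thesis using y(2)[of n] y(2)[of m] by simp
  qed
  have "Cauchy y"
  proof (rule metric_CauchyI)
    fix e :: real assume "e > 0"
    then obtain N where N: "inverse (real (Suc N)) < e\<^sup>2 / 4"
      using reals_Archimedean[of "e\<^sup>2 / 4"] by auto
    show "\<exists>N. \<forall>m\<ge>N. \<forall>n\<ge>N. dist (y m) (y n) < e"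
    proof (intro exI allI impI)
      fix m n assume "N \<le> m" "N \<le> n"
      then have "inverse (real (Suc m)) \<le> inverse (real (Suc N))"
          "inverse (real (Suc n)) \<le> inverse (real (Suc N))"
        by (auto intro!: le_imp_inverse_le)
      then have "(norm (y m - y n))\<^sup>2 < e\<^sup>2" using diff[of m n] N by linarith
      then show "dist (y m) (y n) < e"
        unfolding dist_norm using \<open>e > 0\<close> by (simp add: power2_less_imp_less)
    qed
  qed
  then obtain p where p: "y \<longlonglongrightarrow> p"
    using Cauchy_convergent convergent_def by blast
  have "p \<in> M"
    using assms(1) y(1) p by (auto simp: closed_sequential_limits)
  have "(norm (x - p))\<^sup>2 \<le> D"
  proof (rule LIMSEQ_le)
    show "(\<lambda>n. (norm (x - y n))\<^sup>2) \<longlonglongrightarrow> (norm (x - p))\<^sup>2" by (intro tendsto_intros p)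
    show "(\<lambda>n. D + inverse (real (Suc n))) \<longlonglongrightarrow> D"
      using tendsto_add[OF tendsto_const LIMSEQ_inverse_real_of_nat, of D] by simp
    show "\<exists>N. \<forall>n\<ge>N. (norm (x - y n))\<^sup>2 \<le> D + inverse (real (Suc n))"
      using y(2) less_imp_le by blast
  qed
  have "(x - p) \<bullet> z = 0" if "z \<in> M" for z
  proof (cases "z = 0")
    case False
    \<comment> \<open>This \<open>t\<close> minimizes the distance from \<open>x\<close> to the line through \<open>p\<close> in direction \<open>z\<close>.\<close>
    define t where "t = ((x - p) \<bullet> z) / (z \<bullet> z)"
    have "p + t *\<^sub>R z \<in> M" using \<open>p \<in> M\<close> that assms(2) by (simp add: subspace_add subspace_scale)
    then have "(norm (x - p))\<^sup>2 \<le> (norm (x - (p + t *\<^sub>R z)))\<^sup>2"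
      using D_le \<open>(norm (x - p))\<^sup>2 \<le> D\<close> by (meson order_trans)
    also have "\<dots> = (norm (x - p))\<^sup>2 - 2 * t * ((x - p) \<bullet> z) + t\<^sup>2 * (z \<bullet> z)"
      unfolding power2_norm_eq_inner
      by (simp add: algebra_simps inner_commute power2_eq_square)
    also have "\<dots> = (norm (x - p))\<^sup>2 - ((x - p) \<bullet> z)\<^sup>2 / (z \<bullet> z)"
      using False by (simp add: t_def power2_eq_square field_simps)
    finally have "((x - p) \<bullet> z)\<^sup>2 / (z \<bullet> z) \<le> 0" by simp
    moreover have "z \<bullet> z > 0" using False by simp
    ultimately have "((x - p) \<bullet> z)\<^sup>2 \<le> 0" by (simp add: divide_le_0_iff)
    then show ?thesis by simp
  qed simp
  with \<open>p \<in> M\<close> show ?thesis by (rule that)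
qed

text \<open>
  The representing vector is a multiple of any nonzero vector perpendicular to the kernel.
\<close>
lemma riesz_representation:
  fixes f :: "'a::{real_inner, banach} \<Rightarrow> real"
  assumes "bounded_linear f"
  obtains z where "\<And>x. f x = x \<bullet> z"
proof (cases "\<forall>x. f x = 0")
  case True
  then show ?thesis using that[of 0] by simp
next
  case False
  then obtain x where x: "f x \<noteq> 0" by auto
  interpret bounded_linear f by fact
  have "closed {u. f u = 0}"
    by (intro closed_Collect_eq continuous_on continuous_intros)
  moreover have "subspace {u. f u = 0}"
    by (auto simp: subspace_def zero add scaleR)
  ultimately obtain p where p: "f p = 0" "\<And>y. f y = 0 \<Longrightarrow> (x - p) \<bullet> y = 0"
    using orthogonal_decomposition[of "{u. f u = 0}" x] by auto
  define w where "w = x - p"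
  have fw: "f w = f x" by (simp add: w_def diff p)
  have "w \<noteq> 0" using x fw zero by auto
  have "f u = u \<bullet> ((f w / (w \<bullet> w)) *\<^sub>R w)" for u
  proof -
    have "f (u - (f u / f w) *\<^sub>R w) = 0" using x fw by (simp add: diff scaleR)
    then have "w \<bullet> (u - (f u / f w) *\<^sub>R w) = 0" using p(2) w_def by blast
    then have "w \<bullet> u = f u / f w * (w \<bullet> w)" by (simp add: inner_diff_right)
    then show ?thesis using \<open>w \<noteq> 0\<close> x fw by (simp add: inner_commute field_simps)
  qed
  then show ?thesis by (rule that)
qed

lemma adjoint_exists:
  fixes b :: "'a::{real_inner, banach} \<Rightarrow>\<^sub>L 'a"
  obtains d :: "'a \<Rightarrow>\<^sub>L 'a" where "\<And>x y. blinfun_apply b x \<bullet> y = x \<bullet> blinfun_apply d y"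
proof -
  have "\<exists>z. \<forall>x. blinfun_apply b x \<bullet> y = x \<bullet> z" for y
  proof -
    have "bounded_linear (\<lambda>x. blinfun_apply b x \<bullet> y)"
      by (intro bounded_linear_compose[OF bounded_linear_inner_left] blinfun.bounded_linear_right)
    then show ?thesis by (rule riesz_representation) blast
  qed
  then obtain f where f: "\<And>x y. blinfun_apply b x \<bullet> y = x \<bullet> f y" by metis
  have eqI: "u = v" if "\<And>x. x \<bullet> u = x \<bullet> v" for u v :: 'a
    using that[of "u - v"] by (metis inner_diff_right inner_eq_zero_iff right_minus_eq)
  have "bounded_linear f"
  proof (rule bounded_linear_intro[where K = "norm b"])
    show "f (x + y) = f x + f y" for x y
      by (rule eqI) (simp add: f[symmetric] inner_add_right)
    show "f (r *\<^sub>R x) = r *\<^sub>R f x" for r x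
      by (rule eqI) (simp add: f[symmetric])
    show "norm (f y) \<le> norm y * norm b" for y
    proof -
      have "(norm (f y))\<^sup>2 = blinfun_apply b (f y) \<bullet> y"
        by (simp add: f power2_norm_eq_inner)
      also have "\<dots> \<le> norm (blinfun_apply b (f y)) * norm y" by (rule norm_cauchy_schwarz)
      also have "\<dots> \<le> norm b * norm (f y) * norm y"
        by (intro mult_right_mono norm_blinfun) auto
      finally have "norm (f y) * norm (f y) \<le> (norm b * norm y) * norm (f y)"
        by (simp add: power2_eq_square mult_ac)
      then show ?thesis
        by (cases "norm (f y) = 0") (auto simp: mult.commute mult_le_cancel_right)
    qed
  qed
  then show ?thesis using that[of "Blinfun f"] f by (simp add: bounded_linear_Blinfun_apply)
qed

lemma inner_ext: "(\<And>x. x \<bullet> u = x \<bullet> v) \<Longrightarrow> u = v" for u v :: "'a::real_inner"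
  by (metis inner_diff_right inner_eq_zero_iff right_minus_eq)

text \<open>
  The adjoint is taken with respect to the complex inner product; on complex-linear operators
  it is already determined by the real inner product.
\<close>

lemma adj_eqI:
  assumes b: "b \<in> bounded_ops" and d: "\<And>x y. blinfun_apply b x \<bullet> y = x \<bullet> blinfun_apply d y"
  shows "adj b = d"
  unfolding adj_def
proof (rule the_equality)
  show "\<forall>x y. cinner (blinfun_apply b x) y = cinner x (blinfun_apply d y)"
    unfolding cinner_eq using bounded_opsD[OF b] d by metis
next
  fix e assume "\<forall>x y. cinner (blinfun_apply b x) y = cinner x (blinfun_apply e y)"
  then have "x \<bullet> blinfun_apply e y = x \<bullet> blinfun_apply d y" for x y
    by (metis Re_cinner d)
  then show "e = d" by (metis blinfun_eqI inner_ext)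
qed

lemma
  assumes b: "b \<in> bounded_ops"
  shows inner_adj: "blinfun_apply b x \<bullet> y = x \<bullet> blinfun_apply (adj b) y"
    and inner_adj': "x \<bullet> blinfun_apply b y = blinfun_apply (adj b) x \<bullet> y"
    and adj_bounded_ops: "adj b \<in> bounded_ops"
proof -
  obtain d where d: "\<And>x y. blinfun_apply b x \<bullet> y = x \<bullet> blinfun_apply d y"
    using adjoint_exists by blast
  then have eq: "adj b = d" using adj_eqI[OF b] by blast
  show *: "blinfun_apply b x \<bullet> y = x \<bullet> blinfun_apply (adj b) y" for x y
    using d eq by simp
  show "x \<bullet> blinfun_apply b y = blinfun_apply (adj b) x \<bullet> y"
    using *[of y x] by (simp add: inner_commute)
  have "blinfun_apply d (c *\<^sub>C y) = c *\<^sub>C blinfun_apply d y" for c y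
  proof (rule inner_ext)
    fix x
    have "x \<bullet> blinfun_apply d (c *\<^sub>C y) = blinfun_apply b (cnj c *\<^sub>C x) \<bullet> y"
      by (simp add: d[symmetric] bounded_opsD[OF b] inner_scaleC_left)
    also have "\<dots> = x \<bullet> c *\<^sub>C blinfun_apply d y"
      by (simp add: d inner_scaleC_left)
    finally show "x \<bullet> blinfun_apply d (c *\<^sub>C y) = x \<bullet> c *\<^sub>C blinfun_apply d y" .
  qed
  then show "adj b \<in> bounded_ops" by (simp add: eq bounded_ops_def)
qed

lemma cinner_adj: "b \<in> bounded_ops \<Longrightarrow>
    cinner (blinfun_apply b x) y = cinner x (blinfun_apply (adj b) y)"
  unfolding cinner_eq by (simp add: bounded_opsD[symmetric] inner_adj)

lemma adj_adj: "b \<in> bounded_ops \<Longrightarrow> adj (adj b) = b"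
  by (intro adj_eqI) (auto simp: adj_bounded_ops inner_adj')

lemma adj_add: "b \<in> bounded_ops \<Longrightarrow> d \<in> bounded_ops \<Longrightarrow> adj (b + d) = adj b + adj d"
  by (intro adj_eqI) (auto simp: bounded_ops_intros apply_simps inner_adj algebra_simps)

lemma adj_diff: "b \<in> bounded_ops \<Longrightarrow> d \<in> bounded_ops \<Longrightarrow> adj (b - d) = adj b - adj d"
  by (intro adj_eqI) (auto simp: bounded_ops_intros apply_simps inner_adj algebra_simps)

lemma adj_compose: "b \<in> bounded_ops \<Longrightarrow> d \<in> bounded_ops \<Longrightarrow> adj (b o\<^sub>L d) = adj d o\<^sub>L adj b"
  by (intro adj_eqI) (auto simp: bounded_ops_intros inner_adj)

lemma adj_scale: "b \<in> bounded_ops \<Longrightarrow> adj (scale_op c b) = scale_op (cnj c) (adj b)"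
  by (intro adj_eqI) (auto simp: bounded_ops_intros inner_adj inner_scaleC_left bounded_opsD adj_bounded_ops)

lemma adj_id: "adj id_blinfun = id_blinfun"
  by (intro adj_eqI) (auto simp: bounded_ops_intros)

lemma adj_zero: "adj 0 = 0"
  by (intro adj_eqI) (auto simp: bounded_ops_intros)

lemma norm_adj_le:
  assumes b: "b \<in> bounded_ops"
  shows "norm (adj b) \<le> norm b"
proof (rule norm_blinfun_bound)
  fix y
  let ?f = "blinfun_apply (adj b) y"
  have "(norm ?f)\<^sup>2 = blinfun_apply b ?f \<bullet> y"
    by (simp add: inner_adj[OF b] power2_norm_eq_inner)
  also have "\<dots> \<le> norm (blinfun_apply b ?f) * norm y" by (rule norm_cauchy_schwarz)
  also have "\<dots> \<le> norm b * norm ?f * norm y"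
    by (intro mult_right_mono norm_blinfun) auto
  finally have "norm ?f * norm ?f \<le> (norm b * norm y) * norm ?f"
    by (simp add: power2_eq_square mult_ac)
  then show "norm ?f \<le> norm b * norm y"
    by (cases "norm ?f = 0") (auto simp: mult_le_cancel_right)
qed simp

lemma norm_adj: "b \<in> bounded_ops \<Longrightarrow> norm (adj b) = norm b"
  by (metis adj_adj adj_bounded_ops norm_adj_le order_antisym)

definition self_adjoint :: "('h::complex_hilbert \<Rightarrow>\<^sub>L 'h) \<Rightarrow> bool"
  where "self_adjoint T \<longleftrightarrow> T \<in> bounded_ops \<and> adj T = T"

lemma self_adjointI:
  assumes "T \<in> bounded_ops" "\<And>x y. blinfun_apply T x \<bullet> y = x \<bullet> blinfun_apply T y"
  shows "self_adjoint T"
  using assms by (simp add: self_adjoint_def adj_eqI)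

lemma self_adjoint_ops: "self_adjoint T \<Longrightarrow> T \<in> bounded_ops"
  by (simp add: self_adjoint_def)

lemma self_adjointD:
  "self_adjoint T \<Longrightarrow> blinfun_apply T x \<bullet> y = x \<bullet> blinfun_apply T y"
  by (metis inner_adj self_adjoint_def)

lemma self_adjoint_id: "self_adjoint id_blinfun"
  and self_adjoint_zero: "self_adjoint 0"
  by (simp_all add: self_adjoint_def bounded_ops_id bounded_ops_zero adj_id adj_zero)

lemma self_adjoint_add: "self_adjoint S \<Longrightarrow> self_adjoint T \<Longrightarrow> self_adjoint (S + T)"
  and self_adjoint_diff: "self_adjoint S \<Longrightarrow> self_adjoint T \<Longrightarrow> self_adjoint (S - T)"
  by (simp_all add: self_adjoint_def bounded_ops_add bounded_ops_diff adj_add adj_diff)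

lemma self_adjoint_scaleR: "self_adjoint S \<Longrightarrow> self_adjoint (r *\<^sub>R S)"
  by (rule self_adjointI)
    (simp_all add: bounded_ops_scaleR self_adjoint_ops apply_simps self_adjointD)

lemma is_projection_iff:
  "is_projection P \<longleftrightarrow> self_adjoint P \<and> (\<forall>x. blinfun_apply P (blinfun_apply P x) = blinfun_apply P x)"
proof -
  have "P o\<^sub>L P = P \<longleftrightarrow> (\<forall>x. blinfun_apply P (blinfun_apply P x) = blinfun_apply P x)"
    by (metis blinfun_eqI compose_apply)
  then show ?thesis
    unfolding is_projection_def self_adjoint_def by blast
qed

lemma
  assumes "is_projection P"
  shows projection_self_adjoint: "self_adjoint P"
    and projection_ops: "P \<in> bounded_ops"
    and projection_idem: "blinfun_apply P (blinfun_apply P x) = blinfun_apply P x"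
    and projection_inner: "blinfun_apply P x \<bullet> x = (norm (blinfun_apply P x))\<^sup>2"
    and projection_compose_self: "P o\<^sub>L P = P"
proof -
  show sa: "self_adjoint P" and idem: "blinfun_apply P (blinfun_apply P x) = blinfun_apply P x" for x
    using assms is_projection_iff by blast+
  then show "P \<in> bounded_ops" by (simp add: self_adjoint_ops)
  show "blinfun_apply P x \<bullet> x = (norm (blinfun_apply P x))\<^sup>2"
    unfolding power2_norm_eq_inner by (metis idem sa self_adjointD)
  show "P o\<^sub>L P = P" using assms by (simp add: is_projection_def)
qed

lemma is_projection_zero: "is_projection 0"
  and is_projection_id: "is_projection id_blinfun"
  by (auto simp: is_projection_iff self_adjoint_id self_adjoint_zero)

lemma is_projection_compl: "is_projection P \<Longrightarrow> is_projection (id_blinfun - P)"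
  by (auto simp: is_projection_iff self_adjoint_diff self_adjoint_id apply_simps)

lemma is_projection_commuting_compose:
  assumes "is_projection P" "is_projection Q" "P o\<^sub>L Q = Q o\<^sub>L P"
  shows "is_projection (P o\<^sub>L Q)"
proof -
  have c: "blinfun_apply P (blinfun_apply Q x) = blinfun_apply Q (blinfun_apply P x)" for x
    using assms(3) by (rule compose_eqD)
  have "self_adjoint (P o\<^sub>L Q)"
    using assms(1,2) c
    by (auto intro!: self_adjointI bounded_ops_intros simp: projection_ops
        self_adjointD[OF projection_self_adjoint])
  then show ?thesis
    using assms(1,2) c by (auto simp: is_projection_iff) 
qed

lemma projection_norm_le:
  assumes "is_projection P"
  shows "norm (blinfun_apply P x) \<le> norm x"
proof -
  have "(norm (blinfun_apply P x))\<^sup>2 \<le> norm (blinfun_apply P x) * norm x"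
    using norm_cauchy_schwarz[of "blinfun_apply P x" x] projection_inner[OF assms] by simp
  then show ?thesis
    by (cases "norm (blinfun_apply P x) = 0") (auto simp: power2_eq_square mult_le_cancel_left)
qed

lemma projection_norm_le_1: "is_projection P \<Longrightarrow> norm P \<le> 1"
  by (rule norm_blinfun_bound) (auto simp: projection_norm_le)

lemma closed_subspace_projection:
  fixes M :: "'h::complex_hilbert set"
  assumes "closed M" "subspace M" "\<And>c x. x \<in> M \<Longrightarrow> c *\<^sub>C x \<in> M"
  obtains P where "is_projection P" "\<And>x. blinfun_apply P x \<in> M" "\<And>x. x \<in> M \<Longrightarrow> blinfun_apply P x = x"
proof -
  have "\<exists>p. p \<in> M \<and> (\<forall>y\<in>M. (x - p) \<bullet> y = 0)" for x
    by (rule orthogonal_decomposition[OF assms(1,2), of x]) blast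
  then obtain f where f: "\<And>x. f x \<in> M" "\<And>x y. y \<in> M \<Longrightarrow> (x - f x) \<bullet> y = 0"
    by metis
  have uniq: "f x = p" if "p \<in> M" "\<And>y. y \<in> M \<Longrightarrow> (x - p) \<bullet> y = 0" for x p
  proof -
    have "f x - p \<in> M" using f(1) that(1) assms(2) by (simp add: subspace_diff)
    then have "(x - f x) \<bullet> (f x - p) = 0" "(x - p) \<bullet> (f x - p) = 0" using f(2) that(2) by auto
    then have "(f x - p) \<bullet> (f x - p) = 0" by (simp add: inner_diff_left)
    then show ?thesis by simp
  qed
  have fM: "f x = x" if "x \<in> M" for x by (rule uniq) (use that in auto)
  have scale: "f (c *\<^sub>C x) = c *\<^sub>C f x" for c x
  proof (rule uniq)
    fix y assume "y \<in> M"
    then have "(x - f x) \<bullet> (cnj c *\<^sub>C y) = 0" using assms(3) f(2) by blast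
    then show "(c *\<^sub>C x - c *\<^sub>C f x) \<bullet> y = 0"
      by (simp add: scaleC_diff_right[symmetric] inner_scaleC_left)
  qed (simp add: assms(3) f)
  have "bounded_linear f"
  proof (rule bounded_linear_intro[where K = 1])
    show "f (x + y) = f x + f y" for x y
    proof (rule uniq)
      show "f x + f y \<in> M" using f(1) assms(2) by (simp add: subspace_add)
      fix z assume "z \<in> M"
      then have "(x - f x) \<bullet> z = 0" "(y - f y) \<bullet> z = 0" using f(2) by auto
      then show "(x + y - (f x + f y)) \<bullet> z = 0" by (simp add: inner_diff_left inner_add_left)
    qed
    show "f (r *\<^sub>R x) = r *\<^sub>R f x" for r x
      using scale[of "complex_of_real r"] by (simp add: scaleC_of_real)
    show "norm (f x) \<le> norm x * 1" for x
    proof -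
      have "f x \<bullet> f x = x \<bullet> f x" using f(2)[OF f(1), of x] by (simp add: inner_diff_left)
      then have "norm (f x) * norm (f x) \<le> norm x * norm (f x)"
        using norm_cauchy_schwarz[of x "f x"] by (simp add: power2_norm_eq_inner[symmetric] power2_eq_square)
      then show ?thesis by (cases "norm (f x) = 0") (auto simp: mult_le_cancel_right)
    qed
  qed
  then have app: "blinfun_apply (Blinfun f) x = f x" for x by (simp add: bounded_linear_Blinfun_apply)
  have "is_projection (Blinfun f)"
    unfolding is_projection_iff app
  proof (intro conjI allI self_adjointI)
    show "Blinfun f \<in> bounded_ops" by (simp add: bounded_ops_def app scale)
    show "f (f x) = f x" for x by (simp add: fM f)
    show "blinfun_apply (Blinfun f) x \<bullet> y = x \<bullet> blinfun_apply (Blinfun f) y" for x y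
    proof -
      have "x \<bullet> f y = f x \<bullet> f y" "y \<bullet> f x = f y \<bullet> f x"
        using f(2)[OF f(1), of x y] f(2)[OF f(1), of y x] by (simp_all add: inner_diff_left)
      then show ?thesis unfolding app by (metis inner_commute)
    qed
  qed
  then show ?thesis by (rule that) (auto simp: app f fM)
qed

text \<open>A self-adjoint operator is determined, also in norm, by its quadratic form.\<close>

lemma self_adjoint_norm_le:
  assumes T: "self_adjoint T" and w: "0 \<le> w"
    and q: "\<And>x. \<bar>blinfun_apply T x \<bullet> x\<bar> \<le> w * (norm x)\<^sup>2"
  shows "norm T \<le> w"
proof (rule norm_blinfun_bound[OF w])
  fix x
  let ?y = "blinfun_apply T x"
  show "norm ?y \<le> w * norm x"
  proof (cases "?y = 0 \<or> x = 0")
    case True then show ?thesis using w by auto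
  next
    case False
    \<comment> \<open>Polarization is sharp for vectors of equal length, so the image of \<open>x\<close> is rescaled.\<close>
    define r where "r = norm x / norm ?y"
    define y where "y = r *\<^sub>R ?y"
    have ny: "norm y = norm x" using False by (simp add: y_def r_def)
    have "4 * (?y \<bullet> y) = blinfun_apply T (x + y) \<bullet> (x + y) - blinfun_apply T (x - y) \<bullet> (x - y)"
      using self_adjointD[OF T, of y x]
      by (simp add: apply_simps inner_add_left inner_add_right inner_diff_left inner_diff_right
          inner_commute)
    also have "\<dots> \<le> w * (norm (x + y))\<^sup>2 + w * (norm (x - y))\<^sup>2"
      using q[of "x + y"] q[of "x - y"] by linarith
    also have "\<dots> = w * (2 * (norm x)\<^sup>2 + 2 * (norm y)\<^sup>2)"
      unfolding power2_norm_eq_inner by (simp add: algebra_simps inner_commute)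
    finally have "?y \<bullet> y \<le> w * (norm x)\<^sup>2" by (simp add: ny)
    moreover have "?y \<bullet> y = norm x * norm ?y"
      using False by (simp add: y_def r_def power2_norm_eq_inner[symmetric] power2_eq_square)
    ultimately have "norm x * norm ?y \<le> norm x * (w * norm x)" by (simp add: power2_eq_square mult_ac)
    then show ?thesis using False by simp
  qed
qed

lemma self_adjoint_eqI:
  assumes "self_adjoint S" "self_adjoint T"
    and "\<And>x. blinfun_apply S x \<bullet> x = blinfun_apply T x \<bullet> x"
  shows "S = T"
proof -
  have "norm (S - T) \<le> 0"
    using assms by (intro self_adjoint_norm_le self_adjoint_diff) (auto simp: apply_simps inner_diff_left)
  then show ?thesis by simp
qed

section \<open>Square roots and spectral projections\<close>

text \<open>
  \<open>1 - y\<close> is the square root of \<open>1 - X\<close> as soon as \<open>y = (X + y\<^sup>2) / 2\<close>. The iteration for this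
  equation is dominated by the scalar iteration \<open>q \<mapsto> (1 + q\<^sup>2) / 2\<close>, hence it converges in norm;
  this is what puts \<open>y\<close> into every closed set that the iteration does not leave.
\<close>

primrec sqrt_bound :: "nat \<Rightarrow> real"
  where "sqrt_bound 0 = 0"
  | "sqrt_bound (Suc n) = (1 + (sqrt_bound n)\<^sup>2) / 2"

primrec sqrt_iter :: "('a::real_normed_vector \<Rightarrow>\<^sub>L 'a) \<Rightarrow> nat \<Rightarrow> ('a \<Rightarrow>\<^sub>L 'a)"
  where "sqrt_iter X 0 = 0"
  | "sqrt_iter X (Suc n) = (1/2) *\<^sub>R (X + (sqrt_iter X n o\<^sub>L sqrt_iter X n))"

lemma sqrt_bound_range: "0 \<le> sqrt_bound n \<and> sqrt_bound n \<le> 1"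
  by (induction n) (auto simp: power_le_one)

lemma norm_compose_mono:
  "norm f \<le> c \<Longrightarrow> norm g \<le> d \<Longrightarrow> norm (f o\<^sub>L g) \<le> c * d"
  by (meson mult_mono norm_blinfun_compose norm_ge_zero order_trans)

lemma norm_sqrt_iter: "norm X \<le> 1 \<Longrightarrow> norm (sqrt_iter X n) \<le> sqrt_bound n"
proof (induction n)
  case (Suc n)
  have "norm (X + (sqrt_iter X n o\<^sub>L sqrt_iter X n)) \<le> 1 + sqrt_bound n * sqrt_bound n"
    using Suc by (intro norm_triangle_le add_mono norm_compose_mono) auto
  then show ?case by (simp add: power2_eq_square)
qed simp

lemma norm_sqrt_iter_step:
  assumes "norm X \<le> 1"
  shows "norm (sqrt_iter X (Suc n) - sqrt_iter X n) \<le> sqrt_bound (Suc n) - sqrt_bound n"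
proof (induction n)
  case 0
  then show ?case using assms by simp
next
  case (Suc n)
  define u v where "u = sqrt_iter X n" and "v = sqrt_iter X (Suc n)"
  have "sqrt_iter X (Suc (Suc n)) - v
      = (1/2) *\<^sub>R (X + (v o\<^sub>L v)) - (1/2) *\<^sub>R (X + (u o\<^sub>L u))"
    by (simp add: u_def v_def)
  also have "\<dots> = (1/2) *\<^sub>R ((v o\<^sub>L (v - u)) + ((v - u) o\<^sub>L u))"
    by (rule blinfun_eqI) (simp add: apply_simps algebra_simps)
  also have "norm \<dots> \<le> (1/2) * (sqrt_bound (Suc n) * (sqrt_bound (Suc n) - sqrt_bound n)
      + (sqrt_bound (Suc n) - sqrt_bound n) * sqrt_bound n)"
  proof -
    have "norm u \<le> sqrt_bound n" "norm v \<le> sqrt_bound (Suc n)"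
        "norm (v - u) \<le> sqrt_bound (Suc n) - sqrt_bound n"
      unfolding u_def v_def using Suc norm_sqrt_iter[OF assms] by blast+
    then have "norm ((v o\<^sub>L (v - u)) + ((v - u) o\<^sub>L u)) \<le>
        sqrt_bound (Suc n) * (sqrt_bound (Suc n) - sqrt_bound n)
        + (sqrt_bound (Suc n) - sqrt_bound n) * sqrt_bound n"
      by (intro norm_triangle_le add_mono norm_compose_mono)
    then show ?thesis by simp
  qed
  also have "\<dots> = sqrt_bound (Suc (Suc n)) - sqrt_bound (Suc n)"
    by (subst (5) sqrt_bound.simps) (simp add: power2_eq_square field_simps)
  finally show ?case by (simp add: v_def)
qed

lemma sqrt_iter_limit:
  fixes X :: "'a::banach \<Rightarrow>\<^sub>L 'a"
  assumes X: "norm X \<le> 1"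
  obtains y where "y = (1/2) *\<^sub>R (X + (y o\<^sub>L y))" "norm y \<le> 1"
    "\<And>S. closed S \<Longrightarrow> 0 \<in> S \<Longrightarrow> (\<And>z. z \<in> S \<Longrightarrow> (1/2) *\<^sub>R (X + (z o\<^sub>L z)) \<in> S) \<Longrightarrow> y \<in> S"
proof -
  let ?y = "sqrt_iter X"
  have mono: "sqrt_bound n \<le> sqrt_bound (Suc n)" for n
    using norm_sqrt_iter_step[OF X, of n] norm_ge_zero[of "?y (Suc n) - ?y n"] by linarith
  then have "incseq sqrt_bound" by (rule incseq_SucI)
  then obtain L where "sqrt_bound \<longlonglongrightarrow> L"
    using incseq_convergent[of sqrt_bound 1] sqrt_bound_range by blast
  then have C: "Cauchy sqrt_bound" by (rule LIMSEQ_imp_Cauchy)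
  have diff: "norm (?y (n + k) - ?y n) \<le> sqrt_bound (n + k) - sqrt_bound n" for n k
  proof (induction k)
    case (Suc k)
    have "norm (?y (n + Suc k) - ?y n) \<le> norm (?y (Suc (n + k)) - ?y (n + k)) + norm (?y (n + k) - ?y n)"
      using norm_triangle_ineq[of "?y (Suc (n + k)) - ?y (n + k)" "?y (n + k) - ?y n"] by simp
    then show ?case using Suc norm_sqrt_iter_step[OF X, of "n + k"] by simp
  qed simp
  have "Cauchy ?y"
  proof (rule CauchyI')
    fix e :: real assume "e > 0"
    then obtain M where M: "\<And>m n. m \<ge> M \<Longrightarrow> n \<ge> M \<Longrightarrow> norm (sqrt_bound m - sqrt_bound n) < e"
      using CauchyD[OF C] by blast
    have "dist (?y m) (?y n) < e" if "M \<le> m" "m < n" for m n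
      using diff[of m "n - m"] M[of n m] that by (simp add: dist_norm norm_minus_commute)
    then show "\<exists>M. \<forall>m\<ge>M. \<forall>n>m. dist (?y m) (?y n) < e" by blast
  qed
  then obtain y where y: "?y \<longlonglongrightarrow> y"
    using Cauchy_convergent convergent_def by blast
  have "(\<lambda>n. ?y (Suc n)) \<longlonglongrightarrow> (1/2) *\<^sub>R (X + (y o\<^sub>L y))"
    unfolding sqrt_iter.simps
    by (intro tendsto_intros y bounded_bilinear.tendsto[OF bounded_bilinear_blinfun_compose])
  then have eq: "y = (1/2) *\<^sub>R (X + (y o\<^sub>L y))"
    using LIMSEQ_Suc[OF y] LIMSEQ_unique by blast
  have inv: "y \<in> S" if "closed S" "0 \<in> S" "\<And>z. z \<in> S \<Longrightarrow> (1/2) *\<^sub>R (X + (z o\<^sub>L z)) \<in> S" for S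
  proof -
    have "?y n \<in> S" for n using that(2,3) by (induction n) auto
    then show ?thesis using that(1) y by (auto simp: closed_sequential_limits)
  qed
  have "y \<in> cball 0 1"
  proof (rule inv)
    fix z :: "'a \<Rightarrow>\<^sub>L 'a" assume "z \<in> cball 0 1"
    then have "norm (X + (z o\<^sub>L z)) \<le> 1 + 1 * 1"
      using X by (intro norm_triangle_le add_mono norm_compose_mono) auto
    then show "(1/2) *\<^sub>R (X + (z o\<^sub>L z)) \<in> cball 0 1" by simp
  qed auto
  then show ?thesis using eq inv that[of y] by simp
qed

lemma closed_commutant: "closed {z. T o\<^sub>L z = z o\<^sub>L T}"
  by (intro closed_Collect_eq
      bounded_linear.continuous_on[OF bounded_bilinear.bounded_linear_right[OF bounded_bilinear_blinfun_compose]]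
      bounded_linear.continuous_on[OF bounded_bilinear.bounded_linear_left[OF bounded_bilinear_blinfun_compose]]
      continuous_intros)

lemma self_adjoint_square: "self_adjoint T \<Longrightarrow> self_adjoint (T o\<^sub>L T)"
  by (simp add: self_adjoint_def bounded_ops_compose adj_compose)

lemma self_adjoint_compression:
  "self_adjoint F \<Longrightarrow> self_adjoint T \<Longrightarrow> self_adjoint (F o\<^sub>L T o\<^sub>L F)"
  by (simp add: self_adjoint_def bounded_ops_compose adj_compose compose_assoc)

lemma closed_self_adjoint: "closed {T :: 'h::complex_hilbert \<Rightarrow>\<^sub>L 'h. self_adjoint T}"
proof -
  have "{T :: 'h \<Rightarrow>\<^sub>L 'h. self_adjoint T} =
      bounded_ops \<inter> {T. \<forall>x y. blinfun_apply T x \<bullet> y = x \<bullet> blinfun_apply T y}"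
    by (auto simp: self_adjoint_ops self_adjointD intro: self_adjointI)
  moreover have "closed {T :: 'h \<Rightarrow>\<^sub>L 'h. \<forall>x y. blinfun_apply T x \<bullet> y = x \<bullet> blinfun_apply T y}"
    by (intro closed_Collect_all closed_Collect_eq continuous_intros)
  ultimately show ?thesis by (simp add: closed_Int closed_bounded_ops)
qed

text \<open>
  With \<open>s = \<bar>h\<bar>\<close> the projection onto the kernel of \<open>\<bar>h\<bar> + h\<close> separates the negative from the
  positive part of \<open>h\<close>.
\<close>

lemma negative_projection:
  fixes h :: "'h::complex_hilbert \<Rightarrow>\<^sub>L 'h"
  assumes h: "self_adjoint h"
  obtains P where "is_projection P"
    "\<And>x. blinfun_apply P x = x \<Longrightarrow> blinfun_apply h x \<bullet> x \<le> 0"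
    "\<And>x. blinfun_apply P x = 0 \<Longrightarrow> 0 \<le> blinfun_apply h x \<bullet> x"
    "\<And>T. self_adjoint T \<Longrightarrow> T o\<^sub>L h = h o\<^sub>L T \<Longrightarrow> T o\<^sub>L P = P o\<^sub>L T"
proof (cases "h = 0")
  case True
  then show ?thesis by (intro that[of id_blinfun] is_projection_id) (auto intro!: blinfun_eqI)
next
  case False
  define k where "k = inverse (norm h) *\<^sub>R h"
  have k: "self_adjoint k" by (simp add: k_def h self_adjoint_scaleR)
  have nk: "norm (blinfun_apply k x) \<le> norm x" for x
    using norm_blinfun[of k x] False by (simp add: k_def)
  have hk: "h = norm h *\<^sub>R k" using False by (simp add: k_def)
  define X where "X = id_blinfun - (k o\<^sub>L k)"
  have X: "self_adjoint X"
    unfolding X_def using k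
    by (intro self_adjoint_diff self_adjoint_id self_adjointI)
      (auto simp: bounded_ops_compose self_adjoint_ops self_adjointD)
  have "norm X \<le> 1"
  proof (rule norm_blinfun_bound)
    fix x
    let ?u = "blinfun_apply k x"
    have "(norm (blinfun_apply X x))\<^sup>2 = (norm x)\<^sup>2 - 2 * (norm ?u)\<^sup>2 + (norm (blinfun_apply k ?u))\<^sup>2"
      unfolding X_def power2_norm_eq_inner
      by (simp add: apply_simps inner_diff_left inner_diff_right self_adjointD[OF k] inner_commute)
    also have "\<dots> \<le> (norm x)\<^sup>2"
      using power_mono[OF nk[of ?u] norm_ge_zero, of 2] zero_le_power2[of "norm ?u"] by linarith
    finally show "norm (blinfun_apply X x) \<le> 1 * norm x" by (simp add: power2_le_iff_abs_le)
  qed simp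
  then obtain y where y: "y = (1/2) *\<^sub>R (X + (y o\<^sub>L y))" "norm y \<le> 1" and
    inv: "\<And>S. closed S \<Longrightarrow> 0 \<in> S \<Longrightarrow> (\<And>z. z \<in> S \<Longrightarrow> (1/2) *\<^sub>R (X + (z o\<^sub>L z)) \<in> S) \<Longrightarrow> y \<in> S"
    using sqrt_iter_limit by blast
  have y_sa: "self_adjoint y"
  proof -
    have "y \<in> {T. self_adjoint T}"
    proof (rule inv[OF closed_self_adjoint])
      fix z :: "'h \<Rightarrow>\<^sub>L 'h" assume "z \<in> {T. self_adjoint T}"
      then show "(1/2) *\<^sub>R (X + (z o\<^sub>L z)) \<in> {T. self_adjoint T}"
        using X by (simp add: self_adjoint_scaleR self_adjoint_add self_adjoint_square)
    qed (simp add: self_adjoint_zero)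
    then show ?thesis by simp
  qed
  have y_comm: "T o\<^sub>L y = y o\<^sub>L T" if T: "T o\<^sub>L k = k o\<^sub>L T" for T
  proof -
    have Tk: "blinfun_apply T (blinfun_apply k x) = blinfun_apply k (blinfun_apply T x)" for x
      using T by (rule compose_eqD)
    have "y \<in> {z. T o\<^sub>L z = z o\<^sub>L T}"
    proof (rule inv[OF closed_commutant])
      fix z assume "z \<in> {z. T o\<^sub>L z = z o\<^sub>L T}"
      then have "T o\<^sub>L z = z o\<^sub>L T" by simp
      note compose_eqD[OF this]
      with Tk show "(1/2) *\<^sub>R (X + (z o\<^sub>L z)) \<in> {z. T o\<^sub>L z = z o\<^sub>L T}"
        by (auto intro!: blinfun_eqI simp: X_def apply_simps)
    qed (auto intro!: blinfun_eqI)
    then show ?thesis by simp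
  qed
  define s where "s = id_blinfun - y"
  have s: "self_adjoint s" by (simp add: s_def y_sa self_adjoint_diff self_adjoint_id)
  have s_pos: "0 \<le> blinfun_apply s x \<bullet> x" for x
  proof -
    have "blinfun_apply y x \<bullet> x \<le> norm (blinfun_apply y x) * norm x" by (rule norm_cauchy_schwarz)
    also have "\<dots> \<le> norm x * norm x"
      using norm_blinfun[of y x] mult_right_mono[OF y(2) norm_ge_zero[of x]]
      by (intro mult_right_mono) auto
    finally show ?thesis by (simp add: s_def apply_simps inner_diff_left power2_norm_eq_inner[symmetric] power2_eq_square)
  qed
  have s_comm: "T o\<^sub>L s = s o\<^sub>L T" if "T o\<^sub>L k = k o\<^sub>L T" for T
  proof (rule blinfun_eqI)
    fix x
    have "blinfun_apply T (blinfun_apply y x) = blinfun_apply y (blinfun_apply T x)"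
      using y_comm[OF that] by (rule compose_eqD)
    then show "blinfun_apply (T o\<^sub>L s) x = blinfun_apply (s o\<^sub>L T) x" by (simp add: s_def apply_simps)
  qed
  have sk: "blinfun_apply s (blinfun_apply k x) = blinfun_apply k (blinfun_apply s x)" for x
    using compose_eqD[OF s_comm[of k]] by simp
  have ss: "blinfun_apply s (blinfun_apply s x) = blinfun_apply k (blinfun_apply k x)" for x
  proof -
    have "blinfun_apply y x = (1/2) *\<^sub>R (blinfun_apply X x + blinfun_apply y (blinfun_apply y x))"
      using arg_cong[OF y(1), of "\<lambda>f. blinfun_apply f x"] by (simp add: apply_simps)
    then have "2 *\<^sub>R blinfun_apply y x = blinfun_apply X x + blinfun_apply y (blinfun_apply y x)"
      by (metis scaleR_half_double scaleR_2 scaleR_right_distrib)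
    then show ?thesis by (simp add: s_def X_def apply_simps scaleR_2 algebra_simps)
  qed
  define K where "K = {x. blinfun_apply s x + blinfun_apply k x = 0}"
  have "closed K" unfolding K_def by (intro closed_Collect_eq continuous_intros)
  moreover have "subspace K"
    by (auto simp: K_def subspace_def apply_simps algebra_simps simp flip: scaleR_add_right)
  moreover have "c *\<^sub>C x \<in> K" if "x \<in> K" for c x
    using that bounded_opsD[OF self_adjoint_ops[OF s]] bounded_opsD[OF self_adjoint_ops[OF k]]
    by (simp add: K_def flip: scaleC_add_right)
  ultimately obtain P where P: "is_projection P" "\<And>x. blinfun_apply P x \<in> K"
      "\<And>x. x \<in> K \<Longrightarrow> blinfun_apply P x = x"
    using closed_subspace_projection by metis
  have perp: "u \<bullet> z = 0" if "blinfun_apply P u = 0" "z \<in> K" for u z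
    using self_adjointD[OF projection_self_adjoint[OF P(1)], of u z] that P(3) by simp
  show ?thesis
  proof (rule that[OF P(1)])
    fix x assume "blinfun_apply P x = x"
    then have "blinfun_apply k x = - blinfun_apply s x"
      using P(2)[of x] by (simp add: K_def add_eq_0_iff)
    then have "blinfun_apply k x \<bullet> x \<le> 0" using s_pos[of x] by simp
    then show "blinfun_apply h x \<bullet> x \<le> 0"
      by (subst hk) (simp add: apply_simps mult_nonneg_nonpos)
  next
    fix x assume x: "blinfun_apply P x = 0"
    \<comment> \<open>\<open>(s + k)(s - k) = s\<^sup>2 - k\<^sup>2 = 0\<close>, so \<open>s - k\<close> maps into the kernel of \<open>s + k\<close>.\<close>
    have "blinfun_apply s z - blinfun_apply k z \<in> K" for z
      by (simp add: K_def apply_simps ss sk)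
    then have "x \<bullet> (blinfun_apply s z - blinfun_apply k z) = 0" for z using perp[OF x] by blast
    then have "(blinfun_apply s x - blinfun_apply k x) \<bullet> z = 0" for z
      by (simp add: inner_diff_left inner_diff_right self_adjointD[OF s] self_adjointD[OF k])
    then have "blinfun_apply s x - blinfun_apply k x = 0" by (metis inner_eq_zero_iff)
    then have "0 \<le> blinfun_apply k x \<bullet> x" using s_pos[of x] by simp
    then show "0 \<le> blinfun_apply h x \<bullet> x"
      by (subst hk) (simp add: apply_simps)
  next
    fix T assume T: "self_adjoint T" and Th: "T o\<^sub>L h = h o\<^sub>L T"
    have "blinfun_apply T (blinfun_apply h x) = blinfun_apply h (blinfun_apply T x)" for x
      using Th by (rule compose_eqD)
    then have Tk: "T o\<^sub>L k = k o\<^sub>L T" by (intro blinfun_eqI) (simp add: k_def apply_simps)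
    have TK: "blinfun_apply T x \<in> K" if "x \<in> K" for x
    proof -
      have "blinfun_apply s (blinfun_apply T x) = blinfun_apply T (blinfun_apply s x)"
          "blinfun_apply k (blinfun_apply T x) = blinfun_apply T (blinfun_apply k x)"
        using compose_eqD[OF s_comm[OF Tk]] compose_eqD[OF Tk] by simp_all
      then have "blinfun_apply s (blinfun_apply T x) + blinfun_apply k (blinfun_apply T x)
          = blinfun_apply T (blinfun_apply s x + blinfun_apply k x)"
        by (simp add: apply_simps)
      then show ?thesis using that by (simp add: K_def)
    qed
    show "T o\<^sub>L P = P o\<^sub>L T"
    proof (rule blinfun_eqI)
      fix x
      define v where "v = blinfun_apply P (blinfun_apply T (x - blinfun_apply P x))"
      have "(norm v)\<^sup>2 = blinfun_apply T (x - blinfun_apply P x) \<bullet> v"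
        unfolding v_def using projection_inner[OF P(1)] by (simp add: inner_commute)
      also have "\<dots> = (x - blinfun_apply P x) \<bullet> blinfun_apply T v" by (simp add: self_adjointD[OF T])
      also have "\<dots> = 0"
      proof (rule perp)
        show "blinfun_apply T v \<in> K" unfolding v_def by (intro TK P(2))
      qed (simp add: apply_simps projection_idem[OF P(1)])
      finally have "v = 0" by simp
      then have "blinfun_apply P (blinfun_apply T x) = blinfun_apply P (blinfun_apply T (blinfun_apply P x))"
        by (simp add: v_def apply_simps)
      then show "blinfun_apply (T o\<^sub>L P) x = blinfun_apply (P o\<^sub>L T) x"
        using P(3)[OF TK[OF P(2)]] by simp
    qed
  qed
qed

section \<open>Bisection of the numerical range\<close>

definition neg_proj :: "('h::complex_hilbert \<Rightarrow>\<^sub>L 'h) \<Rightarrow> ('h \<Rightarrow>\<^sub>L 'h)"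
  where "neg_proj h = (SOME P. is_projection P \<and>
    (\<forall>x. blinfun_apply P x = x \<longrightarrow> blinfun_apply h x \<bullet> x \<le> 0) \<and>
    (\<forall>x. blinfun_apply P x = 0 \<longrightarrow> 0 \<le> blinfun_apply h x \<bullet> x) \<and>
    (\<forall>T. self_adjoint T \<longrightarrow> T o\<^sub>L h = h o\<^sub>L T \<longrightarrow> T o\<^sub>L P = P o\<^sub>L T))"

lemma
  assumes "self_adjoint h"
  shows neg_proj_projection: "is_projection (neg_proj h)"
    and neg_proj_le: "\<And>x. blinfun_apply (neg_proj h) x = x \<Longrightarrow> blinfun_apply h x \<bullet> x \<le> 0"
    and neg_proj_ge: "\<And>x. blinfun_apply (neg_proj h) x = 0 \<Longrightarrow> 0 \<le> blinfun_apply h x \<bullet> x"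
    and neg_proj_commute:
      "\<And>T. self_adjoint T \<Longrightarrow> T o\<^sub>L h = h o\<^sub>L T \<Longrightarrow> T o\<^sub>L neg_proj h = neg_proj h o\<^sub>L T"
proof -
  have "\<exists>P. is_projection P \<and>
    (\<forall>x. blinfun_apply P x = x \<longrightarrow> blinfun_apply h x \<bullet> x \<le> 0) \<and>
    (\<forall>x. blinfun_apply P x = 0 \<longrightarrow> 0 \<le> blinfun_apply h x \<bullet> x) \<and>
    (\<forall>T. self_adjoint T \<longrightarrow> T o\<^sub>L h = h o\<^sub>L T \<longrightarrow> T o\<^sub>L P = P o\<^sub>L T)"
    by (rule negative_projection[OF assms]) blast
  note * = someI_ex[OF this, folded neg_proj_def]
  show "is_projection (neg_proj h)"
    and "\<And>x. blinfun_apply (neg_proj h) x = x \<Longrightarrow> blinfun_apply h x \<bullet> x \<le> 0"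
    and "\<And>x. blinfun_apply (neg_proj h) x = 0 \<Longrightarrow> 0 \<le> blinfun_apply h x \<bullet> x"
    and "\<And>T. self_adjoint T \<Longrightarrow> T o\<^sub>L h = h o\<^sub>L T \<Longrightarrow> T o\<^sub>L neg_proj h = neg_proj h o\<^sub>L T"
    using * by blast+
qed

definition re_op :: "('h::complex_hilbert \<Rightarrow>\<^sub>L 'h) \<Rightarrow> ('h \<Rightarrow>\<^sub>L 'h)"
  where "re_op a = (1/2) *\<^sub>R (a + adj a)"

definition im_op :: "('h::complex_hilbert \<Rightarrow>\<^sub>L 'h) \<Rightarrow> ('h \<Rightarrow>\<^sub>L 'h)"
  where "im_op a = scale_op (- \<i> / 2) (a - adj a)"

lemmas scaleR_scaleC = scaleC_of_real[symmetric]

lemma self_adjoint_re_op: "a \<in> bounded_ops \<Longrightarrow> self_adjoint (re_op a)"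
  unfolding re_op_def
  by (intro self_adjoint_scaleR)
    (simp add: self_adjoint_def bounded_ops_add adj_bounded_ops adj_add adj_adj add.commute)

lemma self_adjoint_im_op: "a \<in> bounded_ops \<Longrightarrow> self_adjoint (im_op a)"
proof -
  assume a: "a \<in> bounded_ops"
  have "adj (im_op a) = scale_op (\<i> / 2) (adj a - a)"
    using a by (simp add: im_op_def adj_scale bounded_ops_diff adj_bounded_ops adj_diff adj_adj)
  also have "\<dots> = im_op a"
    by (rule blinfun_eqI) (simp add: im_op_def apply_simps scaleC_diff_right scaleC_minus_left)
  finally show ?thesis
    using a by (simp add: self_adjoint_def im_op_def bounded_ops_intros adj_bounded_ops)
qed

lemma op_decomposition: "a = re_op a + scale_op \<i> (im_op a)"
proof (rule blinfun_eqI)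
  fix x
  have half: "(1/2) *\<^sub>R (u + v) + (1/2) *\<^sub>R (u - v) = u" for u v :: 'a
    by (simp flip: scaleR_add_right)
  have "blinfun_apply (scale_op \<i> (im_op a)) x = complex_of_real (1/2) *\<^sub>C blinfun_apply (a - adj a) x"
    by (simp add: im_op_def scaleC_scaleC)
  then show "blinfun_apply a x = blinfun_apply (re_op a + scale_op \<i> (im_op a)) x"
    unfolding scaleC_of_real by (simp only: re_op_def apply_simps half)
qed

lemma norm_re_op: "a \<in> bounded_ops \<Longrightarrow> norm (re_op a) \<le> norm a"
  using norm_triangle_ineq[of a "adj a"] by (simp add: re_op_def norm_adj)

lemma norm_im_op: "a \<in> bounded_ops \<Longrightarrow> norm (im_op a) \<le> norm a"
  using norm_triangle_ineq4[of a "adj a"] by (simp add: im_op_def norm_adj norm_scale_op norm_divide)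

text \<open>Real and imaginary part are bisected in turn.\<close>

definition part_op :: "('h::complex_hilbert \<Rightarrow>\<^sub>L 'h) \<Rightarrow> nat \<Rightarrow> ('h \<Rightarrow>\<^sub>L 'h)"
  where "part_op a p = (if even p then re_op a else im_op a)"

definition coord :: "nat \<Rightarrow> complex \<Rightarrow> real"
  where "coord p c = (if even p then Re c else Im c)"

definition direction :: "nat \<Rightarrow> complex"
  where "direction p = (if even p then 1 else \<i>)"

definition width :: "('h::complex_hilbert \<Rightarrow>\<^sub>L 'h) \<Rightarrow> nat \<Rightarrow> real"
  where "width a p = norm a / 2 ^ (p div 2)"

text \<open>
  The center of a child is moved by half of the current half-width, in the direction that is bisected
  at this depth. Nodes are lists of bits, the most recent bit first.
\<close>
primrec center :: "('h::complex_hilbert \<Rightarrow>\<^sub>L 'h) \<Rightarrow> bool list \<Rightarrow> complex"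
  where "center a [] = 0"
  | "center a (b # s) = center a s +
      complex_of_real ((if b then 1 else -1) * width a (length s) / 2) * direction (length s)"

definition node_op :: "('h::complex_hilbert \<Rightarrow>\<^sub>L 'h) \<Rightarrow> nat \<Rightarrow> complex \<Rightarrow> ('h \<Rightarrow>\<^sub>L 'h) \<Rightarrow> ('h \<Rightarrow>\<^sub>L 'h)"
  where "node_op a p c F = F o\<^sub>L (part_op a p - coord p c *\<^sub>R id_blinfun) o\<^sub>L F"

primrec node :: "('h::complex_hilbert \<Rightarrow>\<^sub>L 'h) \<Rightarrow> bool list \<Rightarrow> ('h \<Rightarrow>\<^sub>L 'h)"
  where "node a [] = id_blinfun"
  | "node a (b # s) = node a s o\<^sub>L
      (let N = neg_proj (node_op a (length s) (center a s) (node a s))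
       in if b then id_blinfun - N else N)"

lemma self_adjoint_part_op: "a \<in> bounded_ops \<Longrightarrow> self_adjoint (part_op a p)"
  by (simp add: part_op_def self_adjoint_re_op self_adjoint_im_op)

lemma self_adjoint_node_op:
  "a \<in> bounded_ops \<Longrightarrow> is_projection F \<Longrightarrow> self_adjoint (node_op a p c F)"
  unfolding node_op_def
  by (intro self_adjoint_compression self_adjoint_diff self_adjoint_scaleR self_adjoint_id
      self_adjoint_part_op projection_self_adjoint)

lemma neg_proj_node_op_commute:
  assumes "a \<in> bounded_ops" "is_projection F"
  shows "F o\<^sub>L neg_proj (node_op a p c F) = neg_proj (node_op a p c F) o\<^sub>L F"
proof (rule neg_proj_commute[OF self_adjoint_node_op[OF assms] projection_self_adjoint[OF assms(2)]])
  show "F o\<^sub>L node_op a p c F = node_op a p c F o\<^sub>L F"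
    by (rule blinfun_eqI) (simp add: node_op_def projection_idem[OF assms(2)])
qed

lemma node_projection:
  assumes a: "a \<in> bounded_ops"
  shows "is_projection (node a s)"
proof (induction s)
  case (Cons b s)
  let ?N = "neg_proj (node_op a (length s) (center a s) (node a s))"
  note comm = neg_proj_node_op_commute[OF a Cons, of "length s" "center a s"]
  have N: "is_projection ?N" by (intro neg_proj_projection self_adjoint_node_op a Cons)
  have "node a s o\<^sub>L (id_blinfun - ?N) = (id_blinfun - ?N) o\<^sub>L node a s"
    using compose_eqD[OF comm] by (intro blinfun_eqI) (simp add: apply_simps)
  then show ?case
    using Cons N comm by (auto simp: Let_def intro!: is_projection_commuting_compose is_projection_compl)
qed (simp add: is_projection_id)

text \<open>
  The projections are obtained from compressions of the real and the imaginary part of \<open>a\<close> to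
  projections obtained before, so they commute with whatever commutes with both parts. For normal \<open>a\<close>
  this covers both parts themselves.
\<close>
lemma node_commute:
  assumes a: "a \<in> bounded_ops" and T: "self_adjoint T"
    and "T o\<^sub>L re_op a = re_op a o\<^sub>L T" "T o\<^sub>L im_op a = im_op a o\<^sub>L T"
  shows "T o\<^sub>L node a s = node a s o\<^sub>L T"
proof (induction s)
  case (Cons b s)
  let ?h = "node_op a (length s) (center a s) (node a s)"
  have 1: "blinfun_apply T (blinfun_apply (part_op a p) x) = blinfun_apply (part_op a p) (blinfun_apply T x)"
    for p x using assms(3,4) compose_eqD by (auto simp: part_op_def)
  note 2 = compose_eqD[OF Cons]
  have "T o\<^sub>L ?h = ?h o\<^sub>L T"
    by (rule blinfun_eqI) (simp add: node_op_def apply_simps 1 2)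
  then have "T o\<^sub>L neg_proj ?h = neg_proj ?h o\<^sub>L T"
    by (intro neg_proj_commute self_adjoint_node_op a node_projection T)
  note 3 = compose_eqD[OF this]
  show ?case
    by (rule blinfun_eqI) (simp add: Let_def 2 3 apply_simps)
qed (auto intro!: blinfun_eqI)

lemma node_split: "node a (False # s) + node a (True # s) = node a s"
  by (rule blinfun_eqI) (simp add: apply_simps)

lemma node_sibling: "node a ((\<not> b) # s) = node a s - node a (b # s)"
  using node_split[of a s] by (cases b) (auto simp: algebra_simps)

lemma node_parent:
  assumes a: "a \<in> bounded_ops"
  shows "node a s o\<^sub>L node a (b # s) = node a (b # s)" "node a (b # s) o\<^sub>L node a s = node a (b # s)"
proof -
  let ?N = "neg_proj (node_op a (length s) (center a s) (node a s))"
  note F = node_projection[OF a, of s]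
  note comm = compose_eqD[OF neg_proj_node_op_commute[OF a F, of "length s" "center a s"]]
  show "node a s o\<^sub>L node a (b # s) = node a (b # s)"
    by (rule blinfun_eqI) (simp add: projection_idem[OF F])
  show "node a (b # s) o\<^sub>L node a s = node a (b # s)"
    by (rule blinfun_eqI)
      (simp add: apply_simps Let_def comm[symmetric] projection_idem[OF F])
qed

lemma node_siblings_orthogonal:
  assumes a: "a \<in> bounded_ops"
  shows "node a ((\<not> b) # s) o\<^sub>L node a (b # s) = 0"
proof (rule blinfun_eqI)
  fix x
  have "blinfun_apply (node a s) (blinfun_apply (node a (b # s)) x) = blinfun_apply (node a (b # s)) x"
    using arg_cong[OF node_parent(1)[OF a, of s b], of "\<lambda>f. blinfun_apply f x"]
    by (simp only: compose_apply)
  then show "blinfun_apply (node a ((\<not> b) # s) o\<^sub>L node a (b # s)) x = blinfun_apply 0 x"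
    unfolding node_sibling
    by (simp only: compose_apply apply_simps projection_idem[OF node_projection[OF a]] diff_self)
qed

lemma node_orthogonal:
  assumes a: "a \<in> bounded_ops"
  shows "length s = length t \<Longrightarrow> s \<noteq> t \<Longrightarrow> node a s o\<^sub>L node a t = 0"
proof (induction s arbitrary: t)
  case (Cons b s)
  then obtain c t' where t: "t = c # t'" "length s = length t'" by (cases t) auto
  show ?case
  proof (cases "s = t'")
    case True
    then have "c = (\<not> b)" using Cons t by auto
    then show ?thesis using node_siblings_orthogonal[OF a, of "\<not> b" s] t True by simp
  next
    case False
    have "node a (b # s) o\<^sub>L node a t = (node a (b # s) o\<^sub>L node a s) o\<^sub>L (node a t' o\<^sub>L node a t)"
      by (simp add: node_parent[OF a] t(1) del: node.simps)
    also have "\<dots> = node a (b # s) o\<^sub>L (node a s o\<^sub>L node a t') o\<^sub>L node a t"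
      by (simp add: compose_assoc)
    also have "\<dots> = 0" using Cons.IH[OF t(2) False] by simp
    finally show ?thesis .
  qed
qed simp

lemma coord_step:
  "coord (length s) (center a (b # s)) =
      coord (length s) (center a s) + (if b then 1 else -1) * width a (length s) / 2"
  "coord (Suc (length s)) (center a (b # s)) = coord (Suc (length s)) (center a s)"
  by (auto simp: coord_def direction_def)

lemma coord_add2: "coord (Suc (Suc p)) = coord p"
  by (auto simp: coord_def fun_eq_iff)

lemma part_op_add2: "part_op a (Suc (Suc p)) = part_op a p"
  by (simp add: part_op_def)

text \<open>
  The two half-widths are those of the part that is bisected next and of the other one. The quadratic
  form of the other part is only restricted to a smaller subspace, which does not spoil its bounds.
\<close>
lemma node_bounds:
  assumes a: "a \<in> bounded_ops"
  shows "blinfun_apply (node a s) x = x \<Longrightarrow>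
      \<bar>blinfun_apply (part_op a (length s)) x \<bullet> x - coord (length s) (center a s) * (norm x)\<^sup>2\<bar>
        \<le> width a (length s) * (norm x)\<^sup>2 \<and>
      \<bar>blinfun_apply (part_op a (Suc (length s))) x \<bullet> x - coord (Suc (length s)) (center a s) * (norm x)\<^sup>2\<bar>
        \<le> width a (Suc (length s)) * (norm x)\<^sup>2"
proof (induction s)
  case Nil
  have "\<bar>blinfun_apply T x \<bullet> x\<bar> \<le> norm a * (norm x)\<^sup>2" if "norm T \<le> norm a" for T
  proof -
    have "\<bar>blinfun_apply T x \<bullet> x\<bar> \<le> norm (blinfun_apply T x) * norm x" by (rule Cauchy_Schwarz_ineq2)
    also have "\<dots> \<le> (norm T * norm x) * norm x" by (intro mult_right_mono norm_blinfun) auto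
    also have "\<dots> \<le> (norm a * norm x) * norm x" using that by (intro mult_right_mono) auto
    finally show ?thesis by (simp add: power2_eq_square mult.assoc)
  qed
  from this[OF norm_re_op[OF a]] this[OF norm_im_op[OF a]] show ?case
    by (simp add: part_op_def coord_def width_def)
next
  case (Cons b s)
  define F where "F = node a s"
  define p where "p = length s"
  define N where "N = neg_proj (node_op a p (center a s) F)"
  have F: "is_projection F" by (simp add: F_def node_projection a)
  note h = self_adjoint_node_op[OF a F, of p "center a s"]
  have bs: "node a (b # s) = F o\<^sub>L (if b then id_blinfun - N else N)"
    by (simp add: F_def N_def p_def Let_def)
  have Fx: "blinfun_apply F x = x"
    using Cons.prems unfolding bs by (metis compose_apply projection_idem[OF F])
  note IH = Cons.IH[OF Fx[unfolded F_def], folded p_def]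
  have NN: "blinfun_apply N (blinfun_apply N y) = blinfun_apply N y" for y
    unfolding N_def by (rule projection_idem[OF neg_proj_projection[OF h]])
  have comm: "blinfun_apply F (blinfun_apply N y) = blinfun_apply N (blinfun_apply F y)" for y
    unfolding N_def by (rule compose_eqD[OF neg_proj_node_op_commute[OF a F]])
  have hx: "blinfun_apply (node_op a p (center a s) F) x \<bullet> x =
      blinfun_apply (part_op a p) x \<bullet> x - coord p (center a s) * (norm x)\<^sup>2"
    unfolding node_op_def power2_norm_eq_inner
    by (simp add: Fx self_adjointD[OF projection_self_adjoint[OF F]] apply_simps inner_diff_left)
  have Nx: "blinfun_apply N x = (if b then 0 else x)"
  proof -
    have "x = blinfun_apply (if b then id_blinfun - N else N) (blinfun_apply F x)"
      using Cons.prems unfolding bs by (cases b) (simp_all add: apply_simps comm)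
    then have "x = blinfun_apply (if b then id_blinfun - N else N) x" by (simp add: Fx)
    then show ?thesis by (cases b) (simp_all add: apply_simps)
  qed
  have w2: "width a (Suc (Suc p)) = width a p / 2" by (simp add: width_def)
  have key: "\<bar>blinfun_apply (part_op a p) x \<bullet> x - coord p (center a (b # s)) * (norm x)\<^sup>2\<bar>
        \<le> width a (Suc (Suc p)) * (norm x)\<^sup>2"
  proof -
    define n where "n = (norm x)\<^sup>2"
    define q where "q = blinfun_apply (part_op a p) x \<bullet> x"
    have IH': "\<bar>q - coord p (center a s) * n\<bar> \<le> width a p * n"
      using IH by (simp add: n_def q_def)
    have hq: "blinfun_apply (node_op a p (center a s) F) x \<bullet> x = q - coord p (center a s) * n"
      by (simp add: hx n_def q_def)
    have e: "coord p (center a (b # s)) * n =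
        coord p (center a s) * n + (if b then 1 else -1) * (width a p * n) / 2"
      unfolding coord_step(1)[of s a b, folded p_def] by (simp add: algebra_simps)
    have "\<bar>q - coord p (center a (b # s)) * n\<bar> \<le> width a p * n / 2"
    proof (cases b)
      case True
      then have "0 \<le> blinfun_apply (node_op a p (center a s) F) x \<bullet> x"
        using neg_proj_ge[OF h] Nx by (simp add: N_def)
      then show ?thesis using IH' True e unfolding hq if_P[OF True] by linarith
    next
      case False
      then have "blinfun_apply (node_op a p (center a s) F) x \<bullet> x \<le> 0"
        using neg_proj_le[OF h] Nx by (simp add: N_def)
      then show ?thesis using IH' False e unfolding hq if_not_P[OF False] by linarith
    qed
    then show ?thesis unfolding w2 by (simp add: n_def q_def)
  qed
  then show ?case
    using IH coord_step(2)[of s a b] by (simp add: p_def coord_add2 part_op_add2 del: center.simps)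
qed

text \<open>
  Each part is halved at every second step, so the errors decrease like \<open>2 powr (- p / 2)\<close>. The rate
  \<open>3/4\<close> is a rational number above \<open>1 / sqrt 2\<close>, and the factor 4 covers both parts and the rounding
  of \<open>p / 2\<close>.
\<close>
definition eps :: "('h::complex_hilbert \<Rightarrow>\<^sub>L 'h) \<Rightarrow> nat \<Rightarrow> real"
  where "eps a p = 4 * norm a * (3/4) ^ p"

lemma eps_nonneg: "0 \<le> eps a p"
  by (simp add: eps_def)

lemma width_le: "width a p \<le> eps a p / 2" "width a (Suc p) \<le> eps a p / 2"
proof -
  have *: "1 / 2 ^ (p div 2) \<le> 2 * (3/4::real) ^ p" for p
  proof (induction p rule: less_induct)
    case (less p)
    show ?case
    proof (cases "p < 2")
      case True
      then have "p = 0 \<or> p = 1" by auto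
      then show ?thesis by auto
    next
      case False
      define q where "q = p - 2"
      have p: "p = Suc (Suc q)" using False by (simp add: q_def)
      have "1 / 2 ^ (p div 2) = (1/2) * (1 / 2 ^ (q div 2) :: real)" by (simp add: p)
      also have "\<dots> \<le> (1/2) * (2 * (3/4) ^ q)" using less.IH[of q] p by simp
      also have "\<dots> \<le> 2 * (3/4) ^ p" by (simp add: p)
      finally show ?thesis .
    qed
  qed
  show w: "width a p \<le> eps a p / 2" for p
    using mult_left_mono[OF *[of p], of "norm a"] by (simp add: width_def eps_def mult_ac)
  have "eps a (Suc p) \<le> eps a p" by (simp add: eps_def mult_left_mono)
  then show "width a (Suc p) \<le> eps a p / 2" using w[of "Suc p"] by simp
qed

lemma center_step: "cmod (center a (b # s) - center a s) \<le> eps a (length s)"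
proof -
  have "cmod (complex_of_real r * direction p) = \<bar>r\<bar>" for r p
    by (simp add: norm_mult direction_def)
  then have "cmod (center a (b # s) - center a s) = \<bar>(if b then 1 else -1) * width a (length s) / 2\<bar>"
    by (simp only: center.simps add_diff_cancel_left')
  also have "\<dots> = width a (length s) / 2"
    by (simp add: width_def)
  finally show ?thesis
    using width_le(1)[of a "length s"] eps_nonneg[of a "length s"] by linarith
qed

lemma node_compression:
  assumes a: "a \<in> bounded_ops"
  shows "norm (node a s o\<^sub>L (a - scale_op (center a s) id_blinfun) o\<^sub>L node a s) \<le> eps a (length s)"
proof -
  define F where "F = node a s"
  define p where "p = length s"
  have F: "is_projection F" by (simp add: F_def node_projection a)
  have *: "norm (node_op a q (center a s) F) \<le> eps a p / 2" if q: "q = p \<or> q = Suc p" for q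
  proof (rule self_adjoint_norm_le[OF self_adjoint_node_op[OF a F]])
    fix x
    let ?y = "blinfun_apply F x"
    have "\<bar>blinfun_apply (node_op a q (center a s) F) x \<bullet> x\<bar> =
        \<bar>blinfun_apply (part_op a q) ?y \<bullet> ?y - coord q (center a s) * (norm ?y)\<^sup>2\<bar>"
      unfolding node_op_def power2_norm_eq_inner
      by (simp add: self_adjointD[OF projection_self_adjoint[OF F]] apply_simps inner_diff_left inner_diff_right)
    also have "\<dots> \<le> width a q * (norm ?y)\<^sup>2"
      using node_bounds[OF a, of s ?y] projection_idem[OF F, of x] q by (auto simp: F_def p_def)
    also have "\<dots> \<le> (eps a p / 2) * (norm x)\<^sup>2"
      using q width_le[of a p] eps_nonneg[of a p] projection_norm_le[OF F, of x]
      by (intro mult_mono power_mono) auto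
    finally show "\<bar>blinfun_apply (node_op a q (center a s) F) x \<bullet> x\<bar> \<le> (eps a p / 2) * (norm x)\<^sup>2" .
  qed (simp add: eps_nonneg)
  define q where "q = (if even p then p else Suc p)"
  define q' where "q' = (if even p then Suc p else p)"
  have "F o\<^sub>L (a - scale_op (center a s) id_blinfun) o\<^sub>L F =
      node_op a q (center a s) F + scale_op \<i> (node_op a q' (center a s) F)"
  proof (rule blinfun_eqI)
    fix x
    define y where "y = blinfun_apply F x"
    note lin = bounded_opsD[OF projection_ops[OF F], symmetric]
    have ay: "blinfun_apply a y = blinfun_apply (re_op a) y + \<i> *\<^sub>C blinfun_apply (im_op a) y"
      by (subst op_decomposition[of a]) (simp add: apply_simps)
    have cy: "center a s *\<^sub>C y = Re (center a s) *\<^sub>R y + \<i> *\<^sub>C (Im (center a s) *\<^sub>R y)"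
      by (subst complex_eq[of "center a s"])
        (simp add: scaleC_add_left scaleC_of_real flip: scaleC_scaleC)
    show "blinfun_apply (F o\<^sub>L (a - scale_op (center a s) id_blinfun) o\<^sub>L F) x =
      blinfun_apply (node_op a q (center a s) F + scale_op \<i> (node_op a q' (center a s) F)) x"
      by (simp add: node_op_def q_def q'_def part_op_def coord_def apply_simps lin y_def[symmetric]
          ay cy scaleC_diff_right del: blinfun.scaleR_right)
  qed
  also have "norm \<dots> \<le> eps a p / 2 + eps a p / 2"
    using *[of q] *[of q'] by (intro norm_triangle_le add_mono) (auto simp: q_def q'_def norm_scale_op)
  finally show ?thesis by (simp add: F_def p_def)
qed

lemma normal_node_commute:
  assumes a: "a \<in> bounded_ops" and normal: "adj a o\<^sub>L a = a o\<^sub>L adj a"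
  shows "a o\<^sub>L node a s = node a s o\<^sub>L a" "adj a o\<^sub>L node a s = node a s o\<^sub>L adj a"
proof -
  note n = compose_eqD[OF normal]
  note lin = bounded_opsD[OF a] bounded_opsD[OF adj_bounded_ops[OF a]]
  have "re_op a o\<^sub>L im_op a = im_op a o\<^sub>L re_op a"
    by (rule blinfun_eqI)
      (simp add: re_op_def im_op_def apply_simps lin n scaleC_scaleR scaleC_diff_right scaleC_add_right
        scaleR_add_right scaleR_diff_right)
  then have "re_op a o\<^sub>L node a s = node a s o\<^sub>L re_op a" "im_op a o\<^sub>L node a s = node a s o\<^sub>L im_op a"
    by (auto intro!: node_commute self_adjoint_re_op self_adjoint_im_op a)
  note c = compose_eqD[OF this(1)] compose_eqD[OF this(2)]
  note Flin = bounded_opsD[OF projection_ops[OF node_projection[OF a]]]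
  have ad: "adj a = re_op a - scale_op \<i> (im_op a)"
  proof -
    have "a + adj a = 2 *\<^sub>R re_op a" by (simp add: re_op_def)
    then have "adj a = 2 *\<^sub>R re_op a - a" by (simp add: algebra_simps)
    also have "\<dots> = 2 *\<^sub>R re_op a - (re_op a + scale_op \<i> (im_op a))" using op_decomposition[of a] by simp
    finally show ?thesis by (simp add: scaleR_2)
  qed
  show "adj a o\<^sub>L node a s = node a s o\<^sub>L adj a"
    unfolding ad by (rule blinfun_eqI) (simp add: apply_simps c Flin)
  have "(re_op a + scale_op \<i> (im_op a)) o\<^sub>L node a s = node a s o\<^sub>L (re_op a + scale_op \<i> (im_op a))"
    by (rule blinfun_eqI) (simp add: apply_simps c Flin)
  then show "a o\<^sub>L node a s = node a s o\<^sub>L a" by (simp flip: op_decomposition)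
qed

section \<open>The projection-valued measure on the branches of the tree\<close>

primrec prefix :: "(nat \<Rightarrow> bool) \<Rightarrow> nat \<Rightarrow> bool list"
  where "prefix \<omega> 0 = []"
  | "prefix \<omega> (Suc n) = \<omega> n # prefix \<omega> n"

definition cylinder :: "bool list \<Rightarrow> (nat \<Rightarrow> bool) set"
  where "cylinder s = {\<omega>. prefix \<omega> (length s) = s}"

definition branches :: "(nat \<Rightarrow> bool) measure"
  where "branches = sigma UNIV (insert {} (range cylinder))"

lemma length_prefix [simp]: "length (prefix \<omega> n) = n"
  by (induction n) auto

lemma cylinder_Nil: "cylinder [] = UNIV"
  by (simp add: cylinder_def)

lemma mem_cylinder_prefix: "\<omega> \<in> cylinder (prefix \<omega> n)"
  by (simp add: cylinder_def)

lemma prefix_drop: "n \<le> m \<Longrightarrow> prefix \<omega> n = drop (m - n) (prefix \<omega> m)"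
  by (induction m) (auto simp: le_Suc_eq Suc_diff_le)

lemma prefix_eq_mono: "prefix \<omega> m = prefix \<omega>' m \<Longrightarrow> n \<le> m \<Longrightarrow> prefix \<omega> n = prefix \<omega>' n"
  by (metis prefix_drop)

lemma cylinder_nested:
  assumes "length s \<le> length t"
  shows "cylinder t \<subseteq> cylinder s \<or> cylinder t \<inter> cylinder s = {}"
proof (cases "cylinder t \<inter> cylinder s = {}")
  case False
  then obtain \<omega> where \<omega>: "prefix \<omega> (length t) = t" "prefix \<omega> (length s) = s"
    by (auto simp: cylinder_def)
  have "cylinder t \<subseteq> cylinder s"
  proof
    fix \<omega>' assume "\<omega>' \<in> cylinder t"
    then have "prefix \<omega>' (length t) = prefix \<omega> (length t)" using \<omega> by (simp add: cylinder_def)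
    from prefix_eq_mono[OF this assms] show "\<omega>' \<in> cylinder s"
      using \<omega> by (simp add: cylinder_def)
  qed
  then show ?thesis ..
qed simp

lemma sets_branches: "sets branches = sigma_sets UNIV (insert {} (range cylinder))"
  by (simp add: branches_def)

lemma cylinders_Pow: "insert {} (range cylinder) \<subseteq> Pow UNIV"
  by simp

lemma space_branches [simp]: "space branches = UNIV"
  by (simp add: branches_def space_measure_of_conv)

lemma cylinder_sets: "cylinder s \<in> sets branches"
  by (auto simp: sets_branches)

lemma UNIV_sets_branches: "UNIV \<in> sets branches"
  using cylinder_sets[of "[]"] by (simp add: cylinder_Nil)

lemma Int_stable_cylinders: "Int_stable (insert {} (range cylinder))"
proof (rule Int_stableI)
  have *: "cylinder s \<inter> cylinder t \<in> insert {} (range cylinder)" if "length s \<le> length t" for s t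
    using cylinder_nested[OF that] by (metis Int_absorb1 Int_commute insertCI rangeI)
  fix A B assume "A \<in> insert {} (range cylinder)" "B \<in> insert {} (range cylinder)"
  then show "A \<inter> B \<in> insert {} (range cylinder)"
    using * by (metis Int_commute Int_empty_left Int_empty_right insertE insertCI linear rangeE)
qed

text \<open>
  An additive mass function on the nodes lays out nested half-open intervals of the given
  lengths; the branch that a point of the line determines has the required distribution under
  Lebesgue measure.
\<close>

primrec left_end :: "(bool list \<Rightarrow> real) \<Rightarrow> bool list \<Rightarrow> real"
  where "left_end m [] = 0"
  | "left_end m (b # s) = left_end m s + (if b then m (False # s) else 0)"

definition node_interval :: "(bool list \<Rightarrow> real) \<Rightarrow> bool list \<Rightarrow> real set"
  where "node_interval m s = {left_end m s ..< left_end m s + m s}"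

primrec descend :: "(bool list \<Rightarrow> real) \<Rightarrow> real \<Rightarrow> nat \<Rightarrow> bool list"
  where "descend m u 0 = []"
  | "descend m u (Suc n) = (u \<in> node_interval m (True # descend m u n)) # descend m u n"

lemma branch_measure_exists:
  fixes m :: "bool list \<Rightarrow> real"
  assumes nonneg: "\<And>s. 0 \<le> m s" and split: "\<And>s. m s = m (False # s) + m (True # s)"
  obtains \<mu> where "sets \<mu> = sets branches" "\<And>s. emeasure \<mu> (cylinder s) = ennreal (m s)"
proof -
  let ?I = "node_interval m"
  define path where "path u n = (u \<in> ?I (True # descend m u n))" for u n
  have children: "u \<in> ?I s \<longleftrightarrow> u \<in> ?I (False # s) \<or> u \<in> ?I (True # s)"
      "\<not> (u \<in> ?I (False # s) \<and> u \<in> ?I (True # s))" for u s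
    using split[of s] nonneg[of "False # s"] nonneg[of "True # s"] by (auto simp: node_interval_def)
  have sub: "?I s \<subseteq> ?I []" for s
  proof (induction s)
    case (Cons b s)
    have "?I (b # s) \<subseteq> ?I s" using children(1)[of _ s] by (cases b) auto
    then show ?case using Cons by blast
  qed simp
  have prefix_path: "prefix (path u) n = descend m u n" for u n
    by (induction n) (auto simp: path_def)
  have in_I: "u \<in> ?I (descend m u n)" if "u \<in> ?I []" for u n
  proof (induction n)
    case (Suc n)
    then show ?case
      using children(1)[of u "descend m u n"]
      by (cases "u \<in> ?I (True # descend m u n)") simp_all
  qed (use that in simp)
  have iff: "u \<in> ?I s \<longleftrightarrow> descend m u (length s) = s" if u: "u \<in> ?I []" for u s
  proof (induction s)
    case (Cons b s)
    show ?case
    proof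
      assume "u \<in> ?I (b # s)"
      then show "descend m u (length (b # s)) = b # s"
        using Cons children[of u s] by (cases b) auto
    next
      assume d: "descend m u (length (b # s)) = b # s"
      show "u \<in> ?I (b # s)" using in_I[OF u, of "length (b # s)"] unfolding d .
    qed
  qed (use u in simp)
  have pre: "path -` cylinder s \<inter> ?I [] = ?I s" for s
    using iff sub by (auto simp: cylinder_def prefix_path)
  let ?M = "restrict_space lborel (?I [])"
  have I_sets: "?I s \<in> sets lborel" for s by (simp add: node_interval_def)
  have sp: "space ?M = ?I []" by (simp add: space_restrict_space)
  have meas: "path \<in> measurable ?M branches"
    unfolding branches_def
  proof (rule measurable_measure_of)
    fix A assume "A \<in> insert {} (range cylinder)"
    then show "path -` A \<inter> space ?M \<in> sets ?M"
      unfolding sp using pre sub I_sets by (auto simp: sets_restrict_space_iff)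
  qed auto
  have "emeasure (distr ?M branches path) (cylinder s) = ennreal (m s)" for s
  proof -
    have "emeasure (distr ?M branches path) (cylinder s) = emeasure ?M (?I s)"
      by (simp only: emeasure_distr[OF meas cylinder_sets] sp pre)
    also have "\<dots> = emeasure lborel (?I s)"
      using sub I_sets by (intro emeasure_restrict_space) auto
    also have "\<dots> = ennreal (m s)"
      using nonneg[of s] by (simp add: node_interval_def)
    finally show ?thesis .
  qed
  then show ?thesis using that[of "distr ?M branches path"] by simp
qed

lemma projections_orthogonalI:
  assumes P: "is_projection P" and Q: "is_projection Q"
    and le: "\<And>x. blinfun_apply P x \<bullet> x + blinfun_apply Q x \<bullet> x \<le> x \<bullet> x"
  shows "P o\<^sub>L Q = 0"
proof (rule blinfun_eqI)
  fix x
  let ?y = "blinfun_apply Q x"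
  have "(norm (blinfun_apply P ?y))\<^sup>2 + (norm ?y)\<^sup>2 \<le> (norm ?y)\<^sup>2"
    using le[of ?y] projection_inner[OF P, of ?y] projection_inner[OF Q, of ?y] projection_idem[OF Q]
    by (simp add: power2_norm_eq_inner)
  then show "blinfun_apply (P o\<^sub>L Q) x = blinfun_apply 0 x" by simp
qed

lemma orthogonal_ranges:
  assumes P: "is_projection P" and PQ: "P o\<^sub>L Q = 0"
  shows "blinfun_apply P x \<bullet> blinfun_apply Q y = 0"
  using compose_zeroD[OF PQ] self_adjointD[OF projection_self_adjoint[OF P], of x "blinfun_apply Q y"]
  by simp

lemma norm_sum_projections:
  assumes "finite A" and P: "\<And>i. i \<in> A \<Longrightarrow> is_projection (P i)"
    and orth: "\<And>i j. i \<in> A \<Longrightarrow> j \<in> A \<Longrightarrow> i \<noteq> j \<Longrightarrow> P i o\<^sub>L P j = 0"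
  shows "(norm (\<Sum>i\<in>A. blinfun_apply (P i) x))\<^sup>2 = (\<Sum>i\<in>A. (norm (blinfun_apply (P i) x))\<^sup>2)"
  using assms
  by (intro norm_sum_Pythagorean) (auto simp: pairwise_def orthogonal_def intro!: orthogonal_ranges)

lemma bessel_inequality:
  assumes "finite A" and P: "\<And>i. i \<in> A \<Longrightarrow> is_projection (P i)"
    and orth: "\<And>i j. i \<in> A \<Longrightarrow> j \<in> A \<Longrightarrow> i \<noteq> j \<Longrightarrow> P i o\<^sub>L P j = 0"
  shows "(\<Sum>i\<in>A. (norm (blinfun_apply (P i) x))\<^sup>2) \<le> (norm x)\<^sup>2"
proof -
  define y where "y = (\<Sum>i\<in>A. blinfun_apply (P i) x)"
  have "y \<bullet> x = (\<Sum>i\<in>A. (norm (blinfun_apply (P i) x))\<^sup>2)"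
    unfolding y_def inner_sum_left using P by (intro sum.cong) (auto simp: projection_inner)
  also have "\<dots> = (norm y)\<^sup>2"
    unfolding y_def using assms by (intro norm_sum_projections[symmetric])
  finally have e: "y \<bullet> x = (norm y)\<^sup>2" "(norm y)\<^sup>2 = (\<Sum>i\<in>A. (norm (blinfun_apply (P i) x))\<^sup>2)"
    using assms by (auto simp: y_def norm_sum_projections)
  have "(norm y)\<^sup>2 \<le> norm y * norm x" using norm_cauchy_schwarz[of y x] e by simp
  then have "norm y \<le> norm x"
    by (cases "norm y = 0") (auto simp: power2_eq_square mult_le_cancel_left)
  then show ?thesis using e(2) by (metis norm_ge_zero power_mono)
qed

text \<open>
  Bessel's inequality makes the series converge at every vector, though in general not in norm.
\<close>
lemma projection_series:
  fixes P :: "nat \<Rightarrow> 'h::complex_hilbert \<Rightarrow>\<^sub>L 'h"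
  assumes P: "\<And>i. is_projection (P i)" and orth: "\<And>i j. i \<noteq> j \<Longrightarrow> P i o\<^sub>L P j = 0"
  obtains Q where "is_projection Q" "\<And>x. (\<lambda>i. blinfun_apply (P i) x) sums blinfun_apply Q x"
proof -
  have bess: "(\<Sum>i\<in>A. (norm (blinfun_apply (P i) x))\<^sup>2) \<le> (norm x)\<^sup>2" if "finite A" for A x
    by (rule bessel_inequality) (use that P orth in auto)
  have summ: "summable (\<lambda>i. blinfun_apply (P i) x)" for x
    unfolding summable_Cauchy
  proof (intro allI impI)
    fix e :: real assume "e > 0"
    have "summable (\<lambda>i. (norm (blinfun_apply (P i) x))\<^sup>2)"
      by (rule summableI_nonneg_bounded[where x = "(norm x)\<^sup>2"]) (auto intro: bess)
    then obtain N where N: "\<And>m n. m \<ge> N \<Longrightarrow> norm (\<Sum>i=m..<n. (norm (blinfun_apply (P i) x))\<^sup>2) < e\<^sup>2"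
      unfolding summable_Cauchy using \<open>e > 0\<close> by (meson zero_less_power)
    have "norm (\<Sum>i=m..<n. blinfun_apply (P i) x) < e" if "m \<ge> N" for m n
    proof -
      have "(norm (\<Sum>i=m..<n. blinfun_apply (P i) x))\<^sup>2 = (\<Sum>i=m..<n. (norm (blinfun_apply (P i) x))\<^sup>2)"
        by (rule norm_sum_projections) (auto simp: P orth)
      also have "\<dots> < e\<^sup>2" using N[OF that, of n] by simp
      finally show ?thesis using \<open>e > 0\<close> by (simp add: power2_less_imp_less)
    qed
    then show "\<exists>N. \<forall>m\<ge>N. \<forall>n. norm (\<Sum>i=m..<n. blinfun_apply (P i) x) < e" by blast
  qed
  define q where "q x = (\<Sum>i. blinfun_apply (P i) x)" for x
  have q: "(\<lambda>i. blinfun_apply (P i) x) sums q x" for x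
    unfolding q_def using summ by (rule summable_sums)
  have q_eq: "q x = y" if "(\<lambda>i. blinfun_apply (P i) x) sums y" for x y
    using q that sums_unique2 by blast
  have "bounded_linear q"
  proof (rule bounded_linear_intro[where K = 1])
    show "q (x + y) = q x + q y" for x y
      by (rule q_eq) (simp add: apply_simps sums_add q)
    show "q (r *\<^sub>R x) = r *\<^sub>R q x" for r x
      by (rule q_eq) (simp add: apply_simps sums_scaleR_right q)
    show "norm (q x) \<le> norm x * 1" for x
    proof -
      have "norm (\<Sum>i<n. blinfun_apply (P i) x) \<le> norm x" for n
      proof -
        have "(norm (\<Sum>i<n. blinfun_apply (P i) x))\<^sup>2 \<le> (norm x)\<^sup>2"
          using norm_sum_projections[of "{..<n}" P x] P orth bess[of "{..<n}" x] by auto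
        then show ?thesis by (rule power2_le_imp_le) simp
      qed
      then show ?thesis
        using LIMSEQ_le_const2[OF tendsto_norm[OF q[of x, unfolded sums_def]]] by simp
    qed
  qed
  then have app: "blinfun_apply (Blinfun q) x = q x" for x by (simp add: bounded_linear_Blinfun_apply)
  have Pq: "blinfun_apply (P i) (q x) = blinfun_apply (P i) x" for i x
  proof -
    have "(\<lambda>j. blinfun_apply (P i) (blinfun_apply (P j) x)) sums blinfun_apply (P i) (q x)"
      by (rule bounded_linear.sums[OF blinfun.bounded_linear_right q])
    moreover have "blinfun_apply (P i) (blinfun_apply (P j) x) = (if j = i then blinfun_apply (P i) x else 0)" for j
      using compose_zeroD[OF orth[of i j]] projection_idem[OF P[of i]] by auto
    ultimately show ?thesis using sums_If_finite_set[of "{i}" "\<lambda>j. blinfun_apply (P i) x"] sums_unique2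
      by fastforce
  qed
  have "is_projection (Blinfun q)"
    unfolding is_projection_iff app
  proof (intro conjI allI self_adjointI)
    show "q (q x) = q x" for x by (rule q_eq) (simp add: Pq q)
    show "Blinfun q \<in> bounded_ops"
      unfolding bounded_ops_def mem_Collect_eq app
    proof (intro allI q_eq)
      show "(\<lambda>i. blinfun_apply (P i) (c *\<^sub>C x)) sums (c *\<^sub>C q x)" for c x
        unfolding bounded_opsD[OF projection_ops[OF P]]
        by (rule bounded_linear.sums[OF bounded_linear_scaleC q])
    qed
    fix x y
    have "(\<lambda>i. blinfun_apply (P i) x \<bullet> y) sums (q x \<bullet> y)"
      by (rule bounded_linear.sums[OF bounded_linear_inner_left q])
    moreover have "(\<lambda>i. x \<bullet> blinfun_apply (P i) y) sums (x \<bullet> q y)"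
      by (rule bounded_linear.sums[OF bounded_linear_inner_right q])
    ultimately show "blinfun_apply (Blinfun q) x \<bullet> y = x \<bullet> blinfun_apply (Blinfun q) y"
      unfolding app self_adjointD[OF projection_self_adjoint[OF P]] by (rule sums_unique2)
  qed
  then show ?thesis using that[of "Blinfun q"] q by (simp add: app)
qed

text \<open>
  For fixed \<open>x\<close> the squared lengths of the projections of \<open>x\<close> onto the nodes are an additive mass
  function on the tree.
\<close>
definition vector_measure :: "('h::complex_hilbert \<Rightarrow>\<^sub>L 'h) \<Rightarrow> 'h \<Rightarrow> (nat \<Rightarrow> bool) measure"
  where "vector_measure a x = (SOME \<mu>. sets \<mu> = sets branches \<and>
    (\<forall>s. emeasure \<mu> (cylinder s) = ennreal (blinfun_apply (node a s) x \<bullet> x)))"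

lemma vector_measure:
  assumes a: "a \<in> bounded_ops"
  shows sets_vector_measure: "sets (vector_measure a x) = sets branches"
    and emeasure_vector_measure:
      "emeasure (vector_measure a x) (cylinder s) = ennreal (blinfun_apply (node a s) x \<bullet> x)"
proof -
  have "\<exists>\<mu>. sets \<mu> = sets branches \<and>
    (\<forall>s. emeasure \<mu> (cylinder s) = ennreal (blinfun_apply (node a s) x \<bullet> x))"
  proof (rule branch_measure_exists[of "\<lambda>s. blinfun_apply (node a s) x \<bullet> x"])
    show "0 \<le> blinfun_apply (node a s) x \<bullet> x" for s
      by (simp add: projection_inner node_projection a)
    show "blinfun_apply (node a s) x \<bullet> x =
        blinfun_apply (node a (False # s)) x \<bullet> x + blinfun_apply (node a (True # s)) x \<bullet> x" for s
      by (subst node_split[symmetric]) (simp only: apply_simps inner_add_left)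
  qed blast
  from someI_ex[OF this] show "sets (vector_measure a x) = sets branches"
    and "emeasure (vector_measure a x) (cylinder s) = ennreal (blinfun_apply (node a s) x \<bullet> x)"
    unfolding vector_measure_def by blast+
qed

lemma space_vector_measure: "a \<in> bounded_ops \<Longrightarrow> space (vector_measure a x) = UNIV"
  using sets_eq_imp_space_eq[OF sets_vector_measure] by simp

lemma finite_vector_measure: "a \<in> bounded_ops \<Longrightarrow> finite_measure (vector_measure a x)"
  using emeasure_vector_measure[of a x "[]"]
  by (intro finite_measureI) (simp add: space_vector_measure cylinder_Nil)

lemma measure_vector_measure:
  assumes a: "a \<in> bounded_ops"
  shows "measure (vector_measure a x) (cylinder s) = blinfun_apply (node a s) x \<bullet> x"
  using emeasure_vector_measure[OF a, of x s]
  by (simp add: measure_def projection_inner node_projection a)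

lemma measure_vector_measure_UNIV:
  "a \<in> bounded_ops \<Longrightarrow> measure (vector_measure a x) UNIV = x \<bullet> x"
  using measure_vector_measure[of a x "[]"] by (simp add: cylinder_Nil)

definition branch_op :: "('h::complex_hilbert \<Rightarrow>\<^sub>L 'h) \<Rightarrow> (nat \<Rightarrow> bool) set \<Rightarrow> ('h \<Rightarrow>\<^sub>L 'h)"
  where "branch_op a U = (SOME P. is_projection P \<and>
    (\<forall>x. blinfun_apply P x \<bullet> x = measure (vector_measure a x) U))"

text \<open>
  The sets whose measures, as functions of \<open>x\<close>, are the quadratic form of a projection are a Dynkin
  system that contains the cylinders. For a disjoint union the projections are orthogonal because the
  quadratic forms of any two of them add up to at most that of the identity.
\<close>
lemma branch_op_exists:
  assumes a: "a \<in> bounded_ops" and U: "U \<in> sets branches"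
  shows "\<exists>P. is_projection P \<and> (\<forall>x. blinfun_apply P x \<bullet> x = measure (vector_measure a x) U)"
  using Int_stable_cylinders cylinders_Pow U[unfolded sets_branches]
proof (induction rule: sigma_sets_induct_disjoint)
  case (basic A)
  then consider "A = {}" | s where "A = cylinder s" by auto
  then show ?case
  proof cases
    case 1
    then show ?thesis using is_projection_zero by (intro exI[of _ 0]) simp
  next
    case 2
    then show ?thesis
      by (intro exI[of _ "node a s"]) (simp add: node_projection measure_vector_measure a)
  qed
next
  case empty
  then show ?case using is_projection_zero by (intro exI[of _ 0]) simp
next
  case (compl A)
  then obtain P where P: "is_projection P" "\<And>x. blinfun_apply P x \<bullet> x = measure (vector_measure a x) A"
    by blast
  have "blinfun_apply (id_blinfun - P) x \<bullet> x = measure (vector_measure a x) (UNIV - A)" for x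
  proof -
    interpret finite_measure "vector_measure a x" by (rule finite_vector_measure[OF a])
    have "measure (vector_measure a x) (UNIV - A) = x \<bullet> x - measure (vector_measure a x) A"
      using finite_measure_compl[of A] compl(1)
      by (simp add: space_vector_measure a sets_vector_measure sets_branches measure_vector_measure_UNIV)
    then show ?thesis by (simp add: apply_simps inner_diff_left P)
  qed
  then show ?case using is_projection_compl[OF P(1)] by blast
next
  case (union A)
  then obtain P where P: "\<And>i. is_projection (P i)"
      "\<And>i x. blinfun_apply (P i) x \<bullet> x = measure (vector_measure a x) (A i)"
    by metis
  have A: "A i \<in> sets (vector_measure a x)" for i x
    using union(2) by (auto simp: sets_vector_measure a sets_branches)
  have orth: "P i o\<^sub>L P j = 0" if "i \<noteq> j" for i j
  proof (rule projections_orthogonalI[OF P(1) P(1)])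
    fix x
    interpret finite_measure "vector_measure a x" by (rule finite_vector_measure[OF a])
    have "A i \<inter> A j = {}" using union(1) that by (auto simp: disjoint_family_on_def)
    then have "measure (vector_measure a x) (A i) + measure (vector_measure a x) (A j) =
        measure (vector_measure a x) (A i \<union> A j)"
      using A by (intro finite_measure_Union[symmetric]) auto
    also have "\<dots> \<le> measure (vector_measure a x) (space (vector_measure a x))"
      by (rule bounded_measure)
    finally show "blinfun_apply (P i) x \<bullet> x + blinfun_apply (P j) x \<bullet> x \<le> x \<bullet> x"
      by (simp add: P space_vector_measure a measure_vector_measure_UNIV)
  qed
  obtain Q where Q: "is_projection Q" "\<And>x. (\<lambda>i. blinfun_apply (P i) x) sums blinfun_apply Q x"
    by (rule projection_series[OF P(1) orth]) auto
  have "blinfun_apply Q x \<bullet> x = measure (vector_measure a x) (\<Union>i. A i)" for x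
  proof -
    interpret finite_measure "vector_measure a x" by (rule finite_vector_measure[OF a])
    have "(\<lambda>i. blinfun_apply (P i) x \<bullet> x) sums (blinfun_apply Q x \<bullet> x)"
      by (rule bounded_linear.sums[OF bounded_linear_inner_left Q(2)])
    moreover have "(\<lambda>i. blinfun_apply (P i) x \<bullet> x) sums measure (vector_measure a x) (\<Union>i. A i)"
      unfolding P(2) using A union(1) by (intro finite_measure_UNION) auto
    ultimately show ?thesis by (rule sums_unique2)
  qed
  then show ?case using Q(1) by blast
qed

context
  fixes a :: "'h::complex_hilbert \<Rightarrow>\<^sub>L 'h"
  assumes a: "a \<in> bounded_ops"
begin

lemma branch_op_projection: "U \<in> sets branches \<Longrightarrow> is_projection (branch_op a U)"
  and branch_op_inner: "U \<in> sets branches \<Longrightarrow>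
    blinfun_apply (branch_op a U) x \<bullet> x = measure (vector_measure a x) U"
  unfolding branch_op_def using someI_ex[OF branch_op_exists[OF a]] by blast+

lemma branch_op_eqI:
  assumes "U \<in> sets branches" "self_adjoint P"
    and "\<And>x. blinfun_apply P x \<bullet> x = measure (vector_measure a x) U"
  shows "branch_op a U = P"
  by (rule self_adjoint_eqI[OF projection_self_adjoint[OF branch_op_projection[OF assms(1)]] assms(2)])
    (simp add: branch_op_inner assms)

lemma branch_op_cylinder: "branch_op a (cylinder s) = node a s"
  by (rule branch_op_eqI[OF cylinder_sets projection_self_adjoint[OF node_projection[OF a]]])
    (simp add: measure_vector_measure a)

lemma branch_op_UNIV: "branch_op a UNIV = id_blinfun"
  using branch_op_cylinder[of "[]"] by (simp add: cylinder_Nil)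

lemma branch_op_empty: "branch_op a {} = 0"
  by (rule branch_op_eqI[OF _ self_adjoint_zero]) auto

lemma branch_op_Un:
  assumes "U \<in> sets branches" "V \<in> sets branches" "U \<inter> V = {}"
  shows "branch_op a (U \<union> V) = branch_op a U + branch_op a V"
proof (rule branch_op_eqI)
  fix x
  interpret finite_measure "vector_measure a x" by (rule finite_vector_measure[OF a])
  show "blinfun_apply (branch_op a U + branch_op a V) x \<bullet> x = measure (vector_measure a x) (U \<union> V)"
    using assms by (simp add: apply_simps inner_add_left branch_op_inner finite_measure_Union
        sets_vector_measure a)
qed (use assms in \<open>auto intro: self_adjoint_add projection_self_adjoint branch_op_projection\<close>)

lemma branch_op_disjoint:
  assumes "U \<in> sets branches" "V \<in> sets branches" "U \<inter> V = {}"
  shows "branch_op a U o\<^sub>L branch_op a V = 0"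
proof (rule projections_orthogonalI)
  fix x
  have "blinfun_apply (branch_op a U) x \<bullet> x + blinfun_apply (branch_op a V) x \<bullet> x
      = blinfun_apply (branch_op a (U \<union> V)) x \<bullet> x"
    by (simp add: branch_op_Un assms apply_simps inner_add_left)
  also have "\<dots> \<le> norm (blinfun_apply (branch_op a (U \<union> V)) x) * norm x" by (rule norm_cauchy_schwarz)
  also have "\<dots> \<le> norm x * norm x"
    using assms by (intro mult_right_mono projection_norm_le branch_op_projection) auto
  finally show "blinfun_apply (branch_op a U) x \<bullet> x + blinfun_apply (branch_op a V) x \<bullet> x \<le> x \<bullet> x"
    by (simp add: power2_norm_eq_inner[symmetric] power2_eq_square)
qed (use assms in \<open>auto intro: branch_op_projection\<close>)

lemma branch_op_Int:
  assumes U: "U \<in> sets branches" and V: "V \<in> sets branches"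
  shows "branch_op a (U \<inter> V) = branch_op a U o\<^sub>L branch_op a V"
proof (rule blinfun_eqI)
  fix x
  have 1: "branch_op a U = branch_op a (U \<inter> V) + branch_op a (U - V)"
    using branch_op_Un[of "U \<inter> V" "U - V"] U V by (simp add: Int_Diff_Un Int_Diff_disjoint sets.Int sets.Diff)
  have 2: "branch_op a V = branch_op a (U \<inter> V) + branch_op a (V - U)"
    using branch_op_Un[of "U \<inter> V" "V - U"] U V
    by (simp add: Int_commute[of U V] Int_Diff_Un Int_Diff_disjoint sets.Int sets.Diff)
  have z: "blinfun_apply (branch_op a A) (blinfun_apply (branch_op a B) x) = 0"
    if "A \<in> sets branches" "B \<in> sets branches" "A \<inter> B = {}" for A B
    using compose_zeroD[OF branch_op_disjoint[OF that]] .
  show "blinfun_apply (branch_op a (U \<inter> V)) x = blinfun_apply (branch_op a U o\<^sub>L branch_op a V) x"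
  proof -
    have "blinfun_apply (branch_op a (U \<inter> V)) (blinfun_apply (branch_op a (V - U)) x) = 0"
      by (rule z) (use U V in auto)
    moreover have "blinfun_apply (branch_op a (U - V)) (blinfun_apply (branch_op a (U \<inter> V)) x) = 0"
      by (rule z) (use U V in auto)
    moreover have "blinfun_apply (branch_op a (U - V)) (blinfun_apply (branch_op a (V - U)) x) = 0"
      by (rule z) (use U V in auto)
    ultimately show ?thesis
      unfolding 1 2 using U V by (simp add: apply_simps projection_idem branch_op_projection sets.Int)
  qed
qed

lemma branch_op_subset:
  assumes "U \<in> sets branches" "V \<in> sets branches" "U \<subseteq> V"
  shows "branch_op a V o\<^sub>L branch_op a U = branch_op a U"
  using branch_op_Int[OF assms(2,1)] assms(3) by (simp add: Int_absorb1)

lemma branch_op_sums: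
  assumes F: "range F \<subseteq> sets branches" and disj: "disjoint_family (F :: nat \<Rightarrow> _)"
  shows "(\<lambda>n. blinfun_apply (branch_op a (F n)) x) sums blinfun_apply (branch_op a (\<Union>n. F n)) x"
proof -
  have Fn: "F n \<in> sets branches" for n using F by auto
  have "branch_op a (F i) o\<^sub>L branch_op a (F j) = 0" if "i \<noteq> j" for i j
    using disj that by (intro branch_op_disjoint Fn) (auto simp: disjoint_family_on_def)
  then obtain Q where Q: "is_projection Q"
      "\<And>x. (\<lambda>n. blinfun_apply (branch_op a (F n)) x) sums blinfun_apply Q x"
    using projection_series[of "\<lambda>n. branch_op a (F n)"] branch_op_projection[OF Fn] by metis
  have "branch_op a (\<Union>n. F n) = Q"
  proof (rule branch_op_eqI)
    fix x
    interpret finite_measure "vector_measure a x" by (rule finite_vector_measure[OF a])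
    have "(\<lambda>i. blinfun_apply (branch_op a (F i)) x \<bullet> x) sums (blinfun_apply Q x \<bullet> x)"
      by (rule bounded_linear.sums[OF bounded_linear_inner_left Q(2)])
    moreover have "(\<lambda>i. blinfun_apply (branch_op a (F i)) x \<bullet> x) sums measure (vector_measure a x) (\<Union>i. F i)"
      unfolding branch_op_inner[OF Fn] using F disj
      by (intro finite_measure_UNION) (auto simp: sets_vector_measure a)
    ultimately show "blinfun_apply Q x \<bullet> x = measure (vector_measure a x) (\<Union>n. F n)"
      by (rule sums_unique2)
  qed (use Fn Q in \<open>auto intro: projection_self_adjoint\<close>)
  then show ?thesis using Q(2) by simp
qed

lemma branch_op_finite_UN:
  assumes "finite I" "\<And>i. i \<in> I \<Longrightarrow> V i \<in> sets branches" "disjoint_family_on V I"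
  shows "branch_op a (\<Union>i\<in>I. V i) = (\<Sum>i\<in>I. branch_op a (V i))"
  using assms
proof (induction I rule: finite_induct)
  case (insert i I)
  have "V i \<inter> (\<Union>j\<in>I. V j) = {}"
    using insert.prems(2) insert.hyps by (auto simp: disjoint_family_on_def)
  then have "branch_op a (V i \<union> (\<Union>j\<in>I. V j)) = branch_op a (V i) + branch_op a (\<Union>j\<in>I. V j)"
    using insert by (intro branch_op_Un) auto
  then show ?case using insert by (simp add: disjoint_family_on_def)
qed (simp add: branch_op_empty)

end

section \<open>Strongly spectral operators along the branches\<close>

lemma norm_suminf_geometric:
  fixes f :: "nat \<Rightarrow> 'a::banach"
  assumes "\<And>p. norm (f p) \<le> B * (3/4) ^ p"
  shows "summable f" "norm (suminf f) \<le> 4 * B"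
proof -
  have g: "(\<lambda>p. B * (3/4) ^ p) sums (4 * B)"
    using sums_mult[OF geometric_sums[of "3/4::real"], of B] by (simp add: mult.commute)
  show "summable f"
    by (rule summable_comparison_test'[OF sums_summable[OF g]]) (use assms in simp)
  have s: "summable (\<lambda>p. norm (f p))"
    by (rule summable_comparison_test'[OF sums_summable[OF g]]) (use assms in simp)
  have "norm (suminf f) \<le> (\<Sum>p. norm (f p))" by (rule summable_norm[OF s])
  also have "\<dots> \<le> (\<Sum>p. B * (3/4) ^ p)" by (rule suminf_le[OF assms s sums_summable[OF g]])
  also have "\<dots> = 4 * B" using g by (rule sums_unique[symmetric])
  finally show "norm (suminf f) \<le> 4 * B" .
qed

definition branch_value :: "('h::complex_hilbert \<Rightarrow>\<^sub>L 'h) \<Rightarrow> (nat \<Rightarrow> bool) \<Rightarrow> complex"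
  where "branch_value a \<omega> = lim (\<lambda>p. center a (prefix \<omega> p))"

lemma eps_add: "eps a (p + m) = eps a m * (3/4) ^ p"
  by (simp add: eps_def power_add)

lemma eps_tendsto_0: "eps a \<longlonglongrightarrow> 0"
proof -
  have "(\<lambda>p. 4 * norm a * (3/4) ^ p) \<longlonglongrightarrow> 4 * norm a * 0"
    by (intro tendsto_mult tendsto_const LIMSEQ_power_zero) auto
  then show ?thesis by (simp add: eps_def[abs_def])
qed

lemma branch_value_near_center: "cmod (branch_value a \<omega> - center a (prefix \<omega> m)) \<le> 4 * eps a m"
proof -
  define f where "f p = center a (prefix \<omega> p)" for p
  have step: "cmod (f (Suc (p + m)) - f (p + m)) \<le> eps a m * (3/4) ^ p" for p m
    unfolding f_def using center_step[of a "\<omega> (p + m)" "prefix \<omega> (p + m)"] by (simp add: eps_add)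
  have "\<exists>L. f \<longlonglongrightarrow> L \<and> cmod (L - f m) \<le> 4 * eps a m" for m
  proof -
    let ?d = "\<lambda>p. f (Suc (p + m)) - f (p + m)"
    note d = norm_suminf_geometric[of ?d, OF step]
    have t: "(\<Sum>p<n. ?d p) = f (n + m) - f m" for n by (induction n) auto
    have "(\<lambda>n. f (n + m) - f m) \<longlonglongrightarrow> suminf ?d"
      using summable_LIMSEQ[OF d(1)] by (simp only: t)
    then have "(\<lambda>n. f (n + m) - f m + f m) \<longlonglongrightarrow> suminf ?d + f m"
      by (intro tendsto_add tendsto_const)
    then have "f \<longlonglongrightarrow> suminf ?d + f m" by (simp add: LIMSEQ_offset)
    then show ?thesis using d(2) by (intro exI[of _ "suminf ?d + f m"]) simp
  qed
  then obtain L where L: "f \<longlonglongrightarrow> L" "cmod (L - f m) \<le> 4 * eps a m" by blast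
  have "branch_value a \<omega> = L"
    using limI[OF L(1)] by (simp add: branch_value_def f_def[abs_def])
  then show ?thesis using L(2) by (simp add: f_def)
qed

text \<open>
  The part of the compression of \<open>a\<close> to a node that leads from one of its children to the other one.
\<close>
primrec corner :: "('h::complex_hilbert \<Rightarrow>\<^sub>L 'h) \<Rightarrow> bool list \<Rightarrow> ('h \<Rightarrow>\<^sub>L 'h)"
  where "corner a [] = 0"
  | "corner a (b # s) = node a ((\<not> b) # s) o\<^sub>L a o\<^sub>L node a (b # s)"

definition strict_part :: "('h::complex_hilbert \<Rightarrow>\<^sub>L 'h) \<Rightarrow> (nat \<Rightarrow> bool) \<Rightarrow> ('h \<Rightarrow>\<^sub>L 'h)"
  where "strict_part a \<omega> = (\<Sum>p. corner a (prefix \<omega> (Suc p)))"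

definition branch_fun :: "('h::complex_hilbert \<Rightarrow>\<^sub>L 'h) \<Rightarrow> (nat \<Rightarrow> bool) \<Rightarrow> ('h \<Rightarrow>\<^sub>L 'h)"
  where "branch_fun a \<omega> = scale_op (branch_value a \<omega>) id_blinfun + strict_part a \<omega>"

declare node.simps(2) [simp del] corner.simps(2) [simp del]

context
  fixes a :: "'h::complex_hilbert \<Rightarrow>\<^sub>L 'h"
  assumes a: "a \<in> bounded_ops"
begin

lemma node_prefix:
  assumes "n \<le> m"
  shows "node a (prefix \<omega> n) o\<^sub>L node a (prefix \<omega> m) = node a (prefix \<omega> m)"
    and "node a (prefix \<omega> m) o\<^sub>L node a (prefix \<omega> n) = node a (prefix \<omega> m)"
  using assms
proof (induction rule: dec_induct)
  case base
  { case 1 show ?case by (simp add: projection_compose_self node_projection a) }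
  { case 2 show ?case by (simp add: projection_compose_self node_projection a) }
next
  case (step k)
  {
    case 1
    have "node a (prefix \<omega> n) o\<^sub>L node a (prefix \<omega> (Suc k)) =
        (node a (prefix \<omega> n) o\<^sub>L node a (prefix \<omega> k)) o\<^sub>L node a (prefix \<omega> (Suc k))"
      by (simp add: compose_assoc node_parent[OF a])
    then show ?case using step.IH(1) by (simp add: node_parent[OF a])
  next
    case 2
    have "node a (prefix \<omega> (Suc k)) o\<^sub>L node a (prefix \<omega> n) =
        node a (prefix \<omega> (Suc k)) o\<^sub>L (node a (prefix \<omega> k) o\<^sub>L node a (prefix \<omega> n))"
      by (simp add: compose_assoc[symmetric] node_parent[OF a])
    then show ?case using step.IH(2) by (simp add: node_parent[OF a])
  }
qed

text \<open>
  Subtracting a scalar does not change a corner, because siblings are orthogonal. So it is bounded by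
  the distance of the compression to the parent from the scalars.
\<close>
lemma norm_corner: "norm (corner a (b # s)) \<le> eps a (length s)"
proof -
  let ?F = "node a s" and ?B = "node a (b # s)" and ?B' = "node a ((\<not> b) # s)"
  let ?c = "scale_op (center a s) id_blinfun :: 'h \<Rightarrow>\<^sub>L 'h"
  have 1: "blinfun_apply ?F (blinfun_apply ?B x) = blinfun_apply ?B x" for x
    by (metis compose_apply node_parent(1)[OF a])
  have 2: "blinfun_apply ?B' (blinfun_apply ?F x) = blinfun_apply ?B' x" for x
    by (metis compose_apply node_parent(2)[OF a])
  have 3: "blinfun_apply ?B' (blinfun_apply ?B x) = 0" for x
    by (rule compose_zeroD[OF node_siblings_orthogonal[OF a]])
  have "corner a (b # s) = ?B' o\<^sub>L (?F o\<^sub>L (a - ?c) o\<^sub>L ?F) o\<^sub>L ?B"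
    by (rule blinfun_eqI)
      (simp add: corner.simps apply_simps 1 2 3 bounded_opsD[OF projection_ops[OF node_projection[OF a]]])
  also have "norm \<dots> \<le> 1 * eps a (length s) * 1"
    by (intro norm_compose_mono node_compression a projection_norm_le_1 node_projection)
  finally show ?thesis by simp
qed

lemma norm_corner_prefix: "norm (corner a (prefix \<omega> (Suc p))) \<le> eps a p"
  using norm_corner[of "\<omega> p" "prefix \<omega> p"] by simp

lemma corner_left:
  "node a (prefix \<omega> q) o\<^sub>L corner a (prefix \<omega> (Suc p)) = (if q \<le> p then corner a (prefix \<omega> (Suc p)) else 0)"
proof -
  let ?S = "node a ((\<not> \<omega> p) # prefix \<omega> p)"
  have 1: "node a (prefix \<omega> p) o\<^sub>L ?S = ?S" by (rule node_parent(1)[OF a])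
  have "node a (prefix \<omega> q) o\<^sub>L ?S = (if q \<le> p then ?S else 0)"
  proof (cases "q \<le> p")
    case True
    have "node a (prefix \<omega> q) o\<^sub>L ?S = (node a (prefix \<omega> q) o\<^sub>L node a (prefix \<omega> p)) o\<^sub>L ?S"
      by (simp only: compose_assoc 1)
    then show ?thesis using True by (simp only: node_prefix(1) 1) simp
  next
    case False
    then have q: "Suc p \<le> q" by simp
    have "node a (prefix \<omega> q) o\<^sub>L ?S =
        node a (prefix \<omega> q) o\<^sub>L (node a (prefix \<omega> (Suc p)) o\<^sub>L ?S)"
      by (simp only: compose_assoc[symmetric] node_prefix(2)[OF q])
    also have "node a (prefix \<omega> (Suc p)) o\<^sub>L ?S = 0"
      using node_siblings_orthogonal[OF a, of "\<not> \<omega> p" "prefix \<omega> p"] by simp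
    finally show ?thesis using False by simp
  qed
  then show ?thesis
    by (simp add: corner.simps compose_assoc[symmetric])
qed

lemma corner_right:
  "corner a (prefix \<omega> (Suc p)) o\<^sub>L node a (prefix \<omega> (Suc p)) = corner a (prefix \<omega> (Suc p))"
  by (simp add: corner.simps compose_assoc projection_compose_self node_projection a)

lemma corner_bounded_ops: "corner a s \<in> bounded_ops"
  by (cases s) (simp_all add: corner.simps bounded_ops_intros projection_ops node_projection a)

lemma summable_corner: "summable (\<lambda>p. corner a (prefix \<omega> (Suc p)))"
  using norm_corner_prefix by (intro norm_suminf_geometric(1)[where B = "4 * norm a"]) (simp add: eps_def)

lemma strict_part_bounded_ops: "strict_part a \<omega> \<in> bounded_ops"
proof -
  have "(\<Sum>p<n. corner a (prefix \<omega> (Suc p))) \<in> bounded_ops" for n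
    by (induction n) (auto simp: bounded_ops_intros corner_bounded_ops simp del: prefix.simps)
  then show ?thesis
    unfolding strict_part_def
    by (intro closed_sequentially[OF closed_bounded_ops _ summable_LIMSEQ[OF summable_corner]])
qed

lemma branch_fun_bounded_ops: "branch_fun a \<omega> \<in> bounded_ops"
  by (simp add: branch_fun_def bounded_ops_intros strict_part_bounded_ops)

lemma op_power_Suc: "op_power n (Suc k) = n o\<^sub>L op_power n k"
  by (simp add: op_power_def)

text \<open>
  What \<open>strict_part a \<omega>\<close> maps into the node of depth \<open>q\<close> comes from the node of depth \<open>q + 1\<close>, and
  is geometrically small in \<open>q\<close>. So the norms of its powers decrease superexponentially.
\<close>

lemma norm_strict_part_power:
  "norm (node a (prefix \<omega> q) o\<^sub>L op_power (strict_part a \<omega>) k)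
    \<le> (16 * norm a) ^ k * (3/4) ^ (\<Sum>{..<k}) * (3/4) ^ (k * q)"
proof (induction k arbitrary: q)
  case 0
  have "node a (prefix \<omega> q) o\<^sub>L id_blinfun = node a (prefix \<omega> q)" by (intro blinfun_eqI) simp
  then show ?case using projection_norm_le_1[OF node_projection[OF a]] by (simp add: op_power_def)
next
  case (Suc k)
  let ?n = "strict_part a \<omega>"
  let ?A = "(16 * norm a) ^ k * (3/4) ^ (\<Sum>{..<k}) :: real"
  let ?N = "op_power ?n k"
  define f where "f p = node a (prefix \<omega> q) o\<^sub>L corner a (prefix \<omega> (Suc p)) o\<^sub>L ?N" for p
  interpret L: bounded_linear "\<lambda>c. node a (prefix \<omega> q) o\<^sub>L c o\<^sub>L ?N"
    by (intro bounded_linear_intros)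
  have sums: "f sums (node a (prefix \<omega> q) o\<^sub>L ?n o\<^sub>L ?N)"
    using L.sums[OF summable_sums[OF summable_corner[of \<omega>]]]
    unfolding f_def[abs_def] strict_part_def[symmetric] .
  have zero: "f p = 0" if "p < q" for p
    unfolding f_def corner_left using that by (auto intro!: blinfun_eqI)
  have f_shift: "(\<lambda>p. f (p + q)) sums (node a (prefix \<omega> q) o\<^sub>L ?n o\<^sub>L ?N)"
    using sums_split_initial_segment[OF sums, of q] zero by simp
  have bound: "norm (f (p + q)) \<le> (4 * norm a * ?A * (3/4) ^ k * (3/4) ^ (Suc k * q)) * (3/4) ^ p" for p
  proof -
    let ?C = "corner a (prefix \<omega> (Suc (p + q)))"
    have "f (p + q) = ?C o\<^sub>L ?N"
      unfolding f_def corner_left by simp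
    also have "\<dots> = ?C o\<^sub>L (node a (prefix \<omega> (Suc (p + q))) o\<^sub>L ?N)"
      by (simp only: compose_assoc[symmetric] corner_right)
    also have "norm \<dots> \<le> eps a (p + q) * (?A * (3/4) ^ (k * Suc (p + q)))"
      by (intro norm_compose_mono norm_corner_prefix Suc)
    also have "\<dots> = 4 * norm a * ?A * (3/4) ^ k * (3/4) ^ (Suc k * q) * ((3/4) ^ (Suc k * p))"
      by (simp add: eps_def power_add power_mult_distrib algebra_simps)
    also have "\<dots> \<le> 4 * norm a * ?A * (3/4) ^ k * (3/4) ^ (Suc k * q) * ((3/4) ^ p)"
      by (intro mult_left_mono power_decreasing) auto
    finally show ?thesis .
  qed
  have "node a (prefix \<omega> q) o\<^sub>L op_power ?n (Suc k) = (\<Sum>p. f (p + q))"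
    using sums_unique[OF f_shift] by (simp add: op_power_Suc compose_assoc)
  then have "norm (node a (prefix \<omega> q) o\<^sub>L op_power ?n (Suc k))
      \<le> 4 * (4 * norm a * ?A * (3/4) ^ k * (3/4) ^ (Suc k * q))"
    using norm_suminf_geometric(2)[of "\<lambda>p. f (p + q)", OF bound] by simp
  also have "\<dots> = (16 * norm a) ^ Suc k * (3/4) ^ (\<Sum>{..<Suc k}) * (3/4) ^ (Suc k * q)"
    by (simp add: power_add)
  finally show ?case .
qed

lemma quasi_nilpotent_strict_part: "quasi_nilpotent (strict_part a \<omega>)"
  unfolding quasi_nilpotent_def
proof (intro conjI strict_part_bounded_ops)
  let ?n = "strict_part a \<omega>" and ?r = "sqrt (3/4) :: real"
  have "norm (op_power ?n k) \<le> (16 * norm a * ?r ^ (k - 1)) ^ k" for k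
  proof -
    have sum2: "2 * (\<Sum>{..<k}) = k * (k - 1)"
    proof (induction k)
      case (Suc k) then show ?case by (cases k) auto
    qed simp
    have "(3/4::real) ^ (\<Sum>{..<k}) = (?r ^ 2) ^ (\<Sum>{..<k})" by simp
    also have "\<dots> = (?r ^ (k - 1)) ^ k" by (simp only: power_mult[symmetric] sum2 mult.commute)
    finally have "(3/4::real) ^ (\<Sum>{..<k}) = (?r ^ (k - 1)) ^ k" .
    moreover have "id_blinfun o\<^sub>L op_power ?n k = op_power ?n k" by (intro blinfun_eqI) simp
    ultimately show ?thesis
      using norm_strict_part_power[of \<omega> 0 k] by (simp add: power_mult_distrib)
  qed
  then have "root k (norm (op_power ?n k)) \<le> 16 * norm a * ?r ^ (k - 1)" if "k > 0" for k
    using that by (metis (no_types, lifting) mult_nonneg_nonneg norm_ge_zero real_root_le_mono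
        real_root_power_cancel zero_le_numeral zero_le_power real_sqrt_ge_zero zero_le_divide_iff)
  then have ev: "\<forall>\<^sub>F k in sequentially. root k (norm (op_power ?n k)) \<le> 16 * norm a * ?r ^ (k - 1)"
    by (auto simp: eventually_sequentially intro!: exI[of _ 1])
  have "(\<lambda>k. 16 * norm a * ?r ^ k) \<longlonglongrightarrow> 16 * norm a * 0"
    by (intro tendsto_mult tendsto_const LIMSEQ_power_zero) (auto simp: real_sqrt_lt_1_iff)
  then have "(\<lambda>k. 16 * norm a * ?r ^ (Suc k - 1)) \<longlonglongrightarrow> 0" by simp
  then have lim: "(\<lambda>k. 16 * norm a * ?r ^ (k - 1)) \<longlonglongrightarrow> 0"
    by (rule LIMSEQ_imp_Suc)
  show "(\<lambda>k. root k (norm (op_power ?n k))) \<longlonglongrightarrow> 0"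
    by (rule tendsto_sandwich[OF _ ev tendsto_const lim])
      (auto intro!: always_eventually real_root_pos_pos_le)
qed

lemma strongly_spectral_branch_fun: "strongly_spectral (branch_fun a \<omega>)"
  unfolding strongly_spectral_def branch_fun_def quasi_scalar_def
  using quasi_nilpotent_strict_part is_projection_id by blast

lemma strict_part_normal:
  assumes "adj a o\<^sub>L a = a o\<^sub>L adj a"
  shows "strict_part a \<omega> = 0"
proof -
  have "corner a s = 0" for s
  proof (cases s)
    case (Cons b t)
    have "corner a s = (node a ((\<not> b) # t) o\<^sub>L node a (b # t)) o\<^sub>L a"
      by (simp add: Cons corner.simps compose_assoc normal_node_commute(1)[OF a assms])
    then show ?thesis by (simp add: node_siblings_orthogonal[OF a])
  qed simp
  then show ?thesis by (simp add: strict_part_def)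
qed

end

lemma quasi_nilpotent_zero: "quasi_nilpotent (0 :: 'h::complex_hilbert \<Rightarrow>\<^sub>L 'h)"
proof -
  have "root i (norm (op_power (0 :: 'h \<Rightarrow>\<^sub>L 'h) i)) = 0" for i
    by (cases i) (simp_all add: op_power_def)
  then show ?thesis by (simp add: quasi_nilpotent_def bounded_ops_zero)
qed

lemma strongly_spectral_scalar: "strongly_spectral (scale_op c (id_blinfun :: 'h::complex_hilbert \<Rightarrow>\<^sub>L 'h))"
  unfolding strongly_spectral_def quasi_scalar_def
  using is_projection_id quasi_nilpotent_zero by (metis add_0_right)

section \<open>Riemann sums\<close>

text \<open>
  A block operator with orthogonal domains \<open>P i\<close> and orthogonal ranges \<open>Q (g i)\<close> is bounded like its
  largest block. The indices with the same value of \<open>g\<close> share one block, and hence one range, so that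
  the number of indices does not enter the bound.
\<close>
lemma norm_block_sum_le:
  assumes I: "finite I" and P: "\<And>i. i \<in> I \<Longrightarrow> is_projection (P i)"
    and P_orth: "\<And>i j. i \<in> I \<Longrightarrow> j \<in> I \<Longrightarrow> i \<noteq> j \<Longrightarrow> P i o\<^sub>L P j = 0"
    and Q: "\<And>i. i \<in> I \<Longrightarrow> is_projection (Q (g i))"
    and Q_orth: "\<And>i j. i \<in> I \<Longrightarrow> j \<in> I \<Longrightarrow> g i \<noteq> g j \<Longrightarrow> Q (g i) o\<^sub>L Q (g j) = 0"
    and T: "\<And>i. i \<in> I \<Longrightarrow> norm (T (g i)) \<le> e" "\<And>i. i \<in> I \<Longrightarrow> Q (g i) o\<^sub>L T (g i) = T (g i)"
    and e: "0 \<le> e"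
  shows "norm (\<Sum>i\<in>I. T (g i) o\<^sub>L P i) \<le> e"
proof (rule norm_blinfun_bound[OF e])
  fix x
  define v where "v c = (\<Sum>i\<in>{i\<in>I. g i = c}. blinfun_apply (P i) x)" for c
  have v: "(norm (v c))\<^sup>2 = (\<Sum>i\<in>{i\<in>I. g i = c}. (norm (blinfun_apply (P i) x))\<^sup>2)" for c
    unfolding v_def using I P P_orth by (intro norm_sum_projections) auto
  have "blinfun_apply (\<Sum>i\<in>I. T (g i) o\<^sub>L P i) x = (\<Sum>i\<in>I. blinfun_apply (T (g i)) (blinfun_apply (P i) x))"
    by (simp add: apply_simps)
  also have "\<dots> = (\<Sum>c\<in>g ` I. \<Sum>i\<in>{i\<in>I. g i = c}. blinfun_apply (T (g i)) (blinfun_apply (P i) x))"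
    by (rule sum.image_gen[OF I])
  also have "\<dots> = (\<Sum>c\<in>g ` I. blinfun_apply (T c) (v c))"
    unfolding v_def by (intro sum.cong refl) (simp add: apply_simps)
  finally have eq: "blinfun_apply (\<Sum>i\<in>I. T (g i) o\<^sub>L P i) x = (\<Sum>c\<in>g ` I. blinfun_apply (T c) (v c))" .
  have "(norm (\<Sum>c\<in>g ` I. blinfun_apply (T c) (v c)))\<^sup>2 = (\<Sum>c\<in>g ` I. (norm (blinfun_apply (T c) (v c)))\<^sup>2)"
  proof (rule norm_sum_Pythagorean)
    show "pairwise (\<lambda>c d. orthogonal (blinfun_apply (T c) (v c)) (blinfun_apply (T d) (v d))) (g ` I)"
    proof (rule pairwiseI)
      fix c d assume "c \<in> g ` I" "d \<in> g ` I" "c \<noteq> d"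
      then obtain i j where ij: "i \<in> I" "j \<in> I" "c = g i" "d = g j" by auto
      have "blinfun_apply (Q c) (blinfun_apply (T c) (v c)) \<bullet> blinfun_apply (Q d) (blinfun_apply (T d) (v d)) = 0"
        using Q Q_orth ij \<open>c \<noteq> d\<close> by (intro orthogonal_ranges) auto
      moreover have "blinfun_apply (Q c) (blinfun_apply (T c) (v c)) = blinfun_apply (T c) (v c)"
          "blinfun_apply (Q d) (blinfun_apply (T d) (v d)) = blinfun_apply (T d) (v d)"
        using T(2) ij by (metis compose_apply)+
      ultimately show "orthogonal (blinfun_apply (T c) (v c)) (blinfun_apply (T d) (v d))"
        by (simp add: orthogonal_def)
    qed
  qed (use I in simp)
  also have "\<dots> \<le> (\<Sum>c\<in>g ` I. e\<^sup>2 * (norm (v c))\<^sup>2)"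
  proof (rule sum_mono)
    fix c assume "c \<in> g ` I"
    then have le: "norm (blinfun_apply (T c) (v c)) \<le> e * norm (v c)"
      using T(1) by (auto intro!: order_trans[OF norm_blinfun] mult_right_mono)
    show "(norm (blinfun_apply (T c) (v c)))\<^sup>2 \<le> e\<^sup>2 * (norm (v c))\<^sup>2"
      using power_mono[OF le norm_ge_zero, of 2] by (simp add: power_mult_distrib)
  qed
  also have "\<dots> = e\<^sup>2 * (\<Sum>i\<in>I. (norm (blinfun_apply (P i) x))\<^sup>2)"
    unfolding v sum_distrib_left[symmetric] by (simp add: sum.image_gen[OF I, symmetric])
  also have "\<dots> \<le> e\<^sup>2 * (norm x)\<^sup>2"
    by (intro mult_left_mono bessel_inequality I P P_orth) auto
  finally have "(norm (\<Sum>c\<in>g ` I. blinfun_apply (T c) (v c)))\<^sup>2 \<le> (e * norm x)\<^sup>2"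
    by (simp add: power_mult_distrib)
  then show "norm (blinfun_apply (\<Sum>i\<in>I. T (g i) o\<^sub>L P i) x) \<le> e * norm x"
    unfolding eq by (rule power2_le_imp_le) (use e in simp)
qed

lemma compose_sum_right: "f o\<^sub>L (\<Sum>i\<in>I. g i) = (\<Sum>i\<in>I. f o\<^sub>L g i)"
  by (rule bounded_bilinear.sum_right[OF bounded_bilinear_blinfun_compose])

context
  fixes a :: "'h::complex_hilbert \<Rightarrow>\<^sub>L 'h"
  assumes a: "a \<in> bounded_ops"
begin

text \<open>
  The corners of the first \<open>m\<close> levels telescope: on the node of depth \<open>m\<close> they are exactly the part of
  \<open>a\<close> that leads out of it.
\<close>
lemma partial_strict_part:
  "(\<Sum>p<m. corner a (prefix \<omega> (Suc p))) o\<^sub>L node a (prefix \<omega> m) =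
    (id_blinfun - node a (prefix \<omega> m)) o\<^sub>L a o\<^sub>L node a (prefix \<omega> m)"
proof (induction m)
  case 0
  show ?case by (intro blinfun_eqI) (simp add: apply_simps)
next
  case (Suc m)
  let ?F = "node a (prefix \<omega> m)" and ?G = "node a (prefix \<omega> (Suc m))"
  have S: "node a ((\<not> \<omega> m) # prefix \<omega> m) = ?F - ?G" using node_sibling[of a "\<omega> m"] by simp
  have FG: "?F o\<^sub>L ?G = ?G" by (rule node_prefix(1)[OF a]) simp
  have FGx: "blinfun_apply ?F (blinfun_apply ?G x) = blinfun_apply ?G x" for x
    using FG by (metis compose_apply)
  have "(\<Sum>p<Suc m. corner a (prefix \<omega> (Suc p))) o\<^sub>L ?G =
      (((\<Sum>p<m. corner a (prefix \<omega> (Suc p))) o\<^sub>L ?F) o\<^sub>L ?G) + (corner a (prefix \<omega> (Suc m)) o\<^sub>L ?G)"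
    unfolding compose_assoc FG
    by (intro blinfun_eqI) (simp add: apply_simps del: prefix.simps)
  also have "\<dots> = (((id_blinfun - ?F) o\<^sub>L a o\<^sub>L ?F) o\<^sub>L ?G) + ((?F - ?G) o\<^sub>L a o\<^sub>L ?G)"
    unfolding Suc corner_right[OF a] by (simp add: corner.simps S[simplified])
  also have "\<dots> = (id_blinfun - ?G) o\<^sub>L a o\<^sub>L ?G"
    by (intro blinfun_eqI) (simp add: apply_simps FGx del: prefix.simps)
  finally show ?case .
qed

context
  fixes I :: "'i set" and V :: "'i \<Rightarrow> (nat \<Rightarrow> bool) set"
  assumes I: "finite I" and V: "\<And>i. i \<in> I \<Longrightarrow> V i \<in> sets branches"
    and disj: "disjoint_family_on V I" and cover: "(\<Union>i\<in>I. V i) = UNIV"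
begin

lemma partition_projection: "i \<in> I \<Longrightarrow> is_projection (branch_op a (V i))"
  by (rule branch_op_projection[OF a V])

lemma partition_orthogonal:
  "i \<in> I \<Longrightarrow> j \<in> I \<Longrightarrow> i \<noteq> j \<Longrightarrow> branch_op a (V i) o\<^sub>L branch_op a (V j) = 0"
  using disj by (intro branch_op_disjoint[OF a] V) (auto simp: disjoint_family_on_def)

lemma partition_sum: "(\<Sum>i\<in>I. branch_op a (V i)) = id_blinfun"
  using branch_op_finite_UN[OF a I V disj] branch_op_UNIV[OF a] cover by simp

lemma norm_scalar_sum_le:
  assumes "0 \<le> e" "\<And>i. i \<in> I \<Longrightarrow> branch_op a (V i) \<noteq> 0 \<Longrightarrow> cmod (c i) \<le> e"
  shows "norm (\<Sum>i\<in>I. scale_op (c i) (branch_op a (V i))) \<le> e"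
proof -
  let ?T = "\<lambda>i. scale_op (c i) (branch_op a (V i))"
  have "norm (\<Sum>i\<in>I. ?T (id i) o\<^sub>L branch_op a (V i)) \<le> e"
  proof (rule norm_block_sum_le[where Q = "\<lambda>i. branch_op a (V i)"])
    fix i assume i: "i \<in> I"
    show "norm (?T (id i)) \<le> e"
    proof (cases "branch_op a (V i) = 0")
      case False
      have "cmod (c i) * norm (branch_op a (V i)) \<le> e * 1"
        using assms False i by (intro mult_mono projection_norm_le_1 partition_projection) auto
      then show ?thesis by (simp add: norm_scale_op)
    qed (simp add: norm_scale_op assms)
    show "branch_op a (V (id i)) o\<^sub>L ?T (id i) = ?T (id i)"
      by (rule blinfun_eqI)
        (simp add: bounded_opsD[OF projection_ops[OF partition_projection[OF i]]]
          projection_idem[OF partition_projection[OF i]])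
  qed (use I partition_projection partition_orthogonal assms in auto)
  moreover have "?T i o\<^sub>L branch_op a (V i) = ?T i" if "i \<in> I" for i
    by (rule blinfun_eqI) (simp add: projection_idem[OF partition_projection[OF that]])
  ultimately show ?thesis by simp
qed

text \<open>
  Within a fixed depth, the corners belonging to different parents have orthogonal ranges, so
  that grouping by parents bounds the sum independently of the number of parts.
\<close>

lemma norm_corner_sum_le:
  "norm (\<Sum>i\<in>I. corner a (prefix (lab i) (Suc p)) o\<^sub>L branch_op a (V i)) \<le> 2 * eps a p"
proof -
  let ?f = "\<lambda>i. corner a (prefix (lab i) (Suc p)) o\<^sub>L branch_op a (V i)"
  have *: "norm (\<Sum>i\<in>{i\<in>I. lab i p = b}. ?f i) \<le> eps a p" for b
  proof -
    have "norm (\<Sum>i\<in>{i\<in>I. lab i p = b}. corner a (b # prefix (lab i) p) o\<^sub>L branch_op a (V i)) \<le> eps a p"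
    proof (rule norm_block_sum_le[where Q = "\<lambda>r. node a ((\<not> b) # r)" and g = "\<lambda>i. prefix (lab i) p"
          and T = "\<lambda>r. corner a (b # r)"])
      fix i
      show "norm (corner a (b # prefix (lab i) p)) \<le> eps a p"
        using norm_corner[OF a, of b "prefix (lab i) p"] by simp
      show "node a ((\<not> b) # prefix (lab i) p) o\<^sub>L corner a (b # prefix (lab i) p) = corner a (b # prefix (lab i) p)"
        by (simp add: corner.simps compose_assoc[symmetric] projection_compose_self node_projection a)
    qed (simp_all add: I partition_projection partition_orthogonal node_orthogonal node_projection a
        eps_nonneg)
    moreover have "(\<Sum>i\<in>{i\<in>I. lab i p = b}. ?f i) =
        (\<Sum>i\<in>{i\<in>I. lab i p = b}. corner a (b # prefix (lab i) p) o\<^sub>L branch_op a (V i))"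
      by (rule sum.cong) auto
    ultimately show ?thesis by (simp only:)
  qed
  have "(\<Sum>i\<in>I. ?f i) = (\<Sum>i\<in>{i\<in>I. lab i p = True} \<union> {i\<in>I. lab i p = False}. ?f i)"
    by (rule sum.cong) auto
  also have "\<dots> = (\<Sum>i\<in>{i\<in>I. lab i p = True}. ?f i) + (\<Sum>i\<in>{i\<in>I. lab i p = False}. ?f i)"
    by (rule sum.union_disjoint) (use I in auto)
  finally show ?thesis
    using norm_triangle_le[OF add_mono[OF *[of True] *[of False]]] by simp
qed

lemma norm_strict_tail_sum_le:
  "norm (\<Sum>i\<in>I. (strict_part a (lab i) - (\<Sum>p<m. corner a (prefix (lab i) (Suc p)))) o\<^sub>L branch_op a (V i))
    \<le> 8 * eps a m"
proof -
  let ?c = "\<lambda>i p. corner a (prefix (lab i) (Suc (p + m)))"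
  have sums: "(\<lambda>p. ?c i p) sums (strict_part a (lab i) - (\<Sum>p<m. corner a (prefix (lab i) (Suc p))))" for i
    unfolding strict_part_def
    by (rule sums_split_initial_segment[OF summable_sums[OF summable_corner[OF a]]])
  have "(\<lambda>p. \<Sum>i\<in>I. ?c i p o\<^sub>L branch_op a (V i)) sums
      (\<Sum>i\<in>I. (strict_part a (lab i) - (\<Sum>p<m. corner a (prefix (lab i) (Suc p)))) o\<^sub>L branch_op a (V i))"
    by (intro sums_sum bounded_linear.sums[OF
          bounded_bilinear.bounded_linear_left[OF bounded_bilinear_blinfun_compose]] sums)
  moreover have "norm (\<Sum>i\<in>I. ?c i p o\<^sub>L branch_op a (V i)) \<le> (2 * eps a m) * (3/4) ^ p" for p
    using norm_corner_sum_le[of lab "p + m"] by (simp add: eps_add)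
  ultimately show ?thesis
    using norm_suminf_geometric(2)[of "\<lambda>p. \<Sum>i\<in>I. ?c i p o\<^sub>L branch_op a (V i)" "2 * eps a m"]
      sums_unique by fastforce
qed

text \<open>
  On the node \<open>F\<close> of depth \<open>m\<close> with center \<open>c\<close>, the difference of \<open>branch_fun a \<omega>\<close> and \<open>a\<close> is
  \<open>(\<lambda> - c) - F (a - c) F\<close> plus the tail of the corners. The three contributions are bounded by 4, 1
  and 8 times the error of level \<open>m\<close>.
\<close>
lemma riemann_sum_branch_fun:
  assumes lab: "\<And>i \<omega>. i \<in> I \<Longrightarrow> \<omega> \<in> V i \<Longrightarrow> prefix \<omega> m = prefix (lab i) m"
  shows "norm ((\<Sum>i\<in>I. branch_fun a (lab i) o\<^sub>L branch_op a (V i)) - a) \<le> 13 * eps a m"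
proof -
  let ?P = "\<lambda>i. branch_op a (V i)" and ?s = "\<lambda>i. prefix (lab i) m"
  let ?tail = "\<lambda>i. strict_part a (lab i) - (\<Sum>p<m. corner a (prefix (lab i) (Suc p)))"
  let ?T = "\<lambda>s. - (node a s o\<^sub>L (a - scale_op (center a s) id_blinfun) o\<^sub>L node a s)"
  have FP: "node a (?s i) o\<^sub>L ?P i = ?P i" if "i \<in> I" for i
    unfolding branch_op_cylinder[OF a, symmetric]
    by (rule branch_op_subset[OF a V[OF that] cylinder_sets])
      (use lab[OF that] in \<open>auto simp: cylinder_def\<close>)
  have summand: "(branch_fun a (lab i) o\<^sub>L ?P i) - (a o\<^sub>L ?P i) =
      scale_op (branch_value a (lab i) - center a (?s i)) (?P i) + (?T (?s i) o\<^sub>L ?P i) + (?tail i o\<^sub>L ?P i)"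
    if i: "i \<in> I" for i
  proof (rule blinfun_eqI)
    fix x
    define y where "y = blinfun_apply (?P i) x"
    let ?F = "node a (?s i)"
    have Fy: "blinfun_apply ?F y = y"
      unfolding y_def using FP[OF i] by (metis compose_apply)
    have "blinfun_apply (\<Sum>p<m. corner a (prefix (lab i) (Suc p))) y =
        blinfun_apply (\<Sum>p<m. corner a (prefix (lab i) (Suc p))) (blinfun_apply ?F y)"
      by (simp only: Fy)
    also have "\<dots> = blinfun_apply ((id_blinfun - ?F) o\<^sub>L a o\<^sub>L ?F) y"
      unfolding partial_strict_part[symmetric] by simp
    finally have S: "blinfun_apply (\<Sum>p<m. corner a (prefix (lab i) (Suc p))) y =
        blinfun_apply a y - blinfun_apply ?F (blinfun_apply a y)"
      by (simp add: Fy apply_simps(2))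
    show "blinfun_apply ((branch_fun a (lab i) o\<^sub>L ?P i) - (a o\<^sub>L ?P i)) x = blinfun_apply
      (scale_op (branch_value a (lab i) - center a (?s i)) (?P i) + (?T (?s i) o\<^sub>L ?P i) + (?tail i o\<^sub>L ?P i)) x"
      by (simp only: blinfun.add_left blinfun.diff_left blinfun.minus_left compose_apply scale_op_apply
          branch_fun_def y_def[symmetric] S Fy blinfun.diff_right id_blinfun.rep_eq
          bounded_opsD[OF projection_ops[OF node_projection[OF a]]] scaleC_diff_left)
        simp
  qed
  have "(\<Sum>i\<in>I. branch_fun a (lab i) o\<^sub>L ?P i) - a =
      (\<Sum>i\<in>I. (branch_fun a (lab i) o\<^sub>L ?P i) - (a o\<^sub>L ?P i))"
  proof -
    have "a o\<^sub>L (\<Sum>i\<in>I. ?P i) = a" by (intro blinfun_eqI) (simp add: partition_sum)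
    then show ?thesis by (simp add: sum_subtractf compose_sum_right)
  qed
  also have "\<dots> = (\<Sum>i\<in>I. scale_op (branch_value a (lab i) - center a (?s i)) (?P i)) +
      (\<Sum>i\<in>I. ?T (?s i) o\<^sub>L ?P i) + (\<Sum>i\<in>I. ?tail i o\<^sub>L ?P i)"
    by (simp only: summand sum.distrib cong: sum.cong)
  also have "norm \<dots> \<le> 4 * eps a m + eps a m + 8 * eps a m"
  proof (intro norm_triangle_le add_mono norm_strict_tail_sum_le)
    show "norm (\<Sum>i\<in>I. scale_op (branch_value a (lab i) - center a (?s i)) (?P i)) \<le> 4 * eps a m"
      by (rule norm_scalar_sum_le) (auto simp: eps_nonneg branch_value_near_center)
    show "norm (\<Sum>i\<in>I. ?T (?s i) o\<^sub>L ?P i) \<le> eps a m"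
    proof (rule norm_block_sum_le[where Q = "node a"])
      fix i
      show "norm (?T (?s i)) \<le> eps a m" using node_compression[OF a, of "?s i"] by simp
      show "node a (?s i) o\<^sub>L ?T (?s i) = ?T (?s i)"
        by (rule blinfun_eqI) (simp add: apply_simps projection_idem[OF node_projection[OF a]])
    qed (simp_all add: I partition_projection partition_orthogonal node_orthogonal node_projection a
        eps_nonneg)
  qed
  finally show ?thesis by simp
qed

end

text \<open>
  The branches that run into a zero node form a null set, a countable union of null cylinders.
\<close>
definition full_branches :: "(nat \<Rightarrow> bool) set"
  where "full_branches = {\<omega>. \<forall>n. node a (prefix \<omega> n) \<noteq> 0}"

lemma full_branches:
  shows full_branches_sets: "full_branches \<in> sets branches"
    and branch_op_full: "branch_op a (UNIV - full_branches) = 0"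
proof -
  have eq: "UNIV - full_branches = (\<Union>s\<in>{s. node a s = 0}. cylinder s)"
    by (auto simp: full_branches_def cylinder_def) (metis length_prefix)
  have N: "UNIV - full_branches \<in> sets branches"
    unfolding eq by (intro sets.countable_UN'' cylinder_sets) auto
  have "full_branches = UNIV - (UNIV - full_branches)" by blast
  then show "full_branches \<in> sets branches"
    using N UNIV_sets_branches by (metis sets.Diff)
  show "branch_op a (UNIV - full_branches) = 0"
  proof (rule branch_op_eqI[OF a N self_adjoint_zero])
    fix x
    interpret finite_measure "vector_measure a x" by (rule finite_vector_measure[OF a])
    have "cylinder s \<in> null_sets (vector_measure a x)" if "node a s = 0" for s
      using that by (simp add: null_sets_def sets_vector_measure a cylinder_sets emeasure_vector_measure)
    then have "UNIV - full_branches \<in> null_sets (vector_measure a x)"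
      unfolding eq by (intro null_sets_UN') auto
    then show "blinfun_apply 0 x \<bullet> x = measure (vector_measure a x) (UNIV - full_branches)"
      by (simp add: measure_eq_0_null_sets)
  qed
qed

lemma branch_op_null:
  assumes "U \<in> sets branches" "U \<inter> full_branches = {}"
  shows "branch_op a U = 0"
proof -
  have "branch_op a (UNIV - full_branches) o\<^sub>L branch_op a U = branch_op a U"
    using assms by (intro branch_op_subset[OF a] sets.Diff UNIV_sets_branches full_branches_sets) auto
  then show ?thesis by (simp add: branch_op_full)
qed

text \<open>
  The partition is refined by the cylinders of depth \<open>m\<close>, so that the previous estimate applies with
  labels from the refined parts; the coefficients differ from the values at the labels by at most
  \<open>\<delta>\<close>. Then \<open>m\<close> tends to infinity.
\<close>
lemma riemann_sum_normal:
  assumes normal: "adj a o\<^sub>L a = a o\<^sub>L adj a"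
    and I: "finite I" and V: "\<And>i. i \<in> I \<Longrightarrow> V i \<in> sets branches"
    and disj: "disjoint_family_on V I" and cover: "(\<Union>i\<in>I. V i) = UNIV"
    and \<delta>: "0 \<le> \<delta>"
    and c: "\<And>i \<omega>. i \<in> I \<Longrightarrow> \<omega> \<in> V i \<Longrightarrow> \<omega> \<in> full_branches \<Longrightarrow> cmod (c i - branch_value a \<omega>) \<le> \<delta>"
  shows "norm ((\<Sum>i\<in>I. scale_op (c i) (branch_op a (V i))) - a) \<le> \<delta>"
proof -
  have bound: "norm ((\<Sum>i\<in>I. scale_op (c i) (branch_op a (V i))) - a) \<le> \<delta> + 13 * eps a m" for m
  proof -
    define J where "J = I \<times> {s :: bool list. length s = m}"
    define W where "W = (\<lambda>(i, s). V i \<inter> cylinder s)"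
    \<comment> \<open>The hypothesis on \<open>c\<close> is about full branches only, so labels are chosen among them if possible.\<close>
    have "\<exists>\<omega>. W j \<noteq> {} \<longrightarrow> \<omega> \<in> W j \<and> (W j \<inter> full_branches \<noteq> {} \<longrightarrow> \<omega> \<in> full_branches)" for j
      by blast
    then obtain lab where lab: "\<And>j. W j \<noteq> {} \<Longrightarrow>
        lab j \<in> W j \<and> (W j \<inter> full_branches \<noteq> {} \<longrightarrow> lab j \<in> full_branches)"
      by metis
    have finS: "finite {s :: bool list. length s = m}"
      using finite_lists_length_eq[of "UNIV :: bool set" m] by simp
    have J: "finite J" unfolding J_def using I finS by simp
    have W: "W j \<in> sets branches" if "j \<in> J" for j
      using that V cylinder_sets by (auto simp: J_def W_def)
    have Wdisj: "disjoint_family_on W J"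
      using disj by (auto simp: disjoint_family_on_def J_def W_def cylinder_def)
    have Wcover: "(\<Union>j\<in>J. W j) = UNIV"
    proof -
      have "\<omega> \<in> (\<Union>j\<in>J. W j)" for \<omega>
      proof -
        obtain i where "i \<in> I" "\<omega> \<in> V i" using cover by blast
        then have "(i, prefix \<omega> m) \<in> J" "\<omega> \<in> W (i, prefix \<omega> m)"
          by (auto simp: J_def W_def mem_cylinder_prefix)
        then show ?thesis by blast
      qed
      then show ?thesis by blast
    qed

    have 1: "norm ((\<Sum>j\<in>J. branch_fun a (lab j) o\<^sub>L branch_op a (W j)) - a) \<le> 13 * eps a m"
    proof (rule riemann_sum_branch_fun[OF J W Wdisj Wcover])
      fix j \<omega> assume "j \<in> J" "\<omega> \<in> W j"
      moreover from this have "lab j \<in> W j" using lab[of j] by blast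
      ultimately show "prefix \<omega> m = prefix (lab j) m"
        by (auto simp: J_def W_def cylinder_def)
    qed
    have 2: "(\<Sum>i\<in>I. scale_op (c i) (branch_op a (V i))) = (\<Sum>j\<in>J. scale_op (c (fst j)) (branch_op a (W j)))"
    proof -
      have "scale_op (c i) (branch_op a (V i)) = (\<Sum>s | length s = m. scale_op (c i) (branch_op a (W (i, s))))"
        if i: "i \<in> I" for i
      proof -
        have "V i = (\<Union>s\<in>{s. length s = m}. W (i, s))"
          by (auto simp: W_def cylinder_def)
        then have "branch_op a (V i) = (\<Sum>s | length s = m. branch_op a (W (i, s)))"
          using W i by (subst branch_op_finite_UN[OF a, symmetric])
            (auto simp: finS J_def disjoint_family_on_def W_def cylinder_def)
        then show ?thesis by (intro blinfun_eqI) (simp add: apply_simps scaleC_sum_right)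
      qed
      then show ?thesis
        unfolding J_def by (simp add: sum.cartesian_product split_beta)
    qed
    have 3: "norm (\<Sum>j\<in>J. scale_op (c (fst j) - branch_value a (lab j)) (branch_op a (W j))) \<le> \<delta>"
    proof (rule norm_scalar_sum_le[OF J W Wdisj Wcover \<delta>])
      fix j assume j: "j \<in> J" and ne: "branch_op a (W j) \<noteq> 0"
      have "W j \<inter> full_branches \<noteq> {}" using branch_op_null[OF W[OF j]] ne by blast
      then have "lab j \<in> W j" "lab j \<in> full_branches" using lab[of j] by auto
      then show "cmod (c (fst j) - branch_value a (lab j)) \<le> \<delta>"
        using c[of "fst j" "lab j"] j by (auto simp: J_def W_def)
    qed
    have eq: "(\<Sum>i\<in>I. scale_op (c i) (branch_op a (V i))) - a =
        (\<Sum>j\<in>J. scale_op (c (fst j) - branch_value a (lab j)) (branch_op a (W j))) +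
        ((\<Sum>j\<in>J. branch_fun a (lab j) o\<^sub>L branch_op a (W j)) - a)"
    proof -
      have "scale_op (c (fst j)) (branch_op a (W j)) =
          scale_op (c (fst j) - branch_value a (lab j)) (branch_op a (W j)) +
          (branch_fun a (lab j) o\<^sub>L branch_op a (W j))" for j
        by (intro blinfun_eqI)
          (simp add: branch_fun_def strict_part_normal[OF a normal] apply_simps scaleC_diff_left)
      then show ?thesis unfolding 2 by (simp add: sum.distrib)
    qed
    show ?thesis unfolding eq by (rule norm_triangle_le[OF add_mono[OF 3 1]])
  qed
  have "(\<lambda>m. \<delta> + 13 * eps a m) \<longlonglongrightarrow> \<delta> + 13 * 0"
    by (intro tendsto_intros eps_tendsto_0)
  then show ?thesis
    using bound by (intro LIMSEQ_le_const) auto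
qed

end

section \<open>Image measures and their integrals\<close>

lemma borel_sets_preimage:
  assumes "\<And>y. y \<in> S \<Longrightarrow> f y \<in> topspace X" and "sigma_algebra S M"
    and "\<And>U. openin X U \<Longrightarrow> {y\<in>S. f y \<in> U} \<in> M"
    and "U \<in> borel_sets X"
  shows "{y\<in>S. f y \<in> U} \<in> M"
proof -
  interpret sigma_algebra S M by fact
  show ?thesis
    using assms(4) unfolding borel_sets_def
  proof (induction rule: sigma_sets.induct)
    case (Compl A)
    have "{y\<in>S. f y \<in> topspace X - A} = S - {y\<in>S. f y \<in> A}" using assms(1) by auto
    then show ?case using Compl by auto
  next
    case (Union A)
    have "{y\<in>S. f y \<in> (\<Union>i. A i)} = (\<Union>i. {y\<in>S. f y \<in> A i})" by auto
    then show ?case using Union by auto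
  qed (use assms(3) in auto)
qed

lemma sigma_algebra_borel_sets: "sigma_algebra (topspace X) (borel_sets X)"
  unfolding borel_sets_def by (intro sigma_algebra_sigma_sets) (auto dest: openin_subset)

lemma borel_sets_euclidean: "borel_sets (euclidean :: 'a::topological_space topology) = sets borel"
  by (simp add: borel_sets_def borel_def)

lemma sigma_algebra_branches: "sigma_algebra UNIV (sets branches)"
  using sets.sigma_algebra_axioms[of branches] by simp

lemma borel_partition_levels:
  assumes fin: "finite (d ` topspace X)"
    and lev: "\<And>v. {y\<in>topspace X. d y = v} \<in> borel_sets X"
  obtains \<U> where "borel_partition X \<U>"
    "\<And>\<V> U u v. refines (topspace X) \<V> \<U> \<Longrightarrow> U \<in> \<V> \<Longrightarrow> u \<in> U \<Longrightarrow> v \<in> U \<Longrightarrow> d u = d v"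
proof -
  let ?\<U> = "(\<lambda>v. {y\<in>topspace X. d y = v}) ` d ` topspace X"
  have "partition_on (topspace X) ?\<U>"
    by (rule partition_onI) (auto simp: disjnt_def)
  then have "borel_partition X ?\<U>"
    unfolding borel_partition_def using fin lev by auto
  moreover have "d u = d v"
    if "refines (topspace X) \<V> ?\<U>" "U \<in> \<V>" "u \<in> U" "v \<in> U" for \<V> U u v
  proof -
    note U = that
    obtain A where "A \<in> ?\<U>" "U \<subseteq> A" using U(1,2) unfolding refines_def by blast
    then obtain w where "A = {y\<in>topspace X. d y = w}" by blast
    moreover have "u \<in> A" "v \<in> A" using U(3,4) \<open>U \<subseteq> A\<close> by blast+
    ultimately show ?thesis by simp
  qed
  ultimately show ?thesis by (rule that)
qed

context
  fixes a :: "'h::complex_hilbert \<Rightarrow>\<^sub>L 'h" and X :: "'y topology" and \<Gamma> :: "(nat \<Rightarrow> bool) \<Rightarrow> 'y"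
  assumes a: "a \<in> bounded_ops" and \<Gamma>: "\<And>\<omega>. \<Gamma> \<omega> \<in> topspace X"
    and \<Gamma>_meas: "\<And>U. openin X U \<Longrightarrow> \<Gamma> -` U \<in> sets branches"
begin

lemma image_preimage_sets: "U \<in> borel_sets X \<Longrightarrow> \<Gamma> -` U \<in> sets branches"
  using borel_sets_preimage[of UNIV \<Gamma> X "sets branches" U] \<Gamma> \<Gamma>_meas sigma_algebra_branches
  by (simp add: vimage_def)

lemma spectral_measure_image: "spectral_measure X (\<lambda>U. branch_op a (\<Gamma> -` U))"
  unfolding spectral_measure_def
proof (intro conjI ballI allI impI)
  show "is_projection (branch_op a (\<Gamma> -` U))" if "U \<in> borel_sets X" for U
    by (intro branch_op_projection a image_preimage_sets that)
  have "\<Gamma> -` topspace X = UNIV" using \<Gamma> by auto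
  then show "branch_op a (\<Gamma> -` topspace X) = id_blinfun" by (simp add: branch_op_UNIV a)
  show "branch_op a (\<Gamma> -` (U \<inter> V)) = branch_op a (\<Gamma> -` U) o\<^sub>L branch_op a (\<Gamma> -` V)"
    if "U \<in> borel_sets X" "V \<in> borel_sets X" for U V
    using that by (simp add: vimage_Int branch_op_Int a image_preimage_sets)
  fix F :: "nat \<Rightarrow> 'y set" and x
  assume F: "range F \<subseteq> borel_sets X \<and> disjoint_family F"
  then have "range (\<lambda>n. \<Gamma> -` F n) \<subseteq> sets branches" using image_preimage_sets by auto
  moreover have "disjoint_family (\<lambda>n. \<Gamma> -` F n)" using F by (auto simp: disjoint_family_on_def)
  ultimately show "(\<lambda>n. blinfun_apply (branch_op a (\<Gamma> -` F n)) x) sums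
      blinfun_apply (branch_op a (\<Gamma> -` (\<Union>n. F n))) x"
    using branch_op_sums[OF a, of "\<lambda>n. \<Gamma> -` F n" x] by (simp add: vimage_UN)
qed

lemma partition_preimage:
  assumes "borel_partition X \<U>"
  shows "finite \<U>" "\<And>U. U \<in> \<U> \<Longrightarrow> \<Gamma> -` U \<in> sets branches"
    "disjoint_family_on ((-`) \<Gamma>) \<U>" "(\<Union>U\<in>\<U>. \<Gamma> -` U) = UNIV"
proof -
  have \<U>: "finite \<U>" "\<U> \<subseteq> borel_sets X" "partition_on (topspace X) \<U>"
    using assms by (auto simp: borel_partition_def)
  show "finite \<U>" "\<And>U. U \<in> \<U> \<Longrightarrow> \<Gamma> -` U \<in> sets branches"
    using \<U> image_preimage_sets by auto
  show "disjoint_family_on ((-`) \<Gamma>) \<U>"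
    using partition_onD2[OF \<U>(3)] by (auto simp: disjoint_family_on_def disjoint_def)
  show "(\<Union>U\<in>\<U>. \<Gamma> -` U) = UNIV"
    using partition_onD1[OF \<U>(3)] \<Gamma> by auto
qed

text \<open>
  The finite partition to start from separates the points of \<open>X\<close> by the first \<open>m\<close> digits of the
  branches that they encode.
\<close>
lemma integral_branch_fun:
  assumes dec: "\<And>\<omega>. dec (\<Gamma> \<omega>) = \<omega>"
    and lev: "\<And>m s. {y\<in>topspace X. prefix (dec y) m = s} \<in> borel_sets X"
  shows "has_spectral_integral X (\<lambda>U. branch_op a (\<Gamma> -` U)) (\<lambda>y. branch_fun a (dec y)) a"
  unfolding has_spectral_integral_def
proof (intro allI impI)
  fix e :: real assume e: "e > 0"
  have "(\<lambda>m. 13 * eps a m) \<longlonglongrightarrow> 0"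
    using tendsto_mult[OF tendsto_const eps_tendsto_0, of 13] by simp
  then have "\<forall>\<^sub>F m in sequentially. 13 * eps a m < e" using e by (rule order_tendstoD(2))
  then obtain m where m: "13 * eps a m < e"    unfolding eventually_sequentially by blast
  have "(\<lambda>y. prefix (dec y) m) ` topspace X \<subseteq> {s. set s \<subseteq> UNIV \<and> length s = m}" by auto
  then have "finite ((\<lambda>y. prefix (dec y) m) ` topspace X)"
    by (rule finite_subset) (rule finite_lists_length_eq, simp)
  then obtain \<U>\<^sub>0 where \<U>\<^sub>0: "borel_partition X \<U>\<^sub>0"
    "\<And>\<V> U u v. refines (topspace X) \<V> \<U>\<^sub>0 \<Longrightarrow> U \<in> \<V> \<Longrightarrow> u \<in> U \<Longrightarrow> v \<in> U \<Longrightarrow>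
      prefix (dec u) m = prefix (dec v) m"
    using borel_partition_levels[of "\<lambda>y. prefix (dec y) m" X, OF _ lev] by blast
  show "\<exists>\<U>\<^sub>0. borel_partition X \<U>\<^sub>0 \<and>
      (\<forall>\<U> y. borel_partition X \<U> \<and> refines (topspace X) \<U> \<U>\<^sub>0 \<and> (\<forall>U\<in>\<U>. y U \<in> U) \<longrightarrow>
        norm ((\<Sum>U\<in>\<U>. branch_fun a (dec (y U)) o\<^sub>L branch_op a (\<Gamma> -` U)) - a) < e)"
  proof (intro exI conjI allI impI)
    fix \<U> y
    assume \<U>: "borel_partition X \<U> \<and> refines (topspace X) \<U> \<U>\<^sub>0 \<and> (\<forall>U\<in>\<U>. y U \<in> U)"
    have "norm ((\<Sum>U\<in>\<U>. branch_fun a (dec (y U)) o\<^sub>L branch_op a (\<Gamma> -` U)) - a) \<le> 13 * eps a m"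
    proof (rule riemann_sum_branch_fun[OF a, where lab = "\<lambda>U. dec (y U)"])
      fix U \<omega> assume "U \<in> \<U>" "\<omega> \<in> \<Gamma> -` U"
      then show "prefix \<omega> m = prefix (dec (y U)) m"
        using \<U>\<^sub>0(2)[of \<U> U "\<Gamma> \<omega>" "y U"] \<U> by (simp add: dec)
    qed (use partition_preimage \<U> in auto)
    then show "norm ((\<Sum>U\<in>\<U>. branch_fun a (dec (y U)) o\<^sub>L branch_op a (\<Gamma> -` U)) - a) < e"
      using m by simp
  qed (rule \<U>\<^sub>0(1))
qed

lemma cmod_branch_value_le: "cmod (branch_value a \<omega>) \<le> 16 * norm a"
  using branch_value_near_center[of a \<omega> 0] by (simp add: eps_def)

text \<open>
  The finite partition to start from divides a large disc into small squares; all values of the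
  integrand outside of it are irrelevant, because \<open>\<zeta>\<close> maps the support of the measure into the disc.
\<close>
lemma integral_normal:
  assumes normal: "adj a o\<^sub>L a = a o\<^sub>L adj a"
    and \<zeta>: "\<And>\<omega>. \<omega> \<in> full_branches a \<Longrightarrow> \<zeta> (\<Gamma> \<omega>) = branch_value a \<omega>"
    and \<zeta>_meas: "\<And>B. B \<in> sets borel \<Longrightarrow> {y\<in>topspace X. \<zeta> y \<in> B} \<in> borel_sets X"
  shows "has_spectral_integral X (\<lambda>U. branch_op a (\<Gamma> -` U)) (\<lambda>y. scale_op (\<zeta> y) id_blinfun) a"
  unfolding has_spectral_integral_def
proof (intro allI impI)
  fix e :: real assume e: "e > 0"
  define \<delta> where "\<delta> = e / 4"
  have \<delta>: "\<delta> > 0" using e by (simp add: \<delta>_def)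
  define R where "R = 16 * norm a"
  define idx where "idx c = (if cmod c \<le> R then Some (\<lfloor>Re c / \<delta>\<rfloor>, \<lfloor>Im c / \<delta>\<rfloor>) else None)" for c
  have idx_dist: "cmod (c - c') \<le> 2 * \<delta>" if "idx c = idx c'" "cmod c \<le> R" for c c'
  proof -
    have f: "\<lfloor>Re c / \<delta>\<rfloor> = \<lfloor>Re c' / \<delta>\<rfloor>" "\<lfloor>Im c / \<delta>\<rfloor> = \<lfloor>Im c' / \<delta>\<rfloor>"
      using that by (auto simp: idx_def split: if_splits)
    have "\<bar>r - r'\<bar> \<le> \<delta>" if "\<lfloor>r / \<delta>\<rfloor> = \<lfloor>r' / \<delta>\<rfloor>" for r r' :: real
    proof -
      have "\<bar>r / \<delta> - r' / \<delta>\<bar> \<le> 1"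
        using that floor_correct[of "r / \<delta>"] floor_correct[of "r' / \<delta>"] by linarith
      then have "\<bar>(r - r') / \<delta>\<bar> \<le> 1" by (simp add: diff_divide_distrib)
      then show ?thesis using \<delta> by (simp add: abs_divide)
    qed
    from this[OF f(1)] this[OF f(2)] show ?thesis
      using cmod_le[of "c - c'"] by simp
  qed
  have fin: "finite (range idx)"
  proof -
    define N where "N = \<lceil>R / \<delta>\<rceil> + 1"
    have N: "\<lfloor>r / \<delta>\<rfloor> \<in> {- N..N}" if "\<bar>r\<bar> \<le> R" for r
    proof -
      have "\<bar>r / \<delta>\<bar> \<le> R / \<delta>" using that \<delta> by (simp add: abs_divide divide_right_mono)
      then show ?thesis
        unfolding N_def using le_of_int_ceiling[of "R / \<delta>"] by (auto; linarith)
    qed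
    have "idx c \<in> insert None (Some ` ({- N..N} \<times> {- N..N}))" for c
    proof (cases "cmod c \<le> R")
      case True
      then have "\<bar>Re c\<bar> \<le> R" "\<bar>Im c\<bar> \<le> R"
        using abs_Re_le_cmod[of c] abs_Im_le_cmod[of c] by linarith+
      then show ?thesis using N[of "Re c"] N[of "Im c"] True by (simp add: idx_def)
    qed (simp add: idx_def)
    then have "range idx \<subseteq> insert None (Some ` ({- N..N} \<times> {- N..N}))" by (rule image_subsetI)
    then show ?thesis by (rule finite_subset) auto
  qed
  have borel_idx: "{c. idx c = v} \<in> sets borel" for v
  proof (cases v)
    case None
    have "{c. idx c = v} = {c. R < cmod c}" by (auto simp: idx_def None)
    moreover have "open {c. R < cmod c}" by (intro open_Collect_less continuous_intros)
    ultimately show ?thesis by simp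
  next
    case (Some w)
    obtain i j where w: "w = (i, j)" by (cases w)
    have "{c. idx c = v} = {c. cmod c \<le> R} \<inter>
        ({c. real_of_int i \<le> Re c / \<delta>} \<inter> {c. Re c / \<delta> < real_of_int i + 1}) \<inter>
        ({c. real_of_int j \<le> Im c / \<delta>} \<inter> {c. Im c / \<delta> < real_of_int j + 1})"
      by (auto simp: idx_def Some w floor_eq_iff)
    moreover have "closed {c. cmod c \<le> R}" "closed {c. real_of_int i \<le> Re c / \<delta>}"
        "closed {c. real_of_int j \<le> Im c / \<delta>}" "open {c. Re c / \<delta> < real_of_int i + 1}"
        "open {c. Im c / \<delta> < real_of_int j + 1}"
      using \<delta> by (auto intro!: closed_Collect_le open_Collect_less continuous_intros)
    ultimately show ?thesis by (auto intro!: sets.Int)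
  qed
  have "finite ((idx \<circ> \<zeta>) ` topspace X)"
    by (rule finite_subset[OF _ fin]) auto
  moreover have "{y\<in>topspace X. (idx \<circ> \<zeta>) y = v} \<in> borel_sets X" for v
    using \<zeta>_meas[OF borel_idx[of v]] by simp
  ultimately obtain \<U>\<^sub>0 where \<U>\<^sub>0: "borel_partition X \<U>\<^sub>0"
    "\<And>\<V> U u v. refines (topspace X) \<V> \<U>\<^sub>0 \<Longrightarrow> U \<in> \<V> \<Longrightarrow> u \<in> U \<Longrightarrow> v \<in> U \<Longrightarrow>
      (idx \<circ> \<zeta>) u = (idx \<circ> \<zeta>) v"
    using borel_partition_levels[of "idx \<circ> \<zeta>" X] by blast
  show "\<exists>\<U>\<^sub>0. borel_partition X \<U>\<^sub>0 \<and>
      (\<forall>\<U> y. borel_partition X \<U> \<and> refines (topspace X) \<U> \<U>\<^sub>0 \<and> (\<forall>U\<in>\<U>. y U \<in> U) \<longrightarrow>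
        norm ((\<Sum>U\<in>\<U>. scale_op (\<zeta> (y U)) id_blinfun o\<^sub>L branch_op a (\<Gamma> -` U)) - a) < e)"
  proof (intro exI conjI allI impI)
    fix \<U> y
    assume \<U>: "borel_partition X \<U> \<and> refines (topspace X) \<U> \<U>\<^sub>0 \<and> (\<forall>U\<in>\<U>. y U \<in> U)"
    have "norm ((\<Sum>U\<in>\<U>. scale_op (\<zeta> (y U)) (branch_op a (\<Gamma> -` U))) - a) \<le> 2 * \<delta>"
    proof (rule riemann_sum_normal[OF a normal, where c = "\<lambda>U. \<zeta> (y U)"])
      fix U \<omega> assume U: "U \<in> \<U>" "\<omega> \<in> \<Gamma> -` U" "\<omega> \<in> full_branches a"
      have "idx (\<zeta> (\<Gamma> \<omega>)) = idx (\<zeta> (y U))"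
        using \<U>\<^sub>0(2)[of \<U> U "\<Gamma> \<omega>" "y U"] \<U> U by simp
      then have "cmod (\<zeta> (\<Gamma> \<omega>) - \<zeta> (y U)) \<le> 2 * \<delta>"
        by (rule idx_dist) (simp add: \<zeta>[OF U(3)] cmod_branch_value_le R_def)
      then show "cmod (\<zeta> (y U) - branch_value a \<omega>) \<le> 2 * \<delta>"
        by (simp add: \<zeta>[OF U(3)] norm_minus_commute)
    qed (use partition_preimage \<U> \<delta> in auto)
    moreover have "scale_op (\<zeta> (y U)) id_blinfun o\<^sub>L branch_op a (\<Gamma> -` U) =
        scale_op (\<zeta> (y U)) (branch_op a (\<Gamma> -` U))" for U
      by (rule blinfun_eqI) simp
    ultimately show "norm ((\<Sum>U\<in>\<U>. scale_op (\<zeta> (y U)) id_blinfun o\<^sub>L branch_op a (\<Gamma> -` U)) - a) < e"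
      using e by (simp add: \<delta>_def)
  qed (rule \<U>\<^sub>0(1))
qed

end

section \<open>States and pure states\<close>

lemma cstar_subalgebra_bounded_ops: "cstar_subalgebra bounded_ops"
  unfolding cstar_subalgebra_def
  by (auto simp: closed_bounded_ops bounded_ops_intros adj_bounded_ops)

lemma gen_cstar:
  assumes a: "a \<in> bounded_ops"
  shows cstar_subalgebra_gen_cstar: "cstar_subalgebra (gen_cstar a)"
    and id_in_gen_cstar: "id_blinfun \<in> gen_cstar a" and gen_in_gen_cstar: "a \<in> gen_cstar a"
proof -
  let ?C = "{t. cstar_subalgebra t \<and> {id_blinfun, a} \<subseteq> t}"
  have eq: "gen_cstar a = \<Inter>?C" by (simp add: gen_cstar_def hull_def)
  show "id_blinfun \<in> gen_cstar a" "a \<in> gen_cstar a" unfolding eq by auto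
  have B: "bounded_ops \<in> ?C" using a by (simp add: cstar_subalgebra_bounded_ops bounded_ops_id)
  have "closed (\<Inter>?C)" by (intro closed_Inter) (auto simp: cstar_subalgebra_def)
  moreover have "\<Inter>?C \<subseteq> bounded_ops" using B by blast
  ultimately show "cstar_subalgebra (gen_cstar a)"
    unfolding eq by (auto simp: cstar_subalgebra_def)
qed

lemma gen_cstar_subset:
  "cstar_subalgebra S \<Longrightarrow> id_blinfun \<in> S \<Longrightarrow> a \<in> S \<Longrightarrow> gen_cstar a \<subseteq> S"
  unfolding gen_cstar_def by (intro hull_minimal) auto

context
  fixes A :: "('h::complex_hilbert \<Rightarrow>\<^sub>L 'h) set"
  assumes A: "cstar_subalgebra A" and one: "id_blinfun \<in> A"
begin

lemma alg_ops: "x \<in> A \<Longrightarrow> x \<in> bounded_ops"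
  and alg_closed: "closed A"
  and alg_zero: "0 \<in> A"
  and alg_add: "x \<in> A \<Longrightarrow> y \<in> A \<Longrightarrow> x + y \<in> A"
  and alg_compose: "x \<in> A \<Longrightarrow> y \<in> A \<Longrightarrow> x o\<^sub>L y \<in> A"
  and alg_scale: "x \<in> A \<Longrightarrow> scale_op c x \<in> A"
  and alg_adj: "x \<in> A \<Longrightarrow> adj x \<in> A"
  using A unfolding cstar_subalgebra_def by blast+

lemma alg_scaleR: "x \<in> A \<Longrightarrow> r *\<^sub>R x \<in> A"
proof -
  assume "x \<in> A"
  moreover have "r *\<^sub>R x = scale_op (complex_of_real r) x"
    by (intro blinfun_eqI) (simp add: apply_simps scaleC_of_real)
  ultimately show ?thesis by (simp add: alg_scale)
qed

lemma alg_diff: "x \<in> A \<Longrightarrow> y \<in> A \<Longrightarrow> x - y \<in> A"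
  using alg_add[of x "(-1) *\<^sub>R y"] alg_scaleR[of y "-1"] by simp

lemma alg_re_op: "x \<in> A \<Longrightarrow> re_op x \<in> A" and alg_im_op: "x \<in> A \<Longrightarrow> im_op x \<in> A"
  by (simp_all add: re_op_def im_op_def alg_scaleR alg_scale alg_add alg_diff alg_adj)

lemmas alg_intros = one alg_zero alg_add alg_compose alg_scale alg_adj alg_scaleR alg_diff
  alg_re_op alg_im_op

context
  fixes \<phi> assumes \<phi>: "\<phi> \<in> states A"
begin

lemma state_add: "x \<in> A \<Longrightarrow> y \<in> A \<Longrightarrow> \<phi> (x + y) = \<phi> x + \<phi> y"
  and state_scale: "x \<in> A \<Longrightarrow> \<phi> (scale_op c x) = c * \<phi> x"
  and state_pos: "x \<in> A \<Longrightarrow> \<phi> (adj x o\<^sub>L x) \<in> \<real>\<^sub>\<ge>\<^sub>0"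
  and state_one: "\<phi> id_blinfun = 1"
  using \<phi> unfolding states_def dual_space_def by blast+

lemma state_scaleR: "x \<in> A \<Longrightarrow> \<phi> (r *\<^sub>R x) = complex_of_real r * \<phi> x"
proof -
  assume "x \<in> A"
  moreover have "r *\<^sub>R x = scale_op (complex_of_real r) x"
    by (intro blinfun_eqI) (simp add: apply_simps scaleC_of_real)
  ultimately show ?thesis by (simp add: state_scale)
qed

lemma state_diff: "x \<in> A \<Longrightarrow> y \<in> A \<Longrightarrow> \<phi> (x - y) = \<phi> x - \<phi> y"
  using state_add[of x "(-1) *\<^sub>R y"] alg_scaleR[of y "-1"] state_scaleR[of y "-1"] by simp

text \<open>
  Positivity bounds a state, because \<open>1 - h\<close> is the square of an element of the algebra for every
  self-adjoint contraction \<open>h\<close>.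
\<close>

lemma state_one_minus:
  assumes h: "h \<in> A" "self_adjoint h" "norm h \<le> 1"
  shows "1 - \<phi> h \<in> \<real>\<^sub>\<ge>\<^sub>0"
proof -
  obtain y where y: "y = (1/2) *\<^sub>R (h + (y o\<^sub>L y))" "norm y \<le> 1" and
    inv: "\<And>S. closed S \<Longrightarrow> 0 \<in> S \<Longrightarrow> (\<And>z. z \<in> S \<Longrightarrow> (1/2) *\<^sub>R (h + (z o\<^sub>L z)) \<in> S) \<Longrightarrow> y \<in> S"
    using sqrt_iter_limit[OF h(3)] by blast
  have yA: "y \<in> A" using h by (intro inv alg_closed) (auto intro: alg_intros)
  have "y \<in> {T. self_adjoint T}"
    using h(2)
    by (intro inv closed_self_adjoint)
      (auto simp: self_adjoint_zero self_adjoint_scaleR self_adjoint_add self_adjoint_square)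
  then have ys: "self_adjoint (id_blinfun - y)"
    by (simp add: self_adjoint_diff self_adjoint_id)
  have y2: "2 *\<^sub>R y = h + (y o\<^sub>L y)"
    using arg_cong[OF y(1), of "\<lambda>z. 2 *\<^sub>R z"] by simp
  have "blinfun_apply y x + blinfun_apply y x = blinfun_apply h x + blinfun_apply y (blinfun_apply y x)" for x
    using arg_cong[OF y2, of "\<lambda>f. blinfun_apply f x"] by (simp add: apply_simps scaleR_2)
  then have "(id_blinfun - y) o\<^sub>L (id_blinfun - y) = id_blinfun - h"
    by (intro blinfun_eqI) (simp add: apply_simps algebra_simps)
  then have "adj (id_blinfun - y) o\<^sub>L (id_blinfun - y) = id_blinfun - h"
    using ys by (simp add: self_adjoint_def)
  then have "\<phi> (id_blinfun - h) \<in> \<real>\<^sub>\<ge>\<^sub>0"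
    using state_pos[of "id_blinfun - y"] yA by (simp add: alg_intros)
  then show ?thesis using h(1) by (simp add: state_diff one state_one)
qed

lemma state_self_adjoint:
  assumes h: "h \<in> A" "self_adjoint h"
  shows "\<phi> h \<in> \<real>" "cmod (\<phi> h) \<le> norm h"
proof -
  have *: "\<phi> k \<in> \<real> \<and> cmod (\<phi> k) \<le> 1" if k: "k \<in> A" "self_adjoint k" "norm k \<le> 1" for k
  proof -
    have "1 - \<phi> k \<in> \<real>\<^sub>\<ge>\<^sub>0" by (rule state_one_minus[OF k])
    moreover have "1 - \<phi> ((-1) *\<^sub>R k) \<in> \<real>\<^sub>\<ge>\<^sub>0"
      using k by (intro state_one_minus alg_scaleR self_adjoint_scaleR) auto
    ultimately have "Im (\<phi> k) = 0" "Re (\<phi> k) \<le> 1" "- 1 \<le> Re (\<phi> k)"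
      using k(1) state_scaleR[of k "-1"] by (auto simp: complex_nonneg_Reals_iff)
    then show ?thesis by (auto simp: complex_is_Real_iff cmod_eq_Re)
  qed
  show "\<phi> h \<in> \<real>" "cmod (\<phi> h) \<le> norm h"
  proof (atomize (full), cases "h = 0")
    case True
    then show "\<phi> h \<in> \<real> \<and> cmod (\<phi> h) \<le> norm h" using state_scaleR[of h 0] h by simp
  next
    case False
    let ?k = "inverse (norm h) *\<^sub>R h"
    have "\<phi> ?k \<in> \<real> \<and> cmod (\<phi> ?k) \<le> 1"
      using h False by (intro * alg_scaleR self_adjoint_scaleR) auto
    moreover have "\<phi> h = complex_of_real (norm h) * \<phi> ?k"
      using state_scaleR[OF h(1), of "inverse (norm h)"] False by simp
    ultimately show "\<phi> h \<in> \<real> \<and> cmod (\<phi> h) \<le> norm h"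
      by (auto simp: norm_mult mult_left_le)
  qed
qed

lemma state_norm_le:
  assumes x: "x \<in> A"
  shows "cmod (\<phi> x) \<le> 2 * norm x"
proof -
  have "\<phi> x = \<phi> (re_op x) + \<i> * \<phi> (im_op x)"
    using x by (subst op_decomposition) (simp add: state_add state_scale alg_intros)
  also have "cmod \<dots> \<le> norm (re_op x) + norm (im_op x)"
    using x state_self_adjoint(2)[of "re_op x"] state_self_adjoint(2)[of "im_op x"]
    by (intro norm_triangle_le add_mono)
      (auto simp: alg_intros self_adjoint_re_op self_adjoint_im_op alg_ops norm_mult)
  also have "\<dots> \<le> norm x + norm x"
    using x by (intro add_mono norm_re_op norm_im_op alg_ops)
  finally show ?thesis by simp
qed

text \<open>
  The Cauchy-Schwarz inequality in its degenerate case: \<open>\<phi> ((y + z)\<^sup>* (y + z)) \<ge> 0\<close> for all scalars \<open>z\<close>.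
\<close>
lemma state_null:
  assumes y: "y \<in> A" and 0: "\<phi> (adj y o\<^sub>L y) = 0"
  shows "\<phi> y = 0"
proof -
  have pos: "z * \<phi> (adj y) + cnj z * \<phi> y + complex_of_real ((cmod z)\<^sup>2) \<in> \<real>\<^sub>\<ge>\<^sub>0" for z
  proof -
    let ?u = "y + scale_op z id_blinfun"
    have "adj ?u = adj y + scale_op (cnj z) id_blinfun"
      using y by (simp add: adj_add alg_ops bounded_ops_intros adj_scale adj_id)
    then have "adj ?u o\<^sub>L ?u = (adj y o\<^sub>L y) + scale_op z (adj y) + scale_op (cnj z) y
        + scale_op (complex_of_real ((cmod z)\<^sup>2)) id_blinfun"
      using bounded_opsD[OF alg_ops[OF alg_adj[OF y]]]
      by (intro blinfun_eqI)
        (simp add: apply_simps scaleC_add_right scaleC_scaleC mult.commute flip: complex_norm_square)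
    then have "\<phi> (adj ?u o\<^sub>L ?u) = z * \<phi> (adj y) + cnj z * \<phi> y + complex_of_real ((cmod z)\<^sup>2)"
      using y by (simp add: state_add state_scale alg_intros 0 state_one)
    then show ?thesis using state_pos[of ?u] y by (simp add: alg_intros)
  qed
  define p where "p = \<phi> (adj y) + \<phi> y"
  define q where "q = \<i> * \<phi> (adj y) - \<i> * \<phi> y"
  \<comment> \<open>Real and imaginary \<open>z\<close> near 0 exclude a nonzero linear term.\<close>
  have lin: "c = 0" if c: "\<And>t::real. complex_of_real t * c + complex_of_real (t\<^sup>2) \<in> \<real>\<^sub>\<ge>\<^sub>0" for c
  proof -
    have im: "Im c = 0" using c[of 1] by (simp add: complex_nonneg_Reals_iff)
    have re: "0 \<le> t * Re c + t\<^sup>2" for t using c[of t] by (simp add: complex_nonneg_Reals_iff)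
    have "0 \<le> - (Re c)\<^sup>2 / 4" using re[of "- Re c / 2"] by (simp add: power2_eq_square)
    then have "Re c = 0" by simp
    with im show ?thesis by (simp add: complex_eq_iff)
  qed
  have "p = 0"
    by (rule lin) (use pos[of "complex_of_real t" for t] in \<open>simp add: p_def algebra_simps\<close>)
  moreover have "q = 0"
  proof (rule lin)
    fix t :: real
    show "complex_of_real t * q + complex_of_real (t\<^sup>2) \<in> \<real>\<^sub>\<ge>\<^sub>0"
      using pos[of "\<i> * complex_of_real t"] by (simp add: q_def algebra_simps norm_mult)
  qed
  then have "\<phi> (adj y) = \<phi> y" by (simp add: q_def)
  ultimately show ?thesis by (simp add: p_def)
qed

end

lemma vector_state:
  assumes v: "norm v = 1"
  shows "restrict (\<lambda>x. cinner (blinfun_apply x v) v) A \<in> states A"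
proof -
  have le: "cmod (cinner (blinfun_apply x v) v) \<le> 2 * norm x" for x :: "'h \<Rightarrow>\<^sub>L 'h"
  proof -
    have "norm (blinfun_apply x v) \<le> norm x" using norm_blinfun[of x v] v by simp
    then show ?thesis using norm_cinner_le[of "blinfun_apply x v" v] v by simp
  qed
  have "cinner (blinfun_apply (adj x o\<^sub>L x) v) v = complex_of_real ((norm (blinfun_apply x v))\<^sup>2)"
    if "x \<in> A" for x
    using cinner_adj[OF adj_bounded_ops[OF alg_ops[OF that]], of "blinfun_apply x v" v]
    by (simp add: adj_adj alg_ops[OF that] cinner_self)
  then show ?thesis
    using le v
    by (auto simp: states_def dual_space_def alg_intros apply_simps cinner_add_left cinner_scaleC_left
        cinner_self nonneg_Reals_of_real_iff intro!: exI[of _ 2])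
qed

abbreviation "weak \<equiv> product_topology (\<lambda>_. euclidean :: complex topology) A"

lemma states_extensional: "\<phi> \<in> states A \<Longrightarrow> \<phi> \<in> extensional A"
  by (simp add: states_def dual_space_def)

lemma topspace_weak: "topspace weak = extensional A"
  by (simp add: PiE_UNIV_domain PiE_def)

lemma continuous_eval: "x \<in> A \<Longrightarrow> continuous_map weak euclidean (\<lambda>\<phi>. \<phi> x)"
  by (rule continuous_map_product_projection)

lemma continuous_eval_compose:
  assumes "x \<in> A" "continuous_on UNIV f"
  shows "continuous_map weak euclidean (\<lambda>\<phi>. f (\<phi> x))"
  using continuous_map_compose[OF continuous_eval[OF assms(1)], of euclidean f] assms(2)
  by (simp add: continuous_map_iff_continuous2 o_def)

lemma closedin_eval:
  assumes "x \<in> A" "closed C"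
  shows "closedin weak {\<phi> \<in> topspace weak. \<phi> x \<in> C}"
  using closedin_continuous_map_preimage[OF continuous_eval[OF assms(1)], of C] assms(2)
  by simp

text \<open>
  The bound on states is uniform, so that adding it to the defining conditions changes nothing, and
  every condition is closed for pointwise convergence.
\<close>
lemma closedin_states: "closedin weak (states A)"
proof -
  define B where "B = PiE A (\<lambda>x. cball (0::complex) (2 * norm x))"
  define C1 where "C1 x y = {\<phi> \<in> topspace weak. \<phi> (x + y) = \<phi> x + \<phi> y}" for x y
  define C2 where "C2 c x = {\<phi> \<in> topspace weak. \<phi> (scale_op c x) = c * \<phi> x}" for c x
  define C3 where "C3 x = {\<phi> \<in> topspace weak. \<phi> (adj x o\<^sub>L x) \<in> \<real>\<^sub>\<ge>\<^sub>0}" for x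
  define C4 where "C4 = {\<phi> \<in> topspace weak. \<phi> id_blinfun \<in> {1}}"
  have "states A = B \<inter> (\<Inter>x\<in>A. \<Inter>y\<in>A. C1 x y) \<inter> (\<Inter>c\<in>UNIV. \<Inter>x\<in>A. C2 c x) \<inter> (\<Inter>x\<in>A. C3 x) \<inter> C4"
    (is "_ = ?R")
  proof
    show "states A \<subseteq> ?R"
    proof
      fix \<phi> assume s: "\<phi> \<in> states A"
      have "\<phi> \<in> B"
        using state_norm_le[OF s] states_extensional[OF s] by (auto simp: B_def PiE_def)
      then show "\<phi> \<in> ?R"
        using s states_extensional[OF s] topspace_weak
        by (simp add: C1_def C2_def C3_def C4_def states_def dual_space_def)
    qed
    show "?R \<subseteq> states A"
    proof
      fix \<phi> assume R: "\<phi> \<in> ?R"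
      then have "\<phi> \<in> extensional A" "\<And>x. x \<in> A \<Longrightarrow> cmod (\<phi> x) \<le> 2 * norm x"
        by (auto simp: B_def PiE_def)
      then show "\<phi> \<in> states A"
        using R by (auto simp: C1_def C2_def C3_def C4_def states_def dual_space_def)
    qed
  qed
  moreover have "closedin weak B"
    unfolding B_def by (simp add: closedin_product_topology)
  moreover have "closedin weak (C1 x y)" if "x \<in> A" "y \<in> A" for x y
    unfolding C1_def using that
    by (intro closedin_continuous_maps_eq[where Y = euclidean] continuous_map_add continuous_eval
        alg_add) simp_all
  moreover have "closedin weak (C2 c x)" if "x \<in> A" for c x
    unfolding C2_def using that
    by (intro closedin_continuous_maps_eq[where Y = euclidean] continuous_eval
        continuous_eval_compose alg_scale)
      (auto intro: continuous_intros)
  moreover have "closedin weak (C3 x)" if "x \<in> A" for x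
    unfolding C3_def using that
    by (intro closedin_eval closed_nonneg_Reals_complex alg_compose alg_adj)
  moreover have "closedin weak C4"
    unfolding C4_def by (intro closedin_eval one) simp
  ultimately show ?thesis
    using one by (auto intro!: closedin_Int closedin_INT)
qed

lemma compactin_states: "compactin weak (states A)"
proof (rule closed_compactin[OF _ _ closedin_states])
  show "compactin weak (PiE A (\<lambda>x. cball (0::complex) (2 * norm x)))"
    by (simp add: compactin_PiE)
  show "states A \<subseteq> PiE A (\<lambda>x. cball (0::complex) (2 * norm x))"
    using state_norm_le states_extensional by (auto simp: PiE_def)
qed

definition face :: "(('h \<Rightarrow>\<^sub>L 'h) \<Rightarrow> complex) set \<Rightarrow> bool"
  where "face F \<longleftrightarrow> F \<subseteq> states A \<and> closedin weak F \<and> F \<noteq> {} \<and>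
    (\<forall>\<phi>\<in>F. \<forall>\<psi>\<in>states A. \<forall>\<omega>\<in>states A. \<forall>t::real. 0 < t \<and> t < 1 \<and>
      (\<forall>x\<in>A. \<phi> x = of_real (1 - t) * \<psi> x + of_real t * \<omega> x) \<longrightarrow> \<psi> \<in> F \<and> \<omega> \<in> F)"

lemma
  assumes "face F"
  shows face_states: "F \<subseteq> states A" and face_closedin: "closedin weak F" and face_nonempty: "F \<noteq> {}"
    and face_split: "\<phi> \<in> F \<Longrightarrow> \<psi> \<in> states A \<Longrightarrow> \<omega> \<in> states A \<Longrightarrow> 0 < t \<and> t < 1 \<and>
      (\<forall>x\<in>A. \<phi> x = of_real (1 - t) * \<psi> x + of_real t * \<omega> x) \<Longrightarrow> \<psi> \<in> F \<and> \<omega> \<in> F"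
  using assms unfolding face_def by blast+

lemma faceI:
  assumes "F \<subseteq> states A" "closedin weak F" "F \<noteq> {}"
    and "\<And>\<phi> \<psi> \<omega> t. \<phi> \<in> F \<Longrightarrow> \<psi> \<in> states A \<Longrightarrow> \<omega> \<in> states A \<Longrightarrow> 0 < t \<and> t < 1 \<and>
      (\<forall>x\<in>A. \<phi> x = of_real (1 - t) * \<psi> x + of_real t * \<omega> x) \<Longrightarrow> \<psi> \<in> F \<and> \<omega> \<in> F"
  shows "face F"
  using assms unfolding face_def by blast

lemma exposed_face:
  assumes F: "face F" and x: "x \<in> A"
  shows "face {\<phi>\<in>F. \<forall>\<psi>\<in>F. Re (\<psi> x) \<le> Re (\<phi> x)}"
proof -
  note Fs = face_states[OF F] face_closedin[OF F] face_nonempty[OF F]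
  have "compactin weak F" by (rule closed_compactin[OF compactin_states Fs(1,2)])
  then have "compactin euclidean ((\<lambda>\<phi>. Re (\<phi> x)) ` F)"
    by (rule image_compactin) (intro continuous_eval_compose x continuous_intros)
  then have "compact ((\<lambda>\<phi>. Re (\<phi> x)) ` F)" by simp
  then obtain \<phi>\<^sub>0 where \<phi>\<^sub>0: "\<phi>\<^sub>0 \<in> F" "\<And>\<psi>. \<psi> \<in> F \<Longrightarrow> Re (\<psi> x) \<le> Re (\<phi>\<^sub>0 x)"
    using compact_attains_sup[of "(\<lambda>\<phi>. Re (\<phi> x)) ` F"] Fs(3) by auto
  let ?F = "{\<phi>\<in>F. \<forall>\<psi>\<in>F. Re (\<psi> x) \<le> Re (\<phi> x)}"
  have eq: "?F = F \<inter> {\<phi> \<in> topspace weak. \<phi> x \<in> {z. Re (\<phi>\<^sub>0 x) \<le> Re z}}"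
    using \<phi>\<^sub>0 closedin_subset[OF Fs(2)] by (auto intro: order_trans)
  have closedF: "closedin weak ?F"
    unfolding eq by (intro closedin_Int Fs(2) closedin_eval x closed_Collect_le continuous_intros)
  show ?thesis
  proof (rule faceI[OF _ closedF])
    show "?F \<subseteq> states A" "?F \<noteq> {}" using Fs(1) \<phi>\<^sub>0 by blast+
    fix \<phi> \<psi> \<omega> and t :: real
    assume \<phi>: "\<phi> \<in> ?F" and st: "\<psi> \<in> states A" "\<omega> \<in> states A" and t: "0 < t \<and> t < 1 \<and>
      (\<forall>x\<in>A. \<phi> x = of_real (1 - t) * \<psi> x + of_real t * \<omega> x)"
    have "\<phi> \<in> F" using \<phi> by simp
    then have in_F: "\<psi> \<in> F" "\<omega> \<in> F" using face_split[OF F _ st t] by auto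
    then have le: "Re (\<psi> x) \<le> Re (\<phi> x)" "Re (\<omega> x) \<le> Re (\<phi> x)" using \<phi> by auto
    have "\<phi> x = of_real (1 - t) * \<psi> x + of_real t * \<omega> x" using t x by blast
    then have "Re (\<phi> x) = (1 - t) * Re (\<psi> x) + t * Re (\<omega> x)" by simp
    then have sum: "(1 - t) * (Re (\<phi> x) - Re (\<psi> x)) + t * (Re (\<phi> x) - Re (\<omega> x)) = 0"
      by (simp add: algebra_simps)
    have "0 \<le> (1 - t) * (Re (\<phi> x) - Re (\<psi> x))" "0 \<le> t * (Re (\<phi> x) - Re (\<omega> x))"
      using t le by auto
    then have "(1 - t) * (Re (\<phi> x) - Re (\<psi> x)) = 0" "t * (Re (\<phi> x) - Re (\<omega> x)) = 0"
      using sum by linarith+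
    then have "Re (\<phi> x) = Re (\<psi> x)" "Re (\<phi> x) = Re (\<omega> x)" using t by auto
    then show "\<psi> \<in> ?F \<and> \<omega> \<in> ?F" using \<phi> in_F by simp
  qed
qed

text \<open>
  A minimal closed face exists by compactness and Zorn's lemma, applied to complements of faces. Since
  its points cannot be separated by maximizing real parts of evaluations, it consists of one state.
\<close>
lemma face_contains_pure_state:
  assumes F0: "face F\<^sub>0"
  obtains \<alpha> where "\<alpha> \<in> F\<^sub>0" "\<alpha> \<in> pure_states A"
proof -
  let ?\<A> = "{C. \<exists>F. face F \<and> F \<subseteq> F\<^sub>0 \<and> C = topspace weak - F}"
  have face_top: "F \<subseteq> topspace weak" if "face F" for F
    using closedin_subset[OF face_closedin[OF that]] .
  have "\<exists>M\<in>?\<A>. \<forall>X\<in>?\<A>. M \<subseteq> X \<longrightarrow> X = M"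
  proof (rule subset_Zorn_nonempty)
    show "?\<A> \<noteq> {}" using F0 by blast
    fix \<C> assume ne: "\<C> \<noteq> {}" and chain: "subset.chain ?\<A> \<C>"
    define \<F> where "\<F> = {F. face F \<and> F \<subseteq> F\<^sub>0 \<and> topspace weak - F \<in> \<C>}"
    have C_sub: "\<C> \<subseteq> ?\<A>" and C_lin: "\<And>C D. C \<in> \<C> \<Longrightarrow> D \<in> \<C> \<Longrightarrow> C \<subseteq> D \<or> D \<subseteq> C"
      using chain unfolding subset_chain_def by blast+
    have \<F>_lin: "F \<subseteq> G \<or> G \<subseteq> F" if "F \<in> \<F>" "G \<in> \<F>" for F G
    proof -
      have "topspace weak - F \<in> \<C>" "topspace weak - G \<in> \<C>" using that by (simp_all add: \<F>_def)
      then have "topspace weak - F \<subseteq> topspace weak - G \<or> topspace weak - G \<subseteq> topspace weak - F"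
        using C_lin by blast
      moreover have "F \<subseteq> topspace weak" "G \<subseteq> topspace weak"
        using that face_top by (auto simp: \<F>_def)
      ultimately show ?thesis by blast
    qed
    have U_eq: "\<Union>\<C> = topspace weak - \<Inter>\<F>"
    proof
      show "\<Union>\<C> \<subseteq> topspace weak - \<Inter>\<F>"
      proof
        fix z assume "z \<in> \<Union>\<C>"
        then obtain C where C: "C \<in> \<C>" "z \<in> C" by blast
        then obtain F where "face F" "F \<subseteq> F\<^sub>0" "C = topspace weak - F" using C_sub by blast
        then show "z \<in> topspace weak - \<Inter>\<F>" using C by (auto simp: \<F>_def)
      qed
      show "topspace weak - \<Inter>\<F> \<subseteq> \<Union>\<C>" by (auto simp: \<F>_def)
    qed
    have \<F>_ne: "\<F> \<noteq> {}"
    proof -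
      obtain C where "C \<in> \<C>" using ne by blast
      then show ?thesis using C_sub by (auto simp: \<F>_def)
    qed
    have fin: "\<Inter>\<G> \<in> \<F>" if "finite \<G>" "\<G> \<noteq> {}" "\<G> \<subseteq> \<F>" for \<G>
      using that
    proof (induction \<G> rule: finite_ne_induct)
      case (insert F \<G>)
      then have "F \<subseteq> \<Inter>\<G> \<or> \<Inter>\<G> \<subseteq> F" using \<F>_lin by blast
      then have "\<Inter>(insert F \<G>) = F \<or> \<Inter>(insert F \<G>) = \<Inter>\<G>" by auto
      then show ?case using insert by auto
    qed simp
    have \<F>_face: "face F" "F \<subseteq> F\<^sub>0" if "F \<in> \<F>" for F using that by (simp_all add: \<F>_def)
    have "\<Inter>\<F> \<subseteq> states A" "\<Inter>\<F> \<subseteq> F\<^sub>0"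
      using \<F>_ne \<F>_face face_states by blast+
    have "states A \<inter> \<Inter>\<F> \<noteq> {}"
    proof -
      have "states A \<inter> \<Inter>\<G> \<noteq> {}" if "finite \<G> \<and> \<G> \<subseteq> \<F>" for \<G>
      proof (cases "\<G> = {}")
        case True
        then show ?thesis using face_nonempty[OF F0] face_states[OF F0] by auto
      next
        case False
        then have "face (\<Inter>\<G>)" using fin that \<F>_face by blast
        then show ?thesis using face_nonempty face_states by (metis inf.absorb2)
      qed
      moreover have "\<forall>C\<in>\<F>. closedin weak C" using \<F>_face face_closedin by blast
      ultimately show ?thesis using compactin_states unfolding compactin_fip by blast
    qed
    moreover have "closedin weak (\<Inter>\<F>)"
      using \<F>_ne \<F>_face face_closedin by (intro closedin_Inter) blast+
    ultimately have "face (\<Inter>\<F>)"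
    proof (intro faceI)
      fix \<phi> \<psi> \<omega> and t :: real
      assume *: "\<phi> \<in> \<Inter>\<F>" "\<psi> \<in> states A" "\<omega> \<in> states A" "0 < t \<and> t < 1 \<and>
        (\<forall>x\<in>A. \<phi> x = of_real (1 - t) * \<psi> x + of_real t * \<omega> x)"
      have "\<psi> \<in> F \<and> \<omega> \<in> F" if "F \<in> \<F>" for F
        using face_split[OF \<F>_face(1)[OF that] _ *(2-4)] *(1) that by blast
      then show "\<psi> \<in> \<Inter>\<F> \<and> \<omega> \<in> \<Inter>\<F>" by blast
    qed (use \<open>\<Inter>\<F> \<subseteq> states A\<close> in auto)
    with \<open>\<Inter>\<F> \<subseteq> F\<^sub>0\<close>
    show "\<Union>\<C> \<in> ?\<A>" unfolding U_eq by blast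
  qed
  then obtain M where M: "M \<in> ?\<A>" and M_max: "\<forall>X\<in>?\<A>. M \<subseteq> X \<longrightarrow> X = M" by (rule bexE)
  from M obtain F where F: "face F" "F \<subseteq> F\<^sub>0" and MF: "M = topspace weak - F"
    by (elim CollectE exE conjE)
  have max: "C = topspace weak - F" if "C \<in> ?\<A>" "topspace weak - F \<subseteq> C" for C
    using bspec[OF M_max that(1)] that(2) unfolding MF by (rule mp)
  have min': "G = F" if G: "face G" "G \<subseteq> F" for G
  proof -
    have "topspace weak - G \<in> ?\<A>" using G F(2) by blast
    then have "topspace weak - G = topspace weak - F" by (rule max) (use G(2) in blast)
    then show ?thesis using face_top[OF G(1)] face_top[OF F(1)] by blast
  qed
  have const: "Re (\<phi> x) = Re (\<psi> x)" if "\<phi> \<in> F" "\<psi> \<in> F" "x \<in> A" for \<phi> \<psi> x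
  proof -
    have "{\<phi>\<in>F. \<forall>\<psi>\<in>F. Re (\<psi> x) \<le> Re (\<phi> x)} = F"
      by (rule min'[OF exposed_face[OF F(1) that(3)]]) auto
    then have "\<phi> \<in> {\<phi>\<in>F. \<forall>\<psi>\<in>F. Re (\<psi> x) \<le> Re (\<phi> x)}" "\<psi> \<in> {\<phi>\<in>F. \<forall>\<psi>\<in>F. Re (\<psi> x) \<le> Re (\<phi> x)}"
      using that(1,2) by (simp_all only:)
    then show ?thesis using that(1,2) by (auto intro: order_antisym)
  qed
  obtain \<alpha> where \<alpha>: "\<alpha> \<in> F" using face_nonempty[OF F(1)] by blast
  have single: "\<beta> = \<alpha>" if \<beta>: "\<beta> \<in> F" for \<beta>
  proof (rule extensionalityI)
    have s: "\<alpha> \<in> states A" "\<beta> \<in> states A" using \<alpha> \<beta> face_states[OF F(1)] by auto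
    then show "\<beta> \<in> extensional A" "\<alpha> \<in> extensional A" by (simp_all add: states_extensional)
    fix x assume x: "x \<in> A"
    have "Re (\<beta> (scale_op (- \<i>) x)) = Re (\<alpha> (scale_op (- \<i>) x))"
      by (rule const[OF \<beta> \<alpha> alg_scale[OF x]])
    then have "Im (\<beta> x) = Im (\<alpha> x)" using s x by (simp add: state_scale)
    then show "\<beta> x = \<alpha> x" using const[OF \<beta> \<alpha> x] by (simp add: complex_eq_iff)
  qed
  have "\<alpha> \<in> pure_states A"
    unfolding pure_states_def
  proof (intro CollectI conjI ballI allI impI)
    show "\<alpha> \<in> states A" using \<alpha> face_states[OF F(1)] by blast
    fix \<psi> \<omega> and t :: real
    assume "\<psi> \<in> states A" "\<omega> \<in> states A" "0 < t \<and> t < 1 \<and>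
      (\<forall>x\<in>A. \<alpha> x = of_real (1 - t) * \<psi> x + of_real t * \<omega> x)"
    then have "\<psi> \<in> F \<and> \<omega> \<in> F" by (rule face_split[OF F(1) \<alpha>])
    then show "\<psi> = \<alpha>" "\<omega> = \<alpha>" using single by auto
  qed
  then show ?thesis using that \<alpha> F(2) by blast
qed

lemma pure_state_maximizing:
  assumes x: "x \<in> A" and v: "norm v = 1"
  obtains \<alpha> where "\<alpha> \<in> pure_states A" "blinfun_apply x v \<bullet> v \<le> Re (\<alpha> x)"
proof -
  let ?\<rho> = "restrict (\<lambda>x. cinner (blinfun_apply x v) v) A"
  note \<rho> = vector_state[OF v]
  have "face (states A)" by (rule faceI[OF order_refl closedin_states]) (use \<rho> in auto)
  from exposed_face[OF this x] obtain \<alpha> where \<alpha>: "\<alpha> \<in> pure_states A"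
      "\<alpha> \<in> {\<phi>\<in>states A. \<forall>\<psi>\<in>states A. Re (\<psi> x) \<le> Re (\<phi> x)}"
    by (rule face_contains_pure_state) blast
  then have "Re (?\<rho> x) \<le> Re (\<alpha> x)" using \<rho> by blast
  then show ?thesis using that \<alpha>(1) x by (simp add: Re_cinner)
qed

lemma pure_states_subset_P_space: "pure_states A \<subseteq> P_space A"
proof
  fix \<alpha> assume \<alpha>: "\<alpha> \<in> pure_states A"
  then have s: "\<alpha> \<in> states A" by (simp add: pure_states_def)
  have "pure_states A \<subseteq> topspace (weak_star A)"
    unfolding weak_star_def topspace_subtopology topspace_weak
    by (auto simp: pure_states_def states_def dual_space_def)
  then have "\<alpha> \<in> weak_star A closure_of pure_states A" using \<alpha> closure_of_subset by blast
  moreover have "\<alpha> \<noteq> restrict (\<lambda>_. 0) A"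
    using state_one[OF s] one by (metis restrict_apply' zero_neq_one)
  ultimately show "\<alpha> \<in> P_space A" by (simp add: P_space_def)
qed

end

section \<open>From the branches to \<open>Y\<close> and \<open>\<Sigma>(a)\<close>\<close>

definition spectral_decompositions :: "('h::complex_hilbert \<Rightarrow>\<^sub>L 'h) \<Rightarrow> bool"
  where "spectral_decompositions a \<longleftrightarrow>
    (\<exists>(E :: (('h \<Rightarrow>\<^sub>L 'h) \<Rightarrow> complex) set set \<Rightarrow> 'h \<Rightarrow>\<^sub>L 'h) j.
      spectral_measure (Y_space a) E \<and>
      (\<forall>y \<in> topspace (Y_space a). j y \<in> bounded_ops) \<and>
      (\<forall>y \<in> topspace (Y_space a). strongly_spectral (j y)) \<and>
      has_spectral_integral (Y_space a) E j a) \<and>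
    (\<exists>(E :: complex set \<Rightarrow> 'h \<Rightarrow>\<^sub>L 'h) k.
      spectral_measure (top_of_set (Sigma_op a)) E \<and>
      (\<forall>c. k c \<in> bounded_ops) \<and> (\<forall>c. strongly_spectral (k c)) \<and>
      has_spectral_integral (top_of_set (Sigma_op a)) E k a)"

lemma P_space_topspace: "P_space A \<subseteq> topspace (weak_star A)"
  unfolding P_space_def using closure_of_subset_topspace by fastforce

lemma topspace_P_space: "topspace (subtopology (weak_star A) (P_space A)) = P_space A"
  using P_space_topspace[of A] by (simp add: topspace_subtopology Int_absorb1)

lemma topspace_Y_space: "topspace (Y_space a) = r_map a ` P_space (gen_cstar a)"
  unfolding Y_space_def topspace_quotient_topology topspace_P_space ..

lemma openin_Y_space:
  "openin (Y_space a) U \<longleftrightarrow> U \<subseteq> topspace (Y_space a) \<and>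
    openin (subtopology (weak_star (gen_cstar a)) (P_space (gen_cstar a)))
      {\<alpha> \<in> P_space (gen_cstar a). r_map a \<alpha> \<in> U}"
  unfolding topspace_Y_space unfolding Y_space_def openin_quotient_topology topspace_P_space ..

lemma openin_P_space:
  "openin (subtopology (weak_star A) (P_space A)) V \<longleftrightarrow>
    (\<exists>W. openin (product_topology (\<lambda>_. euclidean) A) W \<and> V = W \<inter> P_space A)"
proof -
  have "P_space A \<subseteq> dual_space A"
    using P_space_topspace[of A] by (auto simp: weak_star_def)
  then show ?thesis
    unfolding weak_star_def subtopology_subtopology by (simp add: Int_absorb1 openin_subtopology)
qed

lemma z_map_in_Sigma: "y \<in> topspace (Y_space a) \<Longrightarrow> z_map a y \<in> Sigma_op a"
  unfolding topspace_Y_space Sigma_op_def by (auto simp: z_map_r_map)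

context
  fixes a :: "'h::complex_hilbert \<Rightarrow>\<^sub>L 'h"
  assumes a: "a \<in> bounded_ops"
begin

lemma openin_z_map_preimage:
  assumes "open V"
  shows "openin (Y_space a) {y \<in> topspace (Y_space a). z_map a y \<in> V}"
proof -
  have "{\<alpha> \<in> P_space (gen_cstar a). r_map a \<alpha> \<in> {y \<in> topspace (Y_space a). z_map a y \<in> V}} =
      {\<alpha> \<in> topspace (product_topology (\<lambda>_. euclidean) (gen_cstar a)). \<alpha> a \<in> V} \<inter> P_space (gen_cstar a)"
    using P_space_topspace[of "gen_cstar a"]
    by (auto simp: topspace_Y_space z_map_r_map tau_def weak_star_def)
  moreover have "openin (product_topology (\<lambda>_. euclidean) (gen_cstar a))
      {\<alpha> \<in> topspace (product_topology (\<lambda>_. euclidean) (gen_cstar a)). \<alpha> a \<in> V}"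
    using assms
    by (intro openin_continuous_map_preimage[OF continuous_map_product_projection] gen_in_gen_cstar a) simp
  ultimately show ?thesis
    unfolding openin_Y_space openin_P_space by blast
qed

lemma z_map_borel:
  "B \<in> sets borel \<Longrightarrow> {y \<in> topspace (Y_space a). z_map a y \<in> B} \<in> borel_sets (Y_space a)"
proof (rule borel_sets_preimage[where f = "z_map a" and X = euclidean, OF _ sigma_algebra_borel_sets])
  show "{y \<in> topspace (Y_space a). z_map a y \<in> U} \<in> borel_sets (Y_space a)" if "openin euclidean U" for U
    unfolding borel_sets_def
    by (rule sigma_sets.Basic) (use openin_z_map_preimage that in simp)
qed (simp_all add: borel_sets_euclidean)

lemma Sigma_borel:
  "B \<in> sets borel \<Longrightarrow> {c \<in> topspace (top_of_set S). c \<in> B} \<in> borel_sets (top_of_set S)"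
  for B :: "complex set"
proof (rule borel_sets_preimage[of _ "\<lambda>c. c" euclidean])
  show "sigma_algebra (topspace (top_of_set S)) (borel_sets (top_of_set S))"
    by (rule sigma_algebra_borel_sets)
  show "{y \<in> topspace (top_of_set S). y \<in> U} \<in> borel_sets (top_of_set S)" if "openin euclidean U" for U
  proof -
    have "{y \<in> topspace (top_of_set S). y \<in> U} = S \<inter> U" by auto
    moreover have "openin (top_of_set S) (S \<inter> U)" using that by (simp add: openin_open_Int)
    ultimately show ?thesis by (auto simp: borel_sets_def)
  qed
qed (simp_all add: borel_sets_euclidean)

context
  fixes \<Gamma> :: "(nat \<Rightarrow> bool) \<Rightarrow> (('h \<Rightarrow>\<^sub>L 'h) \<Rightarrow> complex) set"
  assumes \<Gamma>: "\<And>\<omega>. \<Gamma> \<omega> \<in> topspace (Y_space a)"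
    and \<Gamma>_meas: "\<And>U. openin (Y_space a) U \<Longrightarrow> \<Gamma> -` U \<in> sets branches"
begin

lemma Sigma_image:
  shows "z_map a (\<Gamma> \<omega>) \<in> topspace (top_of_set (Sigma_op a))"
    and "openin (top_of_set (Sigma_op a)) U \<Longrightarrow> (\<lambda>\<omega>. z_map a (\<Gamma> \<omega>)) -` U \<in> sets branches"
proof -
  show "z_map a (\<Gamma> \<omega>) \<in> topspace (top_of_set (Sigma_op a))" for \<omega>
    using z_map_in_Sigma[OF \<Gamma>] by simp
  assume "openin (top_of_set (Sigma_op a)) U"
  then obtain V where V: "open V" "U = Sigma_op a \<inter> V" by (auto simp: openin_open)
  have "(\<lambda>\<omega>. z_map a (\<Gamma> \<omega>)) -` U = \<Gamma> -` {y \<in> topspace (Y_space a). z_map a y \<in> V}"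
    using \<Gamma> z_map_in_Sigma[OF \<Gamma>] by (auto simp: V(2))
  then show "(\<lambda>\<omega>. z_map a (\<Gamma> \<omega>)) -` U \<in> sets branches"
    using \<Gamma>_meas[OF openin_z_map_preimage[OF V(1)]] by simp
qed

text \<open>
  The integrands on \<open>Y\<close> and on \<open>\<Sigma>(a)\<close> correspond under \<open>z\<close>: both decode a branch from a complex
  number and take the value of \<open>branch_fun a\<close> there.
\<close>
lemma spectral_decompositions_by_decoding:
  assumes dec: "\<And>\<omega>. dec (z_map a (\<Gamma> \<omega>)) = \<omega>"
    and dec_meas: "\<And>m s. {c :: complex. prefix (dec c) m = s} \<in> sets borel"
  shows "spectral_decompositions a"
  unfolding spectral_decompositions_def
proof (intro conjI exI ballI allI)
  show "spectral_measure (Y_space a) (\<lambda>U. branch_op a (\<Gamma> -` U))"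
    by (rule spectral_measure_image[OF a \<Gamma> \<Gamma>_meas])
  show "has_spectral_integral (Y_space a) (\<lambda>U. branch_op a (\<Gamma> -` U)) (\<lambda>y. branch_fun a (dec (z_map a y))) a"
  proof (rule integral_branch_fun[OF a \<Gamma> \<Gamma>_meas dec])
    show "{y \<in> topspace (Y_space a). prefix (dec (z_map a y)) m = s} \<in> borel_sets (Y_space a)" for m s
      using z_map_borel[OF dec_meas[of m s]] by simp
  qed
  show "spectral_measure (top_of_set (Sigma_op a)) (\<lambda>U. branch_op a ((\<lambda>\<omega>. z_map a (\<Gamma> \<omega>)) -` U))"
    by (rule spectral_measure_image[OF a Sigma_image])
  show "has_spectral_integral (top_of_set (Sigma_op a))
      (\<lambda>U. branch_op a ((\<lambda>\<omega>. z_map a (\<Gamma> \<omega>)) -` U)) (\<lambda>c. branch_fun a (dec c)) a"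
  proof (rule integral_branch_fun[OF a Sigma_image dec])
    show "{c \<in> topspace (top_of_set (Sigma_op a)). prefix (dec c) m = s} \<in>
        borel_sets (top_of_set (Sigma_op a))" for m s
      using Sigma_borel[OF dec_meas[of m s]] by simp
  qed
qed (simp_all add: branch_fun_bounded_ops strongly_spectral_branch_fun a)

lemma spectral_decompositions_normal:
  assumes normal: "adj a o\<^sub>L a = a o\<^sub>L adj a"
    and z: "\<And>\<omega>. \<omega> \<in> full_branches a \<Longrightarrow> z_map a (\<Gamma> \<omega>) = branch_value a \<omega>"
  shows "spectral_decompositions a"
  unfolding spectral_decompositions_def
proof (intro conjI exI ballI allI)
  show "spectral_measure (Y_space a) (\<lambda>U. branch_op a (\<Gamma> -` U))"
    by (rule spectral_measure_image[OF a \<Gamma> \<Gamma>_meas])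
  show "has_spectral_integral (Y_space a) (\<lambda>U. branch_op a (\<Gamma> -` U))
      (\<lambda>y. scale_op (z_map a y) id_blinfun) a"
    by (intro integral_normal[OF a \<Gamma> \<Gamma>_meas normal] z z_map_borel)
  show "spectral_measure (top_of_set (Sigma_op a)) (\<lambda>U. branch_op a ((\<lambda>\<omega>. z_map a (\<Gamma> \<omega>)) -` U))"
    by (rule spectral_measure_image[OF a Sigma_image])
  show "has_spectral_integral (top_of_set (Sigma_op a))
      (\<lambda>U. branch_op a ((\<lambda>\<omega>. z_map a (\<Gamma> \<omega>)) -` U)) (\<lambda>c. scale_op c id_blinfun) a"
    by (intro integral_normal[OF a Sigma_image normal] z Sigma_borel)
qed (simp_all add: bounded_ops_intros strongly_spectral_scalar)

end

section \<open>Normal operators\<close>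

text \<open>
  The number \<open>c\<close> may depend on the node of depth \<open>n\<close> on the branch, but \<open>n\<close> is the same for all branches.
  This uniformity is what makes the characters below depend continuously on the branch.
\<close>
definition asymptotically_scalar :: "('h \<Rightarrow>\<^sub>L 'h) \<Rightarrow> bool"
  where "asymptotically_scalar x \<longleftrightarrow> (\<forall>e>0. \<exists>n. \<forall>\<omega>. \<exists>c.
    norm ((x - scale_op c id_blinfun) o\<^sub>L node a (prefix \<omega> n)) \<le> e)"

lemma norm_compose_node_mono:
  assumes "n \<le> m"
  shows "norm (x o\<^sub>L node a (prefix \<omega> m)) \<le> norm (x o\<^sub>L node a (prefix \<omega> n))"
proof -
  have "x o\<^sub>L node a (prefix \<omega> m) = (x o\<^sub>L node a (prefix \<omega> n)) o\<^sub>L node a (prefix \<omega> m)"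
    by (simp add: compose_assoc node_prefix[OF a assms])
  also have "norm \<dots> \<le> norm (x o\<^sub>L node a (prefix \<omega> n)) * 1"
    by (intro norm_compose_mono projection_norm_le_1 node_projection a) simp
  finally show ?thesis by simp
qed

lemma scalar_mono:
  assumes "\<exists>c. norm ((x - scale_op c id_blinfun) o\<^sub>L node a (prefix \<omega> n)) \<le> e" and "n \<le> m"
  shows "\<exists>c. norm ((x - scale_op c id_blinfun) o\<^sub>L node a (prefix \<omega> m)) \<le> e"
  using assms(1) norm_compose_node_mono[OF assms(2)] order_trans by blast

lemma asymptotically_scalar_add:
  assumes "asymptotically_scalar x" "asymptotically_scalar y"
  shows "asymptotically_scalar (x + y)"
  unfolding asymptotically_scalar_def
proof (intro allI impI)
  fix e :: real assume "e > 0"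
  then have "e / 2 > 0" by simp
  then obtain n m where n: "\<And>\<omega>. \<exists>c. norm ((x - scale_op c id_blinfun) o\<^sub>L node a (prefix \<omega> n)) \<le> e / 2"
    and m: "\<And>\<omega>. \<exists>c. norm ((y - scale_op c id_blinfun) o\<^sub>L node a (prefix \<omega> m)) \<le> e / 2"
    using assms unfolding asymptotically_scalar_def by meson
  show "\<exists>n. \<forall>\<omega>. \<exists>c. norm ((x + y - scale_op c id_blinfun) o\<^sub>L node a (prefix \<omega> n)) \<le> e"
  proof (intro exI[of _ "max n m"] allI)
    fix \<omega>
    let ?F = "node a (prefix \<omega> (max n m))"
    obtain c d where c: "norm ((x - scale_op c id_blinfun) o\<^sub>L ?F) \<le> e / 2"
      and d: "norm ((y - scale_op d id_blinfun) o\<^sub>L ?F) \<le> e / 2"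
      using scalar_mono[OF n[of \<omega>], of "max n m"] scalar_mono[OF m[of \<omega>], of "max n m"] by auto
    have eq: "(x + y - scale_op (c + d) id_blinfun) o\<^sub>L ?F =
        ((x - scale_op c id_blinfun) o\<^sub>L ?F) + ((y - scale_op d id_blinfun) o\<^sub>L ?F)"
      by (intro blinfun_eqI) (simp add: apply_simps scaleC_add_left)
    have "norm ((x + y - scale_op (c + d) id_blinfun) o\<^sub>L ?F) \<le> e"
      unfolding eq using norm_triangle_le[OF add_mono[OF c d]] by simp
    then show "\<exists>c. norm ((x + y - scale_op c id_blinfun) o\<^sub>L ?F) \<le> e" ..
  qed
qed

lemma asymptotically_scalar_compose:
  assumes "asymptotically_scalar x" "asymptotically_scalar y" and x: "x \<in> bounded_ops"
  shows "asymptotically_scalar (x o\<^sub>L y)"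
  unfolding asymptotically_scalar_def
proof (intro allI impI)
  fix e :: real assume e: "e > 0"
  define K where "K = norm x + norm y + 1"
  have K: "K \<ge> 1" by (simp add: K_def)
  define \<delta> where "\<delta> = min 1 (e / (2 * K))"
  have \<delta>: "\<delta> > 0" "\<delta> \<le> 1" "K * \<delta> \<le> e / 2"
    using e K by (auto simp: \<delta>_def min_def field_simps)
  then obtain n m where n: "\<And>\<omega>. \<exists>c. norm ((x - scale_op c id_blinfun) o\<^sub>L node a (prefix \<omega> n)) \<le> \<delta>"
    and m: "\<And>\<omega>. \<exists>c. norm ((y - scale_op c id_blinfun) o\<^sub>L node a (prefix \<omega> m)) \<le> \<delta>"
    using assms unfolding asymptotically_scalar_def by meson
  show "\<exists>n. \<forall>\<omega>. \<exists>c. norm ((x o\<^sub>L y) - scale_op c id_blinfun o\<^sub>L node a (prefix \<omega> n)) \<le> e"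
  proof (intro exI[of _ "max n m"] allI)
    fix \<omega>
    let ?F = "node a (prefix \<omega> (max n m))"
    obtain c d where c: "norm ((x - scale_op c id_blinfun) o\<^sub>L ?F) \<le> \<delta>"
      and d: "norm ((y - scale_op d id_blinfun) o\<^sub>L ?F) \<le> \<delta>"
      using scalar_mono[OF n[of \<omega>], of "max n m"] scalar_mono[OF m[of \<omega>], of "max n m"] by auto
    have F: "is_projection ?F" by (rule node_projection[OF a])
    show "\<exists>c. norm ((x o\<^sub>L y) - scale_op c id_blinfun o\<^sub>L ?F) \<le> e"
    proof (cases "?F = 0")
      case True
      then show ?thesis using e by simp
    next
      case False
      have "norm ?F = norm (?F o\<^sub>L ?F)" by (simp add: projection_compose_self F)
      also have "\<dots> \<le> norm ?F * norm ?F" by (rule norm_blinfun_compose)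
      finally have "1 * norm ?F \<le> norm ?F * norm ?F" by simp
      then have "1 \<le> norm ?F"
        by (rule mult_right_le_imp_le) (use False in simp)
      then have nF: "norm ?F = 1" by (intro order_antisym projection_norm_le_1[OF F])
      have eq1: "scale_op d ?F = (y o\<^sub>L ?F) - ((y - scale_op d id_blinfun) o\<^sub>L ?F)"
        by (intro blinfun_eqI) (simp add: apply_simps)
      have "cmod d = norm (scale_op d ?F)" by (simp add: norm_scale_op nF)
      also have "\<dots> \<le> norm y * norm ?F + \<delta>"
        unfolding eq1 by (intro order_trans[OF norm_triangle_ineq4] add_mono norm_blinfun_compose d)
      finally have dle: "cmod d \<le> norm y + 1" using \<delta>(2) nF by simp
      \<comment> \<open>\<open>xy - cd = x (y - d) + d (x - c)\<close>\<close>
      have eq: "(x o\<^sub>L y) - scale_op (c * d) id_blinfun o\<^sub>L ?F =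
          (x o\<^sub>L ((y - scale_op d id_blinfun) o\<^sub>L ?F)) + scale_op d ((x - scale_op c id_blinfun) o\<^sub>L ?F)"
        by (intro blinfun_eqI)
          (simp add: apply_simps bounded_opsD[OF x] scaleC_diff_right scaleC_scaleC mult.commute)
      have "norm ((x o\<^sub>L y) - scale_op (c * d) id_blinfun o\<^sub>L ?F) \<le> norm x * \<delta> + (norm y + 1) * \<delta>"
        unfolding eq norm_scale_op[symmetric]
        by (intro norm_triangle_le add_mono norm_compose_mono d order_refl)
          (simp add: norm_scale_op, intro mult_mono c dle, auto)
      also have "\<dots> = K * \<delta>" by (simp add: K_def algebra_simps)
      finally show ?thesis using \<delta>(3) e by (intro exI[of _ "c * d"]) linarith
    qed
  qed
qed

lemma asymptotically_scalar_scale: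
  assumes "asymptotically_scalar x"
  shows "asymptotically_scalar (scale_op d x)"
  unfolding asymptotically_scalar_def
proof (intro allI impI)
  fix e :: real assume e: "e > 0"
  define \<delta> where "\<delta> = e / (cmod d + 1)"
  have "cmod d + 1 > 0" using norm_ge_zero[of d] by linarith
  then have \<delta>: "\<delta> > 0" "cmod d * \<delta> \<le> e"
    using e by (auto simp: \<delta>_def field_simps)
  then obtain n where n: "\<And>\<omega>. \<exists>c. norm ((x - scale_op c id_blinfun) o\<^sub>L node a (prefix \<omega> n)) \<le> \<delta>"
    using assms unfolding asymptotically_scalar_def by meson
  have "\<exists>c. norm ((scale_op d x - scale_op c id_blinfun) o\<^sub>L node a (prefix \<omega> n)) \<le> e" for \<omega>
  proof -
    obtain c where c: "norm ((x - scale_op c id_blinfun) o\<^sub>L node a (prefix \<omega> n)) \<le> \<delta>" using n by blast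
    have eq: "(scale_op d x - scale_op (d * c) id_blinfun) o\<^sub>L node a (prefix \<omega> n) =
        scale_op d ((x - scale_op c id_blinfun) o\<^sub>L node a (prefix \<omega> n))"
      by (intro blinfun_eqI) (simp add: apply_simps scaleC_diff_right scaleC_scaleC)
    have "norm ((scale_op d x - scale_op (d * c) id_blinfun) o\<^sub>L node a (prefix \<omega> n)) \<le> cmod d * \<delta>"
      unfolding eq norm_scale_op using c by (intro mult_left_mono) auto
    then show ?thesis using \<delta>(2) by (intro exI[of _ "d * c"]) linarith
  qed
  then show "\<exists>n. \<forall>\<omega>. \<exists>c. norm ((scale_op d x - scale_op c id_blinfun) o\<^sub>L node a (prefix \<omega> n)) \<le> e"
    by blast
qed

lemma asymptotically_scalar_limit:
  assumes x: "\<And>e. e > 0 \<Longrightarrow> \<exists>y. asymptotically_scalar y \<and> norm (x - y) \<le> e"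
  shows "asymptotically_scalar x"
  unfolding asymptotically_scalar_def
proof (intro allI impI)
  fix e :: real assume "e > 0"
  then have e2: "e / 2 > 0" by simp
  then obtain y where y: "asymptotically_scalar y" "norm (x - y) \<le> e / 2" using x by blast
  then obtain n where n: "\<And>\<omega>. \<exists>c. norm ((y - scale_op c id_blinfun) o\<^sub>L node a (prefix \<omega> n)) \<le> e / 2"
    using e2 unfolding asymptotically_scalar_def by meson
  have "\<exists>c. norm ((x - scale_op c id_blinfun) o\<^sub>L node a (prefix \<omega> n)) \<le> e" for \<omega>
  proof -
    obtain c where c: "norm ((y - scale_op c id_blinfun) o\<^sub>L node a (prefix \<omega> n)) \<le> e / 2" using n by blast
    have eq: "(x - scale_op c id_blinfun) o\<^sub>L node a (prefix \<omega> n) =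
        ((x - y) o\<^sub>L node a (prefix \<omega> n)) + ((y - scale_op c id_blinfun) o\<^sub>L node a (prefix \<omega> n))"
      by (intro blinfun_eqI) (simp add: apply_simps)
    have "norm ((x - y) o\<^sub>L node a (prefix \<omega> n)) \<le> e / 2 * 1"
      by (intro norm_compose_mono y projection_norm_le_1 node_projection a)
    then have "norm ((x - scale_op c id_blinfun) o\<^sub>L node a (prefix \<omega> n)) \<le> e / 2 * 1 + e / 2"
      unfolding eq using c by (intro norm_triangle_le add_mono)
    then show ?thesis by (intro exI[of _ c]) simp
  qed
  then show "\<exists>n. \<forall>\<omega>. \<exists>c. norm ((x - scale_op c id_blinfun) o\<^sub>L node a (prefix \<omega> n)) \<le> e" by blast
qed

lemma asymptotically_scalar_scalar: "asymptotically_scalar (scale_op c id_blinfun)"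
  unfolding asymptotically_scalar_def
proof (intro allI impI exI)
  fix e :: real and \<omega> assume "e > 0"
  then show "norm ((scale_op c id_blinfun - scale_op c id_blinfun) o\<^sub>L node a (prefix \<omega> 0)) \<le> e"
    by simp
qed

end

lemma cinner_diff_left: "cinner (u - w) v = cinner u v - cinner w v" for u v w :: "'h::complex_hilbert"
  using cinner_add_left[of "u - w" w v] by simp

definition unit_vector :: "('h::complex_hilbert \<Rightarrow>\<^sub>L 'h) \<Rightarrow> bool list \<Rightarrow> 'h"
  where "unit_vector a s = (SOME v. norm v = 1 \<and> blinfun_apply (node a s) v = v)"

text \<open>
  Along a full branch the vector states of unit vectors in the nodes converge on \<open>C*(1, a)\<close>; the limit
  does not depend on the vectors, but choosing them makes it visibly a state.
\<close>
definition branch_eval :: "('h::complex_hilbert \<Rightarrow>\<^sub>L 'h) \<Rightarrow> (nat \<Rightarrow> bool) \<Rightarrow> ('h \<Rightarrow>\<^sub>L 'h) \<Rightarrow> nat \<Rightarrow> complex"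
  where "branch_eval a \<omega> x n =
    cinner (blinfun_apply x (unit_vector a (prefix \<omega> n))) (unit_vector a (prefix \<omega> n))"

definition branch_state :: "('h::complex_hilbert \<Rightarrow>\<^sub>L 'h) \<Rightarrow> (nat \<Rightarrow> bool) \<Rightarrow> ('h \<Rightarrow>\<^sub>L 'h) \<Rightarrow> complex"
  where "branch_state a \<omega> = restrict (\<lambda>x. lim (branch_eval a \<omega> x)) (gen_cstar a)"

context
  fixes a :: "'h::complex_hilbert \<Rightarrow>\<^sub>L 'h"
  assumes a: "a \<in> bounded_ops" and normal: "adj a o\<^sub>L a = a o\<^sub>L adj a"
begin

lemma asymptotically_scalar_generator:
  "asymptotically_scalar a a" "asymptotically_scalar a (adj a)"
proof -
  note F = node_projection[OF a] and comm = normal_node_commute[OF a normal]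
  have *: "norm ((a - scale_op (center a (prefix \<omega> n)) id_blinfun) o\<^sub>L node a (prefix \<omega> n)) \<le> eps a n"
    "norm ((adj a - scale_op (cnj (center a (prefix \<omega> n))) id_blinfun) o\<^sub>L node a (prefix \<omega> n)) \<le> eps a n"
    for \<omega> n
  proof -
    let ?F = "node a (prefix \<omega> n)" and ?c = "center a (prefix \<omega> n)"
    let ?T = "?F o\<^sub>L (a - scale_op ?c id_blinfun) o\<^sub>L ?F"
    have Fx: "blinfun_apply ?F (blinfun_apply a x) = blinfun_apply a (blinfun_apply ?F x)"
      "blinfun_apply ?F (blinfun_apply (adj a) x) = blinfun_apply (adj a) (blinfun_apply ?F x)" for x
      using compose_eqD[OF comm(1)] compose_eqD[OF comm(2)] by simp_all
    note lin = bounded_opsD[OF projection_ops[OF F]]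
    have T: "norm ?T \<le> eps a n" using node_compression[OF a, of "prefix \<omega> n"] by simp
    have "?T = (a - scale_op ?c id_blinfun) o\<^sub>L ?F"
      by (intro blinfun_eqI) (simp add: apply_simps Fx lin projection_idem[OF F])
    then show "norm ((a - scale_op ?c id_blinfun) o\<^sub>L ?F) \<le> eps a n" using T by simp
    have "adj ?T = ?F o\<^sub>L (adj a - scale_op (cnj ?c) id_blinfun) o\<^sub>L ?F"
      using projection_self_adjoint[OF F]
      by (simp add: adj_compose adj_diff adj_scale adj_id bounded_ops_intros a projection_ops[OF F]
          self_adjoint_def compose_assoc)
    also have "\<dots> = (adj a - scale_op (cnj ?c) id_blinfun) o\<^sub>L ?F"
      by (intro blinfun_eqI) (simp add: apply_simps Fx lin projection_idem[OF F])
    finally have "norm ((adj a - scale_op (cnj ?c) id_blinfun) o\<^sub>L ?F) = norm ?T"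
      using norm_adj[of ?T] by (simp add: bounded_ops_intros a projection_ops[OF F])
    then show "norm ((adj a - scale_op (cnj ?c) id_blinfun) o\<^sub>L ?F) \<le> eps a n" using T by simp
  qed
  have "\<exists>n. eps a n \<le> e" if "e > 0" for e :: real
    using order_tendstoD(2)[OF eps_tendsto_0 that, of a] unfolding eventually_sequentially
    by (meson less_imp_le order_refl)
  then show "asymptotically_scalar a a" "asymptotically_scalar a (adj a)"
    unfolding asymptotically_scalar_def[OF a] using * order_trans by meson+
qed

lemma asymptotically_scalar_gen_cstar:
  assumes "x \<in> gen_cstar a"
  shows "asymptotically_scalar a x"
proof -
  let ?S = "{x \<in> bounded_ops. asymptotically_scalar a x \<and> asymptotically_scalar a (adj x)}"
  have idS: "asymptotically_scalar a id_blinfun"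
  proof -
    have "scale_op 1 id_blinfun = (id_blinfun :: 'h \<Rightarrow>\<^sub>L 'h)" by (intro blinfun_eqI) simp
    then show ?thesis using asymptotically_scalar_scalar[OF a, of 1] by simp
  qed
  have zeroS: "asymptotically_scalar a 0"
  proof -
    have "scale_op 0 id_blinfun = (0 :: 'h \<Rightarrow>\<^sub>L 'h)" by (intro blinfun_eqI) simp
    then show ?thesis using asymptotically_scalar_scalar[OF a, of 0] by simp
  qed
  have "closed ?S"
  proof -
    have "x \<in> ?S" if x: "x \<in> closure ?S" for x
    proof -
      have "x \<in> closure bounded_ops" using x closure_mono[of ?S bounded_ops] by blast
      then have xb: "x \<in> bounded_ops" by (simp add: closure_closed closed_bounded_ops)
      have ap: "\<exists>y\<in>?S. norm (x - y) \<le> e" if e: "e > 0" for e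
      proof -
        obtain y where "y \<in> ?S" "dist y x < e" using x e unfolding closure_approachable by blast
        then show ?thesis by (intro bexI[of _ y]) (auto simp: dist_norm norm_minus_commute)
      qed
      have "asymptotically_scalar a x"
        by (rule asymptotically_scalar_limit[OF a]) (use ap in blast)
      moreover have "asymptotically_scalar a (adj x)"
      proof (rule asymptotically_scalar_limit[OF a])
        fix e :: real assume "e > 0"
        then obtain y where y: "y \<in> ?S" "norm (x - y) \<le> e" using ap by blast
        then have "norm (adj x - adj y) \<le> e"
          using norm_adj[of "x - y"] xb by (simp add: adj_diff bounded_ops_diff)
        then show "\<exists>z. asymptotically_scalar a z \<and> norm (adj x - z) \<le> e" using y(1) by blast
      qed
      ultimately show ?thesis using xb by simp
    qed
    then show ?thesis using closure_subset_eq by blast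
  qed
  then have "cstar_subalgebra ?S"
    unfolding cstar_subalgebra_def
    by (auto simp: bounded_ops_intros adj_bounded_ops adj_add adj_compose adj_scale adj_adj adj_zero zeroS
        intro: asymptotically_scalar_add[OF a] asymptotically_scalar_compose[OF a]
          asymptotically_scalar_scale[OF a])
  then have "gen_cstar a \<subseteq> ?S"
    using asymptotically_scalar_generator a idS
    by (intro gen_cstar_subset) (simp_all add: bounded_ops_id adj_id)
  then show ?thesis using assms by blast
qed

lemma unit_vector:
  assumes "node a s \<noteq> 0"
  shows "norm (unit_vector a s) = 1" "blinfun_apply (node a s) (unit_vector a s) = unit_vector a s"
proof -
  obtain u where u: "blinfun_apply (node a s) u \<noteq> 0"
    using assms by (metis blinfun_eqI blinfun.zero_left)
  let ?w = "blinfun_apply (node a s) u"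
  have "norm (inverse (norm ?w) *\<^sub>R ?w) = 1 \<and>
      blinfun_apply (node a s) (inverse (norm ?w) *\<^sub>R ?w) = inverse (norm ?w) *\<^sub>R ?w"
    using u by (simp add: apply_simps projection_idem[OF node_projection[OF a]])
  then show "norm (unit_vector a s) = 1" "blinfun_apply (node a s) (unit_vector a s) = unit_vector a s"
    unfolding unit_vector_def by (metis (mono_tags, lifting) someI)+
qed

context
  fixes \<omega> assumes \<omega>: "\<omega> \<in> full_branches a"
begin

lemma branch_vector:
  shows "norm (unit_vector a (prefix \<omega> n)) = 1"
    and "n \<le> m \<Longrightarrow> blinfun_apply (node a (prefix \<omega> n)) (unit_vector a (prefix \<omega> m)) = unit_vector a (prefix \<omega> m)"
proof -
  have ne: "node a (prefix \<omega> n) \<noteq> 0" for n using \<omega> by (simp add: full_branches_def[OF a])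
  show "norm (unit_vector a (prefix \<omega> n)) = 1" by (rule unit_vector(1)[OF ne])
  assume "n \<le> m"
  from node_prefix(1)[OF a this, of \<omega>] unit_vector(2)[OF ne[of m]]
  show "blinfun_apply (node a (prefix \<omega> n)) (unit_vector a (prefix \<omega> m)) = unit_vector a (prefix \<omega> m)"
    by (metis compose_apply)
qed

lemma norm_scalar_on_branch:
  assumes "norm ((x - scale_op c id_blinfun) o\<^sub>L node a (prefix \<omega> n)) \<le> e" "n \<le> m"
  shows "norm (blinfun_apply (x - scale_op c id_blinfun) (unit_vector a (prefix \<omega> m))) \<le> e"
proof -
  let ?v = "unit_vector a (prefix \<omega> m)"
  have "blinfun_apply (x - scale_op c id_blinfun) ?v =
      blinfun_apply ((x - scale_op c id_blinfun) o\<^sub>L node a (prefix \<omega> n)) ?v"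
    by (simp add: branch_vector(2)[OF assms(2)])
  also have "norm \<dots> \<le> norm ((x - scale_op c id_blinfun) o\<^sub>L node a (prefix \<omega> n)) * norm ?v"
    by (rule norm_blinfun)
  finally show ?thesis using assms(1) branch_vector(1) by simp
qed

lemma branch_eval_near:
  assumes "norm ((x - scale_op c id_blinfun) o\<^sub>L node a (prefix \<omega> n)) \<le> e" "n \<le> m"
  shows "cmod (branch_eval a \<omega> x m - c) \<le> 2 * e"
proof -
  let ?v = "unit_vector a (prefix \<omega> m)"
  have "branch_eval a \<omega> x m - c = cinner (blinfun_apply (x - scale_op c id_blinfun) ?v) ?v"
    by (simp add: branch_eval_def apply_simps cinner_diff_left cinner_scaleC_left cinner_self branch_vector(1))
  also have "cmod \<dots> \<le> 2 * (norm (blinfun_apply (x - scale_op c id_blinfun) ?v) * norm ?v)"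
    by (rule norm_cinner_le)
  finally show ?thesis using norm_scalar_on_branch[OF assms] branch_vector(1) by simp
qed

lemma branch_eval_tendsto:
  assumes x: "x \<in> gen_cstar a"
  shows "branch_eval a \<omega> x \<longlonglongrightarrow> branch_state a \<omega> x"
proof -
  have "Cauchy (branch_eval a \<omega> x)"
  proof (rule CauchyI)
    fix e :: real assume "e > 0"
    then have "e / 5 > 0" by simp
    then obtain n c where c: "norm ((x - scale_op c id_blinfun) o\<^sub>L node a (prefix \<omega> n)) \<le> e / 5"
      using asymptotically_scalar_gen_cstar[OF x] unfolding asymptotically_scalar_def[OF a] by meson
    have "cmod (branch_eval a \<omega> x k - branch_eval a \<omega> x m) < e" if "n \<le> k" "n \<le> m" for k m
      using norm_triangle_ineq4[of "branch_eval a \<omega> x k - c" "branch_eval a \<omega> x m - c"]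
        branch_eval_near[OF c that(1)] branch_eval_near[OF c that(2)] \<open>e > 0\<close> by simp
    then show "\<exists>M. \<forall>k\<ge>M. \<forall>m\<ge>M. norm (branch_eval a \<omega> x k - branch_eval a \<omega> x m) < e" by blast
  qed
  then have "branch_eval a \<omega> x \<longlonglongrightarrow> lim (branch_eval a \<omega> x)"
    by (rule convergent_LIMSEQ_iff[THEN iffD1, OF Cauchy_convergent])
  then show ?thesis using x by (simp add: branch_state_def)
qed

lemma branch_state_near:
  assumes "x \<in> gen_cstar a" "norm ((x - scale_op c id_blinfun) o\<^sub>L node a (prefix \<omega> n)) \<le> e"
  shows "cmod (branch_state a \<omega> x - c) \<le> 2 * e"
proof (rule LIMSEQ_le_const2)
  show "(\<lambda>m. cmod (branch_eval a \<omega> x m - c)) \<longlonglongrightarrow> cmod (branch_state a \<omega> x - c)"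
    by (intro tendsto_intros branch_eval_tendsto assms)
  show "\<exists>N. \<forall>m\<ge>N. cmod (branch_eval a \<omega> x m - c) \<le> 2 * e"
    using branch_eval_near[OF assms(2)] by blast
qed

lemma branch_state_generator: "branch_state a \<omega> a = branch_value a \<omega>"
proof (rule LIMSEQ_unique)
  note F = node_projection[OF a] and comm = normal_node_commute[OF a normal]
  show "branch_eval a \<omega> a \<longlonglongrightarrow> branch_state a \<omega> a"
    by (rule branch_eval_tendsto[OF gen_in_gen_cstar[OF a]])
  have near: "cmod (branch_eval a \<omega> a n - branch_value a \<omega>) \<le> 6 * eps a n" for n
  proof -
    let ?F = "node a (prefix \<omega> n)" and ?c = "center a (prefix \<omega> n)"
    have Fx: "blinfun_apply ?F (blinfun_apply a x) = blinfun_apply a (blinfun_apply ?F x)" for x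
      using compose_eqD[OF comm(1)] by simp
    have "?F o\<^sub>L (a - scale_op ?c id_blinfun) o\<^sub>L ?F = (a - scale_op ?c id_blinfun) o\<^sub>L ?F"
      by (intro blinfun_eqI)
        (simp add: apply_simps Fx bounded_opsD[OF projection_ops[OF F]] projection_idem[OF F])
    then have "norm ((a - scale_op ?c id_blinfun) o\<^sub>L ?F) \<le> eps a n"
      using node_compression[OF a, of "prefix \<omega> n"] by simp
    from branch_eval_near[OF this order_refl] branch_value_near_center[of a \<omega> n]
    show ?thesis
      using norm_triangle_ineq4[of "branch_eval a \<omega> a n - ?c" "branch_value a \<omega> - ?c"] by simp
  qed
  have "(\<lambda>n. 6 * eps a n) \<longlonglongrightarrow> 0"
    using tendsto_mult[OF tendsto_const eps_tendsto_0, of 6] by simp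
  then have "(\<lambda>n. branch_eval a \<omega> a n - branch_value a \<omega>) \<longlonglongrightarrow> 0"
    by (rule Lim_null_comparison[rotated]) (simp add: near)
  then show "branch_eval a \<omega> a \<longlonglongrightarrow> branch_value a \<omega>" by (rule LIM_zero_cancel)
qed

lemma branch_state_state: "branch_state a \<omega> \<in> states (gen_cstar a)"
proof -
  note alg = cstar_subalgebra_gen_cstar[OF a] id_in_gen_cstar[OF a]
  note intros = alg_intros[OF alg]
  note lim = branch_eval_tendsto
  have add: "branch_state a \<omega> (x + y) = branch_state a \<omega> x + branch_state a \<omega> y"
    if "x \<in> gen_cstar a" "y \<in> gen_cstar a" for x y
  proof (rule LIMSEQ_unique[OF lim])
    show "x + y \<in> gen_cstar a" using that by (simp add: intros)
    have "branch_eval a \<omega> (x + y) = (\<lambda>n. branch_eval a \<omega> x n + branch_eval a \<omega> y n)"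
      by (simp add: branch_eval_def fun_eq_iff apply_simps cinner_add_left)
    then show "branch_eval a \<omega> (x + y) \<longlonglongrightarrow> branch_state a \<omega> x + branch_state a \<omega> y"
      using tendsto_add[OF lim lim] that by simp
  qed
  have scale: "branch_state a \<omega> (scale_op c x) = c * branch_state a \<omega> x"
    if "x \<in> gen_cstar a" for c x
  proof (rule LIMSEQ_unique[OF lim])
    show "scale_op c x \<in> gen_cstar a" using that by (simp add: intros)
    have "branch_eval a \<omega> (scale_op c x) = (\<lambda>n. c * branch_eval a \<omega> x n)"
      by (simp add: branch_eval_def fun_eq_iff cinner_scaleC_left)
    then show "branch_eval a \<omega> (scale_op c x) \<longlonglongrightarrow> c * branch_state a \<omega> x"
      using tendsto_mult[OF tendsto_const lim] that by simp
  qed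
  have bound: "cmod (branch_state a \<omega> x) \<le> 2 * norm x" if x: "x \<in> gen_cstar a" for x
  proof (rule LIMSEQ_le_const2[OF tendsto_norm[OF lim[OF x]]])
    have "cmod (branch_eval a \<omega> x n) \<le> 2 * norm x" for n
    proof -
      let ?v = "unit_vector a (prefix \<omega> n)"
      have "norm (blinfun_apply x ?v) \<le> norm x" using norm_blinfun[of x ?v] branch_vector(1) by simp
      then show ?thesis
        using norm_cinner_le[of "blinfun_apply x ?v" ?v] branch_vector(1)
        by (simp add: branch_eval_def)
    qed
    then show "\<exists>N. \<forall>n\<ge>N. cmod (branch_eval a \<omega> x n) \<le> 2 * norm x" by blast
  qed
  have pos: "branch_state a \<omega> (adj x o\<^sub>L x) \<in> \<real>\<^sub>\<ge>\<^sub>0" if x: "x \<in> gen_cstar a" for x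
  proof (rule closed_sequentially[OF closed_nonneg_Reals_complex _ lim])
    show "adj x o\<^sub>L x \<in> gen_cstar a" using x by (simp add: intros)
    have xb: "x \<in> bounded_ops" by (rule alg_ops[OF alg x])
    show "branch_eval a \<omega> (adj x o\<^sub>L x) n \<in> \<real>\<^sub>\<ge>\<^sub>0" for n
      using cinner_adj[OF adj_bounded_ops[OF xb]]
      by (simp add: branch_eval_def adj_adj[OF xb] cinner_self nonneg_Reals_of_real_iff)
  qed
  have one: "branch_state a \<omega> id_blinfun = 1"
  proof (rule LIMSEQ_unique[OF lim[OF alg(2)]])
    show "branch_eval a \<omega> id_blinfun \<longlonglongrightarrow> 1"
      by (simp add: branch_eval_def[abs_def] cinner_self branch_vector(1))
  qed
  have ext: "branch_state a \<omega> \<in> extensional (gen_cstar a)" by (simp add: branch_state_def)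
  show ?thesis
    unfolding states_def dual_space_def
    by (intro CollectI conjI ballI allI exI[of _ 2] ext add scale bound pos one)
qed

text \<open>
  The state \<open>\<phi>\<close> vanishes on \<open>(x - \<phi> x)\<^sup>* (x - \<phi> x)\<close>. If it is a proper convex combination of two
  states, these vanish there, too, and therefore agree with \<open>\<phi>\<close> at \<open>x\<close>.
\<close>
lemma branch_state_pure: "branch_state a \<omega> \<in> pure_states (gen_cstar a)"
proof -
  let ?A = "gen_cstar a" and ?\<phi> = "branch_state a \<omega>"
  note alg = cstar_subalgebra_gen_cstar[OF a] id_in_gen_cstar[OF a]
  note intros = alg_intros[OF alg]
  have null: "?\<phi> (adj (x - scale_op (?\<phi> x) id_blinfun) o\<^sub>L (x - scale_op (?\<phi> x) id_blinfun)) = 0"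
    if x: "x \<in> ?A" for x
  proof -
    let ?y = "x - scale_op (?\<phi> x) id_blinfun"
    have y: "?y \<in> ?A" using x by (simp add: intros)
    have yb: "?y \<in> bounded_ops" by (rule alg_ops[OF alg y])
    have eval: "branch_eval a \<omega> (adj ?y o\<^sub>L ?y) =
        (\<lambda>n. complex_of_real ((norm (blinfun_apply ?y (unit_vector a (prefix \<omega> n))))\<^sup>2))"
      using cinner_adj[OF adj_bounded_ops[OF yb]]
      by (simp add: branch_eval_def fun_eq_iff adj_adj[OF yb] cinner_self)
    have "(\<lambda>n. norm (blinfun_apply ?y (unit_vector a (prefix \<omega> n)))) \<longlonglongrightarrow> 0"
    proof (rule LIMSEQ_I)
      fix e :: real assume "e > 0"
      then have "e / 4 > 0" by simp
      then obtain n c where c: "norm ((x - scale_op c id_blinfun) o\<^sub>L node a (prefix \<omega> n)) \<le> e / 4"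
        using asymptotically_scalar_gen_cstar[OF x] unfolding asymptotically_scalar_def[OF a] by meson
      have "norm (blinfun_apply ?y (unit_vector a (prefix \<omega> m))) < e" if "n \<le> m" for m
      proof -
        let ?v = "unit_vector a (prefix \<omega> m)"
        have "blinfun_apply ?y ?v = blinfun_apply (x - scale_op c id_blinfun) ?v - (?\<phi> x - c) *\<^sub>C ?v"
          by (simp add: apply_simps scaleC_diff_left)
        also have "norm \<dots> \<le> e / 4 + cmod (?\<phi> x - c) * norm ?v"
          unfolding norm_scaleC[symmetric]
          by (intro order_trans[OF norm_triangle_ineq4] add_mono norm_scalar_on_branch[OF c that] order_refl)
        also have "\<dots> \<le> e / 4 + 2 * (e / 4)"
          using branch_state_near[OF x c] by (simp add: branch_vector(1))
        finally show ?thesis using \<open>e > 0\<close> by simp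
      qed
      then show "\<exists>no. \<forall>m\<ge>no. norm (norm (blinfun_apply ?y (unit_vector a (prefix \<omega> m))) - 0) < e" by auto
    qed
    then have "(\<lambda>n. complex_of_real ((norm (blinfun_apply ?y (unit_vector a (prefix \<omega> n))))\<^sup>2)) \<longlonglongrightarrow>
        complex_of_real (0\<^sup>2)"
      by (intro tendsto_intros)
    then have "branch_eval a \<omega> (adj ?y o\<^sub>L ?y) \<longlonglongrightarrow> 0" by (simp add: eval)
    moreover have "branch_eval a \<omega> (adj ?y o\<^sub>L ?y) \<longlonglongrightarrow> ?\<phi> (adj ?y o\<^sub>L ?y)"
      using y by (intro branch_eval_tendsto) (simp add: intros)
    ultimately show ?thesis using LIMSEQ_unique by blast
  qed
  have agree: "\<psi> = ?\<phi>"
    if \<psi>: "\<psi> \<in> states ?A" and le: "\<And>y. y \<in> ?A \<Longrightarrow> ?\<phi> (adj y o\<^sub>L y) = 0 \<Longrightarrow> \<psi> (adj y o\<^sub>L y) = 0" for \<psi>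
  proof (rule extensionalityI)
    show "\<psi> \<in> extensional ?A" "?\<phi> \<in> extensional ?A"
      using \<psi> branch_state_state by (simp_all add: states_def dual_space_def)
    fix x assume x: "x \<in> ?A"
    let ?y = "x - scale_op (?\<phi> x) id_blinfun"
    have y: "?y \<in> ?A" using x by (simp add: intros)
    have "\<psi> ?y = 0" by (rule state_null[OF alg \<psi> y le[OF y null[OF x]]])
    moreover have "\<psi> ?y = \<psi> x - ?\<phi> x"
      using x by (simp add: state_diff[OF alg \<psi>] state_scale[OF alg \<psi>] state_one[OF alg \<psi>] intros)
    ultimately show "\<psi> x = ?\<phi> x" by simp
  qed
  show ?thesis
    unfolding pure_states_def
  proof (intro CollectI conjI ballI allI impI)
    show "?\<phi> \<in> states ?A" by (rule branch_state_state)
    fix \<psi> \<eta> and t :: real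
    assume \<psi>: "\<psi> \<in> states ?A" and \<eta>: "\<eta> \<in> states ?A" and t: "0 < t \<and> t < 1 \<and>
      (\<forall>x\<in>?A. ?\<phi> x = of_real (1 - t) * \<psi> x + of_real t * \<eta> x)"
    have both: "\<psi> (adj y o\<^sub>L y) = 0 \<and> \<eta> (adj y o\<^sub>L y) = 0"
      if y: "y \<in> ?A" and 0: "?\<phi> (adj y o\<^sub>L y) = 0" for y
    proof -
      let ?p = "\<psi> (adj y o\<^sub>L y)" and ?q = "\<eta> (adj y o\<^sub>L y)"
      have pq: "?p \<in> \<real>\<^sub>\<ge>\<^sub>0" "?q \<in> \<real>\<^sub>\<ge>\<^sub>0"
        using state_pos[OF alg \<psi> y] state_pos[OF alg \<eta> y] .
      have "of_real (1 - t) * ?p + of_real t * ?q = 0"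
        using t 0 y by (metis alg_adj[OF alg] alg_compose[OF alg])
      then have "(1 - t) * Re ?p + t * Re ?q = 0" by (metis Re_complex_of_real plus_complex.sel(1)
            mult.commute scaleR_conv_of_real scaleR_complex.sel(1) zero_complex.sel(1))
      moreover have "0 \<le> (1 - t) * Re ?p" "0 \<le> t * Re ?q"
        using t pq by (auto simp: complex_nonneg_Reals_iff)
      ultimately have "(1 - t) * Re ?p = 0" "t * Re ?q = 0" by linarith+
      then have "Re ?p = 0" "Re ?q = 0" using t by auto
      then show ?thesis using pq by (simp add: complex_nonneg_Reals_iff complex_eq_iff)
    qed
    show "\<psi> = ?\<phi>" "\<eta> = ?\<phi>" using both by (intro agree \<psi> \<eta>; blast)+
  qed
qed

end

lemma branch_state_locally_constant:
  assumes x: "x \<in> gen_cstar a" and e: "e > 0"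
  obtains n where "\<And>\<omega> \<omega>'. \<omega> \<in> full_branches a \<Longrightarrow> \<omega>' \<in> full_branches a \<Longrightarrow> prefix \<omega>' n = prefix \<omega> n \<Longrightarrow>
    cmod (branch_state a \<omega>' x - branch_state a \<omega> x) < e"
proof -
  have "e / 5 > 0" using e by simp
  then obtain n where n: "\<And>\<omega>. \<exists>c. norm ((x - scale_op c id_blinfun) o\<^sub>L node a (prefix \<omega> n)) \<le> e / 5"
    using asymptotically_scalar_gen_cstar[OF x] unfolding asymptotically_scalar_def[OF a] by meson
  have "cmod (branch_state a \<omega>' x - branch_state a \<omega> x) < e"
    if \<omega>: "\<omega> \<in> full_branches a" "\<omega>' \<in> full_branches a" "prefix \<omega>' n = prefix \<omega> n" for \<omega> \<omega>'
  proof -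
    obtain c where c: "norm ((x - scale_op c id_blinfun) o\<^sub>L node a (prefix \<omega> n)) \<le> e / 5" using n by blast
    then have c': "norm ((x - scale_op c id_blinfun) o\<^sub>L node a (prefix \<omega>' n)) \<le> e / 5" by (simp add: \<omega>(3))
    show ?thesis
      using branch_state_near[OF \<omega>(1) x c] branch_state_near[OF \<omega>(2) x c'] e
        norm_triangle_ineq4[of "branch_state a \<omega>' x - c" "branch_state a \<omega> x - c"] by simp
  qed
  then show ?thesis by (rule that)
qed

lemma branch_state_preimage_sets:
  assumes W: "openin (product_topology (\<lambda>_. euclidean) (gen_cstar a)) W"
  shows "{\<omega> \<in> full_branches a. branch_state a \<omega> \<in> W} \<in> sets branches"
proof -
  let ?A = "gen_cstar a"
  define G where "G = {\<omega> \<in> full_branches a. branch_state a \<omega> \<in> W}"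
  define S where "S = {s. full_branches a \<inter> cylinder s \<subseteq> G}"
  have "\<exists>s\<in>S. \<omega> \<in> cylinder s" if "\<omega> \<in> G" for \<omega>
  proof -
    have \<omega>: "\<omega> \<in> full_branches a" "branch_state a \<omega> \<in> W" using that by (auto simp: G_def)
    obtain U where U: "finite {x \<in> ?A. U x \<noteq> (UNIV :: complex set)}" "\<And>x. x \<in> ?A \<Longrightarrow> open (U x)"
        "branch_state a \<omega> \<in> Pi\<^sub>E ?A U" "Pi\<^sub>E ?A U \<subseteq> W"
      using W \<omega>(2) unfolding openin_product_topology_alt by (fastforce simp: Ball_def)
    have "\<exists>n. \<forall>\<omega>'\<in>full_branches a. prefix \<omega>' n = prefix \<omega> n \<longrightarrow> branch_state a \<omega>' x \<in> U x"
      if x: "x \<in> ?A" for x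
    proof -
      have "branch_state a \<omega> x \<in> U x" using U(3) x by (auto simp: PiE_def)
      then obtain e where e: "e > 0" "ball (branch_state a \<omega> x) e \<subseteq> U x"
        using U(2)[OF x] open_contains_ball by blast
      obtain n where n: "\<And>\<omega> \<omega>'. \<omega> \<in> full_branches a \<Longrightarrow> \<omega>' \<in> full_branches a \<Longrightarrow>
          prefix \<omega>' n = prefix \<omega> n \<Longrightarrow> cmod (branch_state a \<omega>' x - branch_state a \<omega> x) < e"
        using branch_state_locally_constant[OF x e(1)] by blast
      show ?thesis
        using n[OF \<omega>(1)] e(2) by (intro exI[of _ n]) (auto simp: dist_norm norm_minus_commute)
    qed
    then obtain n where n: "\<And>x \<omega>'. x \<in> ?A \<Longrightarrow> \<omega>' \<in> full_branches a \<Longrightarrow>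
        prefix \<omega>' (n x) = prefix \<omega> (n x) \<Longrightarrow> branch_state a \<omega>' x \<in> U x"
      by metis
    \<comment> \<open>A basic open set restricts only finitely many coordinates.\<close>
    define N where "N = Max (insert 0 (n ` {x \<in> ?A. U x \<noteq> UNIV}))"
    have "branch_state a \<omega>' \<in> W" if \<omega>': "\<omega>' \<in> full_branches a" "\<omega>' \<in> cylinder (prefix \<omega> N)" for \<omega>'
    proof -
      have "branch_state a \<omega>' x \<in> U x" if x: "x \<in> ?A" for x
      proof (cases "U x = UNIV")
        case False
        then have "n x \<le> N" using U(1) x unfolding N_def by (intro Max_ge) auto
        moreover have "prefix \<omega>' N = prefix \<omega> N" using \<omega>'(2) by (simp add: cylinder_def)
        ultimately show ?thesis using n[OF x \<omega>'(1)] prefix_eq_mono by blast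
      qed simp
      then have "branch_state a \<omega>' \<in> Pi\<^sub>E ?A U" by (auto simp: PiE_def branch_state_def)
      then show ?thesis using U(4) by blast
    qed
    then have "prefix \<omega> N \<in> S" by (auto simp: S_def G_def)
    then show ?thesis using mem_cylinder_prefix by blast
  qed
  then have "G = full_branches a \<inter> (\<Union>s\<in>S. cylinder s)" by (auto simp: S_def G_def)
  then show ?thesis
    unfolding G_def[symmetric]
    by (simp only:) (intro sets.Int full_branches_sets[OF a] sets.countable_UN'' cylinder_sets, auto)
qed

lemma spectral_decompositions_of_normal:
  assumes nontrivial: "(id_blinfun :: 'h \<Rightarrow>\<^sub>L 'h) \<noteq> 0"
  shows "spectral_decompositions a"
proof -
  let ?A = "gen_cstar a"
  note alg = cstar_subalgebra_gen_cstar[OF a] id_in_gen_cstar[OF a]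
  have "full_branches a \<noteq> {}"
    using branch_op_null[OF a UNIV_sets_branches] branch_op_UNIV[OF a] nontrivial by auto
  then obtain \<omega>\<^sub>0 where \<omega>\<^sub>0: "\<omega>\<^sub>0 \<in> full_branches a" by blast
  define \<Gamma> where "\<Gamma> \<omega> = r_map a (branch_state a (if \<omega> \<in> full_branches a then \<omega> else \<omega>\<^sub>0))" for \<omega>
  have P: "branch_state a \<omega> \<in> P_space ?A" if "\<omega> \<in> full_branches a" for \<omega>
    using branch_state_pure[OF that] pure_states_subset_P_space[OF alg] by blast
  have \<Gamma>: "\<Gamma> \<omega> \<in> topspace (Y_space a)" for \<omega>
    unfolding \<Gamma>_def topspace_Y_space using P \<omega>\<^sub>0 by auto
  have meas: "\<Gamma> -` U \<in> sets branches" if U: "openin (Y_space a) U" for U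
  proof -
    obtain W where W: "openin (product_topology (\<lambda>_. euclidean) ?A) W"
        "{\<alpha> \<in> P_space ?A. r_map a \<alpha> \<in> U} = W \<inter> P_space ?A"
      using U unfolding openin_Y_space openin_P_space by blast
    have iff: "r_map a (branch_state a \<omega>) \<in> U \<longleftrightarrow> branch_state a \<omega> \<in> W" if "\<omega> \<in> full_branches a" for \<omega>
      using W(2) P[OF that] by blast
    have "\<Gamma> -` U = {\<omega> \<in> full_branches a. branch_state a \<omega> \<in> W} \<union>
        (if branch_state a \<omega>\<^sub>0 \<in> W then UNIV - full_branches a else {})"
      using iff \<omega>\<^sub>0 by (auto simp: \<Gamma>_def split: if_splits)
    then show ?thesis
      using branch_state_preimage_sets[OF W(1)] full_branches_sets[OF a] UNIV_sets_branches by auto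
  qed
  show ?thesis
  proof (rule spectral_decompositions_normal[OF a \<Gamma> meas normal])
    fix \<omega> assume \<omega>: "\<omega> \<in> full_branches a"
    then show "z_map a (\<Gamma> \<omega>) = branch_value a \<omega>"
      using z_map_r_map[OF P[OF \<omega>]] branch_state_generator[OF \<omega>] by (simp add: \<Gamma>_def tau_def)
  qed
qed

end

section \<open>A path of pure states\<close>

lemma scaleC_imaginary_twice:
  "(\<i> * complex_of_real t) *\<^sub>C (\<i> * complex_of_real t) *\<^sub>C x = - (t\<^sup>2 *\<^sub>R x)"
  for x :: "'h::complex_hilbert"
proof -
  have "(\<i> * complex_of_real t) * (\<i> * complex_of_real t) = complex_of_real (- t\<^sup>2)"
    by (simp add: complex_eq_iff power2_eq_square)
  then show ?thesis by (simp only: scaleC_scaleC scaleC_of_real) simp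
qed

lemma continuous_on_state:
  fixes V :: "'t::metric_space \<Rightarrow> 'h::complex_hilbert \<Rightarrow>\<^sub>L 'h"
  assumes alg: "cstar_subalgebra A" "id_blinfun \<in> A" and \<alpha>: "\<alpha> \<in> states A"
    and V: "continuous_on S V" "\<And>t. t \<in> S \<Longrightarrow> V t \<in> A"
  shows "continuous_on S (\<lambda>t. \<alpha> (V t))"
  unfolding continuous_on_iff
proof (intro ballI allI impI)
  fix t :: 't and e :: real assume t: "t \<in> S" and e: "e > 0"
  then obtain d where d: "d > 0" "\<And>s. s \<in> S \<Longrightarrow> dist s t < d \<Longrightarrow> dist (V s) (V t) < e / 2"
    using V(1) unfolding continuous_on_iff by (metis half_gt_zero)
  have "dist (\<alpha> (V s)) (\<alpha> (V t)) < e" if s: "s \<in> S" "dist s t < d" for s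
  proof -
    have "dist (\<alpha> (V s)) (\<alpha> (V t)) = cmod (\<alpha> (V s - V t))"
      using V(2) s t by (simp add: dist_norm state_diff[OF alg \<alpha>])
    also have "\<dots> \<le> 2 * norm (V s - V t)"
      using V(2) s t by (intro state_norm_le[OF alg \<alpha>] alg_diff[OF alg])
    also have "\<dots> < e" using d(2)[OF s] by (simp add: dist_norm)
    finally show ?thesis .
  qed
  then show "\<exists>d>0. \<forall>s\<in>S. dist s t < d \<longrightarrow> dist (\<alpha> (V s)) (\<alpha> (V t)) < e" using d(1) by blast
qed

definition conjugate_state ::
    "('h::complex_hilbert \<Rightarrow>\<^sub>L 'h) set \<Rightarrow> ('h \<Rightarrow>\<^sub>L 'h) \<Rightarrow> (('h \<Rightarrow>\<^sub>L 'h) \<Rightarrow> complex) \<Rightarrow> ('h \<Rightarrow>\<^sub>L 'h) \<Rightarrow> complex"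
  where "conjugate_state A u \<alpha> = restrict (\<lambda>x. \<alpha> (adj u o\<^sub>L x o\<^sub>L u)) A"

context
  fixes A :: "('h::complex_hilbert \<Rightarrow>\<^sub>L 'h) set"
  assumes alg: "cstar_subalgebra A" "id_blinfun \<in> A"
begin

lemma conjugate_state_states:
  assumes \<alpha>: "\<alpha> \<in> states A" and u: "u \<in> A" "adj u o\<^sub>L u = id_blinfun"
  shows "conjugate_state A u \<alpha> \<in> states A"
proof -
  note intros = alg_intros[OF alg]
  have mem: "adj u o\<^sub>L x o\<^sub>L u \<in> A" if "x \<in> A" for x using that u by (simp add: intros)
  have add: "conjugate_state A u \<alpha> (x + y) = conjugate_state A u \<alpha> x + conjugate_state A u \<alpha> y"
    if "x \<in> A" "y \<in> A" for x y
  proof -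
    have "adj u o\<^sub>L (x + y) o\<^sub>L u = (adj u o\<^sub>L x o\<^sub>L u) + (adj u o\<^sub>L y o\<^sub>L u)"
      by (intro blinfun_eqI) (simp add: apply_simps)
    then show ?thesis
      using that by (simp add: conjugate_state_def intros state_add[OF alg \<alpha>] mem)
  qed
  have scale: "conjugate_state A u \<alpha> (scale_op c x) = c * conjugate_state A u \<alpha> x" if x: "x \<in> A" for c x
  proof -
    have "adj u o\<^sub>L scale_op c x o\<^sub>L u = scale_op c (adj u o\<^sub>L x o\<^sub>L u)"
      using bounded_opsD[OF adj_bounded_ops[OF alg_ops[OF alg u(1)]]] by (intro blinfun_eqI) simp
    then show ?thesis
      using x by (simp add: conjugate_state_def intros state_scale[OF alg \<alpha>] mem)
  qed
  have bound: "cmod (conjugate_state A u \<alpha> x) \<le> (2 * norm (adj u) * norm u) * norm x" if x: "x \<in> A" for x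
  proof -
    have "cmod (conjugate_state A u \<alpha> x) \<le> 2 * norm (adj u o\<^sub>L x o\<^sub>L u)"
      using x state_norm_le[OF alg \<alpha> mem[OF x]] by (simp add: conjugate_state_def)
    also have "\<dots> \<le> 2 * (norm (adj u) * norm x * norm u)"
      by (intro mult_left_mono norm_compose_mono order_refl) simp
    finally show ?thesis by (simp add: mult_ac)
  qed
  have pos: "conjugate_state A u \<alpha> (adj x o\<^sub>L x) \<in> \<real>\<^sub>\<ge>\<^sub>0" if x: "x \<in> A" for x
  proof -
    have "adj u o\<^sub>L (adj x o\<^sub>L x) o\<^sub>L u = adj (x o\<^sub>L u) o\<^sub>L (x o\<^sub>L u)"
      using alg_ops[OF alg] x u(1) by (simp add: adj_compose compose_assoc)
    then show ?thesis
      using x u(1) state_pos[OF alg \<alpha>, of "x o\<^sub>L u"] by (simp add: conjugate_state_def intros)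
  qed
  have one: "conjugate_state A u \<alpha> id_blinfun = 1"
  proof -
    have "adj u o\<^sub>L id_blinfun o\<^sub>L u = id_blinfun"
      using u(2) by (metis blinfun_eqI compose_apply id_blinfun.rep_eq id_apply)
    then show ?thesis by (simp add: conjugate_state_def alg(2) state_one[OF alg \<alpha>])
  qed
  have ext: "conjugate_state A u \<alpha> \<in> extensional A" by (simp add: conjugate_state_def)
  show ?thesis
    unfolding states_def dual_space_def
    by (intro CollectI conjI ballI allI exI[of _ "2 * norm (adj u) * norm u"] ext add scale bound pos one)
qed

text \<open>
  Conjugation by \<open>u\<close> is an affine bijection of the state space, with conjugation by \<open>u\<^sup>*\<close> as its
  inverse.
\<close>
lemma conjugate_state_pure:
  assumes \<alpha>: "\<alpha> \<in> pure_states A" and u: "u \<in> A" "adj u o\<^sub>L u = id_blinfun" "u o\<^sub>L adj u = id_blinfun"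
  shows "conjugate_state A u \<alpha> \<in> pure_states A"
proof -
  note intros = alg_intros[OF alg]
  have \<alpha>s: "\<alpha> \<in> states A" using \<alpha> by (simp add: pure_states_def)
  have ub: "u \<in> bounded_ops" by (rule alg_ops[OF alg u(1)])
  have uu: "blinfun_apply (adj u) (blinfun_apply u x) = x" "blinfun_apply u (blinfun_apply (adj u) x) = x" for x
    using arg_cong[OF u(2), of "\<lambda>f. blinfun_apply f x"] arg_cong[OF u(3), of "\<lambda>f. blinfun_apply f x"]
    by simp_all
  have agree: "\<psi> = conjugate_state A u \<alpha>"
    if \<psi>: "\<psi> \<in> states A" and eq: "conjugate_state A (adj u) \<psi> = \<alpha>" for \<psi>
  proof (rule extensionalityI)
    show "\<psi> \<in> extensional A" "conjugate_state A u \<alpha> \<in> extensional A"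
      using \<psi> by (simp_all add: states_def dual_space_def conjugate_state_def)
    fix x assume x: "x \<in> A"
    then have "adj u o\<^sub>L x o\<^sub>L u \<in> A" using u(1) by (simp add: intros)
    moreover have "adj (adj u) o\<^sub>L (adj u o\<^sub>L x o\<^sub>L u) o\<^sub>L adj u = x"
      by (intro blinfun_eqI) (simp add: adj_adj[OF ub] uu)
    ultimately show "\<psi> x = conjugate_state A u \<alpha> x"
      using x by (simp add: eq[symmetric] conjugate_state_def)
  qed
  show ?thesis
    unfolding pure_states_def
  proof (intro CollectI conjI ballI allI impI)
    show "conjugate_state A u \<alpha> \<in> states A" by (rule conjugate_state_states[OF \<alpha>s u(1,2)])
    fix \<psi> \<eta> and t :: real
    assume \<psi>: "\<psi> \<in> states A" and \<eta>: "\<eta> \<in> states A" and t: "0 < t \<and> t < 1 \<and>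
      (\<forall>x\<in>A. conjugate_state A u \<alpha> x = of_real (1 - t) * \<psi> x + of_real t * \<eta> x)"
    have st: "conjugate_state A (adj u) \<psi> \<in> states A" "conjugate_state A (adj u) \<eta> \<in> states A"
      using u by (auto intro!: conjugate_state_states \<psi> \<eta> simp: intros adj_adj[OF ub])
    have "\<alpha> x = of_real (1 - t) * conjugate_state A (adj u) \<psi> x + of_real t * conjugate_state A (adj u) \<eta> x"
      if x: "x \<in> A" for x
    proof -
      have "adj (adj u) o\<^sub>L x o\<^sub>L adj u \<in> A" using x u(1) by (simp add: intros)
      moreover have "adj u o\<^sub>L (adj (adj u) o\<^sub>L x o\<^sub>L adj u) o\<^sub>L u = x"
        by (intro blinfun_eqI) (simp add: adj_adj[OF ub] uu)
      ultimately show ?thesis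
        using t x by (force simp: conjugate_state_def)
    qed
    then have "conjugate_state A (adj u) \<psi> = \<alpha> \<and> conjugate_state A (adj u) \<eta> = \<alpha>"
      using \<alpha> st t unfolding pure_states_def by blast
    then show "\<psi> = conjugate_state A u \<alpha>" "\<eta> = conjugate_state A u \<alpha>"
      using agree \<psi> \<eta> by blast+
  qed
qed

text \<open>
  The path is \<open>u t = sqrt (1 - t\<^sup>2 h\<^sup>2) + i t h\<close>, with the square root written as \<open>1 - y t\<close>. For
  \<open>t \<le> 1/2\<close> the equation for \<open>y t\<close> is a contraction on the ball of radius \<open>1/2\<close>, which gives both the
  continuity in \<open>t\<close> and the bound that leaves \<open>i t h\<close> as the linear term of \<open>u t - 1\<close> at \<open>t = 0\<close>.
\<close>
lemma unitary_path:
  assumes h: "h \<in> A" "self_adjoint h" "norm h \<le> 1"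
  obtains y u :: "real \<Rightarrow> 'h \<Rightarrow>\<^sub>L 'h" where
    "\<forall>t\<in>{0..1/2}. u t = id_blinfun - y t + scale_op (\<i> * complex_of_real t) h \<and>
      adj (u t) = id_blinfun - y t - scale_op (\<i> * complex_of_real t) h \<and> norm (y t) \<le> t\<^sup>2"
    "\<forall>t\<in>{0..1/2}. u t \<in> A \<and> adj (u t) o\<^sub>L u t = id_blinfun \<and> u t o\<^sub>L adj (u t) = id_blinfun"
    "continuous_on {0..1/2} u" "continuous_on {0..1/2} (\<lambda>t. adj (u t))"
proof -
  note intros = alg_intros[OF alg]
  define X where "X t = t\<^sup>2 *\<^sub>R (h o\<^sub>L h)" for t :: real
  have nhh: "norm (h o\<^sub>L h) \<le> 1"
    using norm_compose_mono[OF h(3) h(3)] by simp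
  have nX: "norm (X t) \<le> t\<^sup>2" for t
    unfolding X_def using mult_left_mono[OF nhh, of "t\<^sup>2"] by simp
  have t2: "t\<^sup>2 \<le> 1/4" if "t \<in> {0..1/2}" for t :: real
    using power_mono[of t "1/2" 2] that by (simp add: power2_eq_square)
  have Xsa: "self_adjoint (X t)" for t
    unfolding X_def by (intro self_adjoint_scaleR self_adjoint_square h)
  have "\<exists>y. y = (1/2) *\<^sub>R (X t + (y o\<^sub>L y)) \<and> norm y \<le> 1/2 \<and> y \<in> A \<and> self_adjoint y \<and> h o\<^sub>L y = y o\<^sub>L h"
    if t: "t \<in> {0..1/2}" for t
  proof -
    have "norm (X t) \<le> 1" using nX[of t] t2[OF t] by linarith
    then obtain y where y: "y = (1/2) *\<^sub>R (X t + (y o\<^sub>L y))" "norm y \<le> 1" and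
      inv: "\<And>S. closed S \<Longrightarrow> 0 \<in> S \<Longrightarrow> (\<And>z. z \<in> S \<Longrightarrow> (1/2) *\<^sub>R (X t + (z o\<^sub>L z)) \<in> S) \<Longrightarrow> y \<in> S"
      using sqrt_iter_limit by blast
    have "y \<in> cball 0 (1/2)"
    proof (rule inv)
      fix z :: "'h \<Rightarrow>\<^sub>L 'h" assume "z \<in> cball 0 (1/2)"
      then have "norm (X t + (z o\<^sub>L z)) \<le> 1/4 + 1/2 * (1/2)"
        using nX[of t] t2[OF t] by (intro norm_triangle_le add_mono norm_compose_mono) auto
      then show "(1/2) *\<^sub>R (X t + (z o\<^sub>L z)) \<in> cball 0 (1/2)" by simp
    qed auto
    moreover have "y \<in> A"
      by (rule inv[OF alg_closed[OF alg]]) (auto simp: intros X_def h)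
    moreover have "y \<in> {T. self_adjoint T}"
      by (rule inv[OF closed_self_adjoint])
        (simp_all add: self_adjoint_zero self_adjoint_scaleR self_adjoint_add self_adjoint_square Xsa)
    moreover have "y \<in> {z. h o\<^sub>L z = z o\<^sub>L h}"
    proof (rule inv[OF closed_commutant])
      fix z assume "z \<in> {z. h o\<^sub>L z = z o\<^sub>L h}"
      then have "h o\<^sub>L z = z o\<^sub>L h" by simp
      note compose_eqD[OF this]
      then show "(1/2) *\<^sub>R (X t + (z o\<^sub>L z)) \<in> {z. h o\<^sub>L z = z o\<^sub>L h}"
        by (auto intro!: blinfun_eqI simp: X_def apply_simps)
    qed (auto intro!: blinfun_eqI)
    ultimately show ?thesis using y(1) by (intro exI[of _ y]) simp
  qed
  then obtain y where y: "\<And>t. t \<in> {0..1/2} \<Longrightarrow> y t = (1/2) *\<^sub>R (X t + (y t o\<^sub>L y t))"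
      "\<And>t. t \<in> {0..1/2} \<Longrightarrow> norm (y t) \<le> 1/2" "\<And>t. t \<in> {0..1/2} \<Longrightarrow> y t \<in> A"
      "\<And>t. t \<in> {0..1/2} \<Longrightarrow> self_adjoint (y t)" "\<And>t. t \<in> {0..1/2} \<Longrightarrow> h o\<^sub>L y t = y t o\<^sub>L h"
    by metis
  define u where "u t = id_blinfun - y t + scale_op (\<i> * complex_of_real t) h" for t
  have hb: "h \<in> bounded_ops" by (rule self_adjoint_ops[OF h(2)])
  have adj_u: "adj (u t) = id_blinfun - y t - scale_op (\<i> * complex_of_real t) h" if t: "t \<in> {0..1/2}" for t
  proof -
    have yb: "y t \<in> bounded_ops" by (rule self_adjoint_ops[OF y(4)[OF t]])
    have "adj (u t) = id_blinfun - y t + scale_op (cnj (\<i> * complex_of_real t)) h"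
      unfolding u_def using y(4)[OF t] h(2) hb yb
      by (simp add: adj_add adj_diff adj_scale adj_id bounded_ops_intros self_adjoint_def)
    also have "\<dots> = id_blinfun - y t - scale_op (\<i> * complex_of_real t) h"
      by (intro blinfun_eqI) (simp add: apply_simps scaleC_minus_left)
    finally show ?thesis .
  qed
  have small: "norm (y t) \<le> t\<^sup>2" if t: "t \<in> {0..1/2}" for t
  proof -
    have "norm (y t) = norm ((1/2) *\<^sub>R (X t + (y t o\<^sub>L y t)))" using y(1)[OF t] by simp
    also have "\<dots> = (1/2) * norm (X t + (y t o\<^sub>L y t))" by simp
    also have "\<dots> \<le> (1/2) * (t\<^sup>2 + 1/2 * norm (y t))"
      using y(2)[OF t] nX[of t] by (intro mult_left_mono norm_triangle_le add_mono norm_compose_mono) auto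
    finally have "norm (y t) * 3 \<le> t\<^sup>2 * 2" by (simp add: field_simps)
    then show ?thesis using zero_le_power2[of t] by linarith
  qed
  have uA: "u t \<in> A" if t: "t \<in> {0..1/2}" for t
    unfolding u_def using y(3)[OF t] h(1) by (simp add: intros)
  have unit: "adj (u t) o\<^sub>L u t = id_blinfun \<and> u t o\<^sub>L adj (u t) = id_blinfun" if t: "t \<in> {0..1/2}" for t
  proof -
    have hy: "blinfun_apply h (blinfun_apply (y t) x) = blinfun_apply (y t) (blinfun_apply h x)" for x
      by (rule compose_eqD[OF y(5)[OF t]])
    have y2: "2 *\<^sub>R y t = X t + (y t o\<^sub>L y t)"
      using arg_cong[OF y(1)[OF t], of "\<lambda>z. 2 *\<^sub>R z"] by simp
    have yy: "blinfun_apply (y t) (blinfun_apply (y t) x) =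
        blinfun_apply (y t) x + blinfun_apply (y t) x - t\<^sup>2 *\<^sub>R blinfun_apply h (blinfun_apply h x)" for x
      using arg_cong[OF y2, of "\<lambda>f. blinfun_apply f x"]
      by (simp add: X_def apply_simps scaleR_2 algebra_simps)
    note lin = bounded_opsD[OF hb] bounded_opsD[OF self_adjoint_ops[OF y(4)[OF t]]]
    note sq = scaleC_imaginary_twice[of t]
    show ?thesis
      unfolding adj_u[OF t] unfolding u_def
      by (intro conjI blinfun_eqI)
        (simp_all add: apply_simps lin hy yy scaleC_add_right scaleC_diff_right sq algebra_simps)
  qed
  have lip: "norm (y t - y s) \<le> \<bar>t - s\<bar>" if t: "t \<in> {0..1/2}" and s: "s \<in> {0..1/2}" for t s
  proof -
    have "y t - y s = (1/2) *\<^sub>R (X t + (y t o\<^sub>L y t)) - (1/2) *\<^sub>R (X s + (y s o\<^sub>L y s))"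
      using y(1)[OF t] y(1)[OF s] by simp
    also have "\<dots> = (1/2) *\<^sub>R ((X t - X s) + ((y t o\<^sub>L (y t - y s)) + ((y t - y s) o\<^sub>L y s)))"
      by (rule blinfun_eqI) (simp add: apply_simps algebra_simps)
    finally have "norm (y t - y s) = (1/2) * norm ((X t - X s) + ((y t o\<^sub>L (y t - y s)) + ((y t - y s) o\<^sub>L y s)))"
      by (metis norm_scaleR abs_of_nonneg zero_le_divide_1_iff zero_le_numeral)
    also have "\<dots> \<le> (1/2) * (\<bar>t\<^sup>2 - s\<^sup>2\<bar> + (1/2 * norm (y t - y s) + norm (y t - y s) * (1/2)))"
    proof (intro mult_left_mono norm_triangle_le add_mono norm_compose_mono order_refl y(2) t s)
      have "X t - X s = (t\<^sup>2 - s\<^sup>2) *\<^sub>R (h o\<^sub>L h)" by (simp add: X_def scaleR_diff_left)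
      then show "norm (X t - X s) \<le> \<bar>t\<^sup>2 - s\<^sup>2\<bar>"
        using mult_left_mono[OF nhh, of "\<bar>t\<^sup>2 - s\<^sup>2\<bar>"] by simp
    qed simp
    finally have "norm (y t - y s) \<le> \<bar>t\<^sup>2 - s\<^sup>2\<bar>" by simp
    also have "\<dots> = \<bar>t - s\<bar> * \<bar>t + s\<bar>" by (simp add: power2_eq_square algebra_simps flip: abs_mult)
    also have "\<dots> \<le> \<bar>t - s\<bar> * 1" using t s by (intro mult_left_mono) auto
    finally show ?thesis by simp
  qed
  have cont_y: "continuous_on {0..1/2} y"
    unfolding continuous_on_iff
  proof (intro ballI allI impI)
    fix t e :: real assume t: "t \<in> {0..1/2}" and e: "e > 0"
    have "dist (y s) (y t) < e" if "s \<in> {0..1/2}" "dist s t < e" for s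
      using lip[OF that(1) t] that(2) by (simp add: dist_norm)
    then show "\<exists>d>0. \<forall>s\<in>{0..1/2}. dist s t < d \<longrightarrow> dist (y s) (y t) < e" using e by blast
  qed
  have scale_eq: "scale_op (\<i> * complex_of_real t) h = t *\<^sub>R scale_op \<i> h" for t
    by (intro blinfun_eqI) (simp add: apply_simps scaleR_scaleC scaleC_scaleC mult.commute)
  have "continuous_on {0..1/2} u"
    unfolding u_def[abs_def] scale_eq by (intro continuous_intros cont_y)
  moreover have "continuous_on {0..1/2} (\<lambda>t. id_blinfun - y t - scale_op (\<i> * complex_of_real t) h)"
    unfolding scale_eq by (intro continuous_intros cont_y)
  then have "continuous_on {0..1/2} (\<lambda>t. adj (u t))"
    by (rule continuous_on_eq) (simp add: adj_u)
  ultimately show ?thesis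
    using that[of u y] u_def adj_u small uA unit by blast
qed

end

section \<open>Coding branches by real numbers\<close>

text \<open>
  The branches are coded by the points of Cantor's ternary set. The digits are Borel functions on the
  whole line, which the value of a ternary expansion inverts on the right.
\<close>
primrec digit :: "nat \<Rightarrow> real \<Rightarrow> bool"
  where "digit 0 v \<longleftrightarrow> 1/2 < v"
  | "digit (Suc n) v \<longleftrightarrow> digit n (3 * v - (if 1/2 < v then 2 else 0))"

definition encode :: "(nat \<Rightarrow> bool) \<Rightarrow> real"
  where "encode \<omega> = (\<Sum>n. (if \<omega> n then 2 else 0) / 3 ^ Suc n)"

lemma encode_sums: "(\<lambda>n. (if \<omega> n then 2 else 0) / 3 ^ Suc n :: real) sums encode \<omega>"
  and encode_range: "0 \<le> encode \<omega>" "encode \<omega> \<le> 1"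
proof -
  have g: "(\<lambda>n. (2/3) * (1/3) ^ n :: real) sums 1"
    using sums_mult[OF geometric_sums[of "1/3::real"], of "2/3"] by simp
  have le: "(if \<omega> n then 2 else 0) / 3 ^ Suc n \<le> (2/3) * (1/3::real) ^ n" for n
    by (simp add: power_divide)
  have s: "summable (\<lambda>n. (if \<omega> n then 2 else 0) / 3 ^ Suc n :: real)"
    by (rule summable_comparison_test'[OF sums_summable[OF g]]) (use le in auto)
  then show "(\<lambda>n. (if \<omega> n then 2 else 0) / 3 ^ Suc n :: real) sums encode \<omega>"
    unfolding encode_def by (rule summable_sums)
  show "0 \<le> encode \<omega>" unfolding encode_def by (rule suminf_nonneg[OF s]) simp
  show "encode \<omega> \<le> 1"
    using suminf_le[OF le s sums_summable[OF g]] sums_unique[OF g] unfolding encode_def by (simp only:)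
qed

lemma encode_shift: "encode \<omega> = (if \<omega> 0 then 2/3 else 0) + encode (\<lambda>n. \<omega> (Suc n)) / 3"
proof -
  have "(\<lambda>n. ((if \<omega> (Suc n) then 2 else 0) / 3 ^ Suc n) / 3 :: real) sums (encode (\<lambda>n. \<omega> (Suc n)) / 3)"
    by (intro sums_divide encode_sums)
  moreover have "((if \<omega> (Suc n) then 2 else 0) / 3 ^ Suc n) / 3 = ((if \<omega> (Suc n) then 2 else 0) / 3 ^ Suc (Suc n) :: real)" for n
    by simp
  ultimately have "(\<lambda>n. (if \<omega> (Suc n) then 2 else 0) / 3 ^ Suc (Suc n) :: real) sums (encode (\<lambda>n. \<omega> (Suc n)) / 3)"
    by (simp only:)
  from sums_Suc[OF this] have "(\<lambda>n. (if \<omega> n then 2 else 0) / 3 ^ Suc n :: real) sums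
      (encode (\<lambda>n. \<omega> (Suc n)) / 3 + (if \<omega> 0 then 2 else 0) / 3 ^ Suc 0)" .
  then have "encode \<omega> = encode (\<lambda>n. \<omega> (Suc n)) / 3 + (if \<omega> 0 then 2 else 0) / 3 ^ Suc 0"
    using encode_sums sums_unique2 by blast
  then show ?thesis by simp
qed

lemma digit_encode: "digit n (encode \<omega>) = \<omega> n"
proof (induction n arbitrary: \<omega>)
  case 0
  show ?case
    using encode_shift[of \<omega>] encode_range[of "\<lambda>n. \<omega> (Suc n)"] by simp
next
  case (Suc n)
  have half: "1/2 < encode \<omega> \<longleftrightarrow> \<omega> 0"
    using encode_shift[of \<omega>] encode_range[of "\<lambda>n. \<omega> (Suc n)"] by simp
  have "3 * encode \<omega> - (if 1/2 < encode \<omega> then 2 else 0) = encode (\<lambda>n. \<omega> (Suc n))"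
    unfolding half using encode_shift[of \<omega>] by simp
  then have "digit (Suc n) (encode \<omega>) = digit n (encode (\<lambda>n. \<omega> (Suc n)))" by (simp only: digit.simps)
  then show ?case using Suc by simp
qed

lemma coordinate_sets: "{\<omega>. \<omega> n} \<in> sets branches"
proof -
  have "{\<omega>. \<omega> n} = (\<Union>s\<in>{s. length s = Suc n \<and> hd s}. cylinder s)"
  proof
    show "{\<omega>. \<omega> n} \<subseteq> (\<Union>s\<in>{s. length s = Suc n \<and> hd s}. cylinder s)"
    proof
      fix \<omega> :: "nat \<Rightarrow> bool" assume "\<omega> \<in> {\<omega>. \<omega> n}"
      then show "\<omega> \<in> (\<Union>s\<in>{s. length s = Suc n \<and> hd s}. cylinder s)"
        using mem_cylinder_prefix[of \<omega> "Suc n"] by (intro UN_I[of "prefix \<omega> (Suc n)"]) auto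
    qed
    show "(\<Union>s\<in>{s. length s = Suc n \<and> hd s}. cylinder s) \<subseteq> {\<omega>. \<omega> n}"
      by (auto simp: cylinder_def)
  qed
  then show ?thesis
    by (simp only:) (intro sets.countable_UN'' cylinder_sets, auto)
qed

lemma measurable_encode: "encode \<in> borel_measurable branches"
proof -
  have "(\<lambda>\<omega>. if \<omega> n then 2 else 0 :: real) \<in> borel_measurable branches" for n
    using coordinate_sets by (intro measurable_If) auto
  then show ?thesis
    unfolding encode_def[abs_def] by (intro borel_measurable_suminf borel_measurable_divide) auto
qed

lemma measurable_digit: "digit n \<in> measurable borel (count_space UNIV)"
proof (induction n)
  case 0
  show ?case by (simp add: digit.simps[abs_def]) 
next
  case (Suc n)
  have "(\<lambda>v::real. 3 * v - (if 1/2 < v then 2 else 0)) \<in> borel_measurable borel" by measurable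
  from measurable_compose[OF this Suc] show ?case by simp
qed

lemma decode_sets:
  assumes w: "w \<in> borel_measurable borel"
  shows "{c :: complex. prefix (\<lambda>n. digit n (w c)) m = s} \<in> sets borel"
proof (induction m arbitrary: s)
  case (Suc m)
  show ?case
  proof (cases s)
    case (Cons b s')
    have "{c. digit m (w c) = b} = (\<lambda>c. digit m (w c)) -` {b} \<inter> space borel" by auto
    also have "\<dots> \<in> sets borel"
      by (rule measurable_sets[OF measurable_compose[OF w measurable_digit]]) simp
    finally have "{c. digit m (w c) = b} \<inter> {c. prefix (\<lambda>n. digit n (w c)) m = s'} \<in> sets borel"
      using Suc by (rule sets.Int)
    moreover have "{c. prefix (\<lambda>n. digit n (w c)) (Suc m) = s} =
        {c. digit m (w c) = b} \<inter> {c. prefix (\<lambda>n. digit n (w c)) m = s'}"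
      by (auto simp: Cons)
    ultimately show ?thesis by simp
  qed simp
qed (cases "s = []"; simp)

text \<open>
  The first point where a continuous function reaches a level depends monotonically on the level,
  so it is a Borel section of the function.
\<close>

definition first_reach :: "(real \<Rightarrow> real) \<Rightarrow> real \<Rightarrow> real \<Rightarrow> real"
  where "first_reach f T v = Inf {t\<in>{0..T}. t = T \<or> v \<le> f t}"

lemma first_reach_range: "0 \<le> T \<Longrightarrow> first_reach f T v \<in> {0..T}"
proof -
  assume T: "0 \<le> T"
  let ?S = "{t\<in>{0..T}. t = T \<or> v \<le> f t}"
  have "T \<in> ?S" using T by simp
  moreover have "bdd_below ?S" by (rule bdd_belowI[of _ 0]) auto
  ultimately have "Inf ?S \<le> T" by (rule cInf_lower)
  moreover have "0 \<le> Inf ?S" by (rule cInf_greatest) (use T in auto)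
  ultimately show ?thesis by (simp add: first_reach_def)
qed

lemma mono_first_reach: "0 \<le> T \<Longrightarrow> mono (first_reach f T)"
  unfolding first_reach_def by (intro monoI cInf_superset_mono) (auto intro: bdd_belowI[of _ 0])

lemma first_reach_value:
  assumes f: "continuous_on {0..T} f" and T: "0 \<le> T" and v: "f 0 \<le> v" "v \<le> f T"
  shows "f (first_reach f T v) = v"
proof -
  let ?S = "{t\<in>{0..T}. t = T \<or> v \<le> f t}"
  have S: "?S = {0..T} \<inter> f -` {v..}" using v(2) by auto
  have "closed ?S" unfolding S by (rule continuous_closed_preimage[OF f]) auto
  moreover have "?S \<noteq> {}" using T by auto
  moreover have "bdd_below ?S" by (rule bdd_belowI[of _ 0]) auto
  ultimately have "Inf ?S \<in> ?S" by (rule closed_contains_Inf[rotated 2])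
  define q where "q = first_reach f T v"
  have q: "q \<in> {0..T}" "v \<le> f q" using \<open>Inf ?S \<in> ?S\<close> unfolding S q_def first_reach_def by auto
  have "continuous_on {0..q} f" using continuous_on_subset[OF f] q by auto
  then obtain x where x: "0 \<le> x" "x \<le> q" "f x = v"
    using IVT'[of f 0 v q] v(1) q by auto
  have "x \<in> ?S" using x q by auto
  then have "Inf ?S \<le> x" by (rule cInf_lower) (rule bdd_belowI[of _ 0], auto)
  then have "q = x" using x(2) by (simp add: q_def first_reach_def)
  then show ?thesis using x(3) by (simp add: q_def)
qed

section \<open>Operators that are not normal\<close>

text \<open>
  With \<open>h\<close> a positive multiple of the real part of \<open>a\<close>, the commutator \<open>ah - ha\<close> is a positive multiple
  of the nonzero self-adjoint operator \<open>aa\<^sup>* - a\<^sup>*a\<close>. Some vector state does not vanish there, so neither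
  does a pure state that maximizes it or its negative.
\<close>
lemma exists_noncommuting_pure_state:
  fixes a :: "'h::complex_hilbert \<Rightarrow>\<^sub>L 'h"
  assumes a: "a \<in> bounded_ops" and not_normal: "adj a o\<^sub>L a \<noteq> a o\<^sub>L adj a"
  obtains \<alpha> h where "\<alpha> \<in> pure_states (gen_cstar a)" "h \<in> gen_cstar a" "self_adjoint h" "norm h \<le> 1"
    "\<alpha> ((a o\<^sub>L h) - (h o\<^sub>L a)) \<noteq> 0"
proof -
  note alg = cstar_subalgebra_gen_cstar[OF a] id_in_gen_cstar[OF a]
  note intros = alg_intros[OF alg]
  note aA = gen_in_gen_cstar[OF a]
  define c where "c = (a o\<^sub>L adj a) - (adj a o\<^sub>L a)"
  have cA: "c \<in> gen_cstar a" using aA by (simp add: c_def intros)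
  have c_sa: "self_adjoint c"
    using a by (simp add: c_def self_adjoint_def bounded_ops_intros adj_bounded_ops adj_diff adj_compose adj_adj)
  have "c \<noteq> 0" using not_normal by (simp add: c_def)
  then obtain u where u: "blinfun_apply c u \<bullet> u \<noteq> 0"
    using self_adjoint_eqI[OF c_sa self_adjoint_zero] by auto
  then have "norm u \<noteq> 0" by auto
  define v where "v = inverse (norm u) *\<^sub>R u"
  have v: "norm v = 1" "blinfun_apply c v \<bullet> v \<noteq> 0" using u \<open>norm u \<noteq> 0\<close> by (auto simp: v_def apply_simps)
  have "\<exists>\<alpha>\<in>pure_states (gen_cstar a). \<alpha> c \<noteq> 0"
  proof (cases "0 < blinfun_apply c v \<bullet> v")
    case True
    obtain \<alpha> where "\<alpha> \<in> pure_states (gen_cstar a)" "blinfun_apply c v \<bullet> v \<le> Re (\<alpha> c)"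
      by (rule pure_state_maximizing[OF alg cA v(1)])
    then show ?thesis using True by (intro bexI[of _ \<alpha>]) auto
  next
    case False
    have mA: "(-1) *\<^sub>R c \<in> gen_cstar a" using cA by (intro intros)
    obtain \<alpha> where \<alpha>: "\<alpha> \<in> pure_states (gen_cstar a)"
        "blinfun_apply ((-1) *\<^sub>R c) v \<bullet> v \<le> Re (\<alpha> ((-1) *\<^sub>R c))"
      by (rule pure_state_maximizing[OF alg mA v(1)])
    have "\<alpha> \<in> states (gen_cstar a)" using \<alpha>(1) by (simp add: pure_states_def)
    then have "\<alpha> ((-1) *\<^sub>R c) = - \<alpha> c" using state_scaleR[OF alg _ cA, of \<alpha> "-1"] by simp
    then show ?thesis using False v(2) \<alpha> by (intro bexI[of _ \<alpha>]) (auto simp: blinfun.minus_left)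
  qed
  then obtain \<alpha> where \<alpha>: "\<alpha> \<in> pure_states (gen_cstar a)" "\<alpha> c \<noteq> 0" by blast
  then have \<alpha>s: "\<alpha> \<in> states (gen_cstar a)" by (simp add: pure_states_def)
  define r where "r = inverse (norm (re_op a) + 1)"
  have "norm (re_op a) + 1 > 0" by (simp add: add_nonneg_pos)
  then have r: "r > 0" "r * norm (re_op a) \<le> 1" by (auto simp: r_def field_simps)
  define h where "h = r *\<^sub>R re_op a"
  have comm: "(a o\<^sub>L h) - (h o\<^sub>L a) = (r / 2) *\<^sub>R c"
    by (intro blinfun_eqI)
      (simp add: h_def c_def re_op_def apply_simps scaleR_add_right scaleR_diff_right)
  show ?thesis
  proof (rule that[OF \<alpha>(1)])
    show "h \<in> gen_cstar a" using aA by (simp add: h_def intros)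
    show "self_adjoint h" by (simp add: h_def self_adjoint_scaleR self_adjoint_re_op a)
    show "norm h \<le> 1" using r by (simp add: h_def)
    show "\<alpha> ((a o\<^sub>L h) - (h o\<^sub>L a)) \<noteq> 0"
      unfolding comm using \<alpha>(2) r by (simp add: state_scaleR[OF alg \<alpha>s cA])
  qed
qed

text \<open>
  To first order in \<open>t\<close>, conjugation by the path \<open>u t\<close> changes the value at \<open>a\<close> by \<open>i t \<beta> (ah - ha)\<close>, and
  the remainder is at most \<open>12 \<parallel>a\<parallel> t\<^sup>2\<close>. The length \<open>T\<close> of the path is so small that the linear term
  prevails at its end.
\<close>
lemma nonconstant_pure_state_path:
  fixes a :: "'h::complex_hilbert \<Rightarrow>\<^sub>L 'h"
  assumes a: "a \<in> bounded_ops" and not_normal: "adj a o\<^sub>L a \<noteq> a o\<^sub>L adj a"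
  obtains T \<alpha> where "0 < T" "\<And>t. t \<in> {0..T} \<Longrightarrow> \<alpha> t \<in> pure_states (gen_cstar a)"
    "\<And>x. x \<in> gen_cstar a \<Longrightarrow> continuous_on {0..T} (\<lambda>t::real. \<alpha> t x)" "\<alpha> T a \<noteq> \<alpha> 0 a"
proof -
  let ?A = "gen_cstar a"
  note alg = cstar_subalgebra_gen_cstar[OF a] id_in_gen_cstar[OF a]
  note intros = alg_intros[OF alg]
  note aA = gen_in_gen_cstar[OF a]
  obtain \<beta> h where \<beta>: "\<beta> \<in> pure_states ?A" and h: "h \<in> ?A" "self_adjoint h" "norm h \<le> 1"
    and ne: "\<beta> ((a o\<^sub>L h) - (h o\<^sub>L a)) \<noteq> 0"
    by (rule exists_noncommuting_pure_state[OF a not_normal])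
  have \<beta>s: "\<beta> \<in> states ?A" using \<beta> by (simp add: pure_states_def)
  obtain y u where
    path: "\<forall>t\<in>{0..1/2}. u t = id_blinfun - y t + scale_op (\<i> * complex_of_real t) h \<and>
      adj (u t) = id_blinfun - y t - scale_op (\<i> * complex_of_real t) h \<and> norm (y t) \<le> t\<^sup>2"
    and unitary: "\<forall>t\<in>{0..1/2}. u t \<in> ?A \<and> adj (u t) o\<^sub>L u t = id_blinfun \<and> u t o\<^sub>L adj (u t) = id_blinfun"
    and cont: "continuous_on {0..1/2} u" "continuous_on {0..1/2} (\<lambda>t. adj (u t))"
    by (rule unitary_path[OF alg h])
  have u: "u t = id_blinfun - y t + scale_op (\<i> * complex_of_real t) h"
    and adj_u: "adj (u t) = id_blinfun - y t - scale_op (\<i> * complex_of_real t) h"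
    and y: "norm (y t) \<le> t\<^sup>2"
    and uA: "u t \<in> ?A" and unit: "adj (u t) o\<^sub>L u t = id_blinfun" "u t o\<^sub>L adj (u t) = id_blinfun"
    if "t \<in> {0..1/2}" for t
    using bspec[OF path that] bspec[OF unitary that] by blast+
  define \<alpha> where "\<alpha> t = conjugate_state ?A (u t) \<beta>" for t
  define b where "b = \<beta> ((a o\<^sub>L h) - (h o\<^sub>L a))"
  define N where "N = norm a"
  have app: "\<alpha> t x = \<beta> (adj (u t) o\<^sub>L x o\<^sub>L u t)" if "x \<in> ?A" for t x
    using that by (simp add: \<alpha>_def conjugate_state_def)
  have y0: "y 0 = 0" using y[of 0] by simp
  have \<alpha>0: "\<alpha> 0 a = \<beta> a"
  proof -
    have "u 0 = id_blinfun" "adj (u 0) = id_blinfun"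
      using u[of 0] adj_u[of 0] by (auto intro!: blinfun_eqI simp: apply_simps y0)
    then have "adj (u 0) o\<^sub>L a o\<^sub>L u 0 = a" by (intro blinfun_eqI) simp
    then show ?thesis by (simp add: app aA)
  qed
  have expand: "cmod (\<alpha> t a - \<alpha> 0 a - \<i> * complex_of_real t * b) \<le> 12 * N * t\<^sup>2"
    if t: "t \<in> {0..1/2}" for t
  proof -
    let ?z = "\<i> * complex_of_real t"
    define R where "R = (y t o\<^sub>L a o\<^sub>L y t) - (a o\<^sub>L y t) - (y t o\<^sub>L a) + t\<^sup>2 *\<^sub>R (h o\<^sub>L a o\<^sub>L h)
      + scale_op ?z ((h o\<^sub>L a o\<^sub>L y t) - (y t o\<^sub>L a o\<^sub>L h))"
    have yt: "norm (y t) \<le> t\<^sup>2" by (rule y[OF t])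
    have t1: "t\<^sup>2 \<le> 1" "0 \<le> t" "t \<le> 1" using t power_mono[of t 1 2] by auto
    have ab: "a \<in> bounded_ops" "h \<in> bounded_ops" using a self_adjoint_ops[OF h(2)] by auto
    have yA: "y t \<in> ?A"
    proof -
      have "y t = id_blinfun + scale_op ?z h - u t" using u[OF t] by simp
      then show ?thesis using uA[OF t] h(1) by (simp add: intros)
    qed
    note lin = bounded_opsD[OF ab(1)] bounded_opsD[OF ab(2)] bounded_opsD[OF alg_ops[OF alg yA]]
    note sq = scaleC_imaginary_twice[of t]
    have eq: "adj (u t) o\<^sub>L a o\<^sub>L u t = a + scale_op ?z ((a o\<^sub>L h) - (h o\<^sub>L a)) + R"
      unfolding adj_u[OF t] unfolding u[OF t] R_def
      by (intro blinfun_eqI) (simp add: apply_simps lin scaleC_add_right scaleC_diff_right sq algebra_simps)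
    have RA: "R \<in> ?A" unfolding R_def using yA aA h(1) by (simp add: intros)
    have "\<alpha> t a = \<beta> a + ?z * b + \<beta> R"
      using aA h(1) RA by (simp add: app eq b_def state_add[OF alg \<beta>s] state_scale[OF alg \<beta>s] intros)
    then have "cmod (\<alpha> t a - \<alpha> 0 a - ?z * b) = cmod (\<beta> R)" by (simp add: \<alpha>0)
    also have "\<dots> \<le> 2 * norm R" by (rule state_norm_le[OF alg \<beta>s RA])
    also have "norm R \<le> (1 * N * t\<^sup>2 + N * t\<^sup>2 + t\<^sup>2 * N) + t\<^sup>2 * (1 * N * 1)
        + 1 * ((1 * N * t\<^sup>2) + (t\<^sup>2 * N * 1))"
    proof -
      have n1: "norm (y t o\<^sub>L a o\<^sub>L y t) \<le> 1 * N * t\<^sup>2"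
        using yt t1 by (intro norm_compose_mono) (auto simp: N_def)
      have n2: "norm (a o\<^sub>L y t) \<le> N * t\<^sup>2" "norm (y t o\<^sub>L a) \<le> t\<^sup>2 * N"
        using yt by (auto intro!: norm_compose_mono simp: N_def)
      have n3: "norm (t\<^sup>2 *\<^sub>R (h o\<^sub>L a o\<^sub>L h)) \<le> t\<^sup>2 * (1 * N * 1)"
        unfolding norm_scaleR abs_power2 using h(3)
        by (intro mult_left_mono norm_compose_mono) (auto simp: N_def)
      have n4: "norm (scale_op ?z ((h o\<^sub>L a o\<^sub>L y t) - (y t o\<^sub>L a o\<^sub>L h)))
          \<le> 1 * ((1 * N * t\<^sup>2) + (t\<^sup>2 * N * 1))"
      proof -
        have "norm ((h o\<^sub>L a o\<^sub>L y t) - (y t o\<^sub>L a o\<^sub>L h)) \<le> (1 * N * t\<^sup>2) + (t\<^sup>2 * N * 1)"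
          using h(3) yt
          by (intro order_trans[OF norm_triangle_ineq4] add_mono norm_compose_mono) (auto simp: N_def)
        moreover have "cmod ?z \<le> 1" using t1 by (simp add: norm_mult)
        ultimately show ?thesis unfolding norm_scale_op by (intro mult_mono) auto
      qed
      show ?thesis
        unfolding R_def
        by (intro order_trans[OF norm_triangle_ineq] order_trans[OF norm_triangle_ineq4] add_mono n1 n2 n3 n4)
    qed
    also have "2 * \<dots> = 12 * N * t\<^sup>2" by (simp add: algebra_simps)
    finally show ?thesis by simp
  qed
  define T where "T = min (1/2) (cmod b / (12 * N + 1))"
  have N0: "12 * N + 1 > 0" "N \<ge> 0" by (auto simp: N_def add_nonneg_pos)
  have "T \<le> 1/2" unfolding T_def by (rule min.cobounded1)
  moreover have "0 < T" using ne N0 by (simp add: T_def b_def)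
  ultimately have T: "0 < T" "T \<le> 1/2" by simp_all
  have TN: "12 * N * T < cmod b"
  proof -
    have "T \<le> cmod b / (12 * N + 1)" by (simp add: T_def)
    then have "T * (12 * N + 1) \<le> cmod b" using N0 by (simp add: pos_le_divide_eq)
    then show ?thesis using T(1) by (simp add: algebra_simps)
  qed
  show ?thesis
  proof (rule that[OF T(1)])
    fix t assume "t \<in> {0..T}"
    then have t: "t \<in> {0..1/2}" using T by auto
    show "\<alpha> t \<in> pure_states ?A"
      unfolding \<alpha>_def by (rule conjugate_state_pure[OF alg \<beta> uA[OF t] unit(1)[OF t] unit(2)[OF t]])
  next
    fix x assume x: "x \<in> ?A"
    have sub: "{0..T} \<subseteq> {0..1/2}" using T by auto
    have "continuous_on {0..T} (\<lambda>t. adj (u t) o\<^sub>L x o\<^sub>L u t)"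
      using continuous_on_subset[OF cont(1) sub] continuous_on_subset[OF cont(2) sub]
      by (intro bounded_bilinear.continuous_on[OF bounded_bilinear_blinfun_compose] continuous_on_const)
    then have "continuous_on {0..T} (\<lambda>t. \<beta> (adj (u t) o\<^sub>L x o\<^sub>L u t))"
      using sub uA x by (intro continuous_on_state[OF alg \<beta>s]) (auto simp: intros)
    then show "continuous_on {0..T} (\<lambda>t. \<alpha> t x)" by (simp add: app x)
  next
    show "\<alpha> T a \<noteq> \<alpha> 0 a"
    proof
      assume "\<alpha> T a = \<alpha> 0 a"
      then have "T * cmod b \<le> T * (12 * N * T)"
        using expand[of T] T by (simp add: norm_mult power2_eq_square mult_ac)
      then have "cmod b \<le> 12 * N * T" using T(1) by simp
      then show False using TN by simp
    qed
  qed
qed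

text \<open>
  The affine map \<open>w\<close> sends the values of the path at its ends to 0 and 1. A branch is mapped to the first
  point of the path where \<open>w\<close> takes the value that encodes the branch.
\<close>
lemma spectral_decompositions_of_nonnormal:
  fixes a :: "'h::complex_hilbert \<Rightarrow>\<^sub>L 'h"
  assumes a: "a \<in> bounded_ops" and not_normal: "adj a o\<^sub>L a \<noteq> a o\<^sub>L adj a"
  shows "spectral_decompositions a"
proof -
  let ?A = "gen_cstar a"
  note alg = cstar_subalgebra_gen_cstar[OF a] id_in_gen_cstar[OF a]
  obtain T \<alpha> where T: "0 < T" and pure: "\<And>t. t \<in> {0..T} \<Longrightarrow> \<alpha> t \<in> pure_states ?A"
    and cont: "\<And>x. x \<in> ?A \<Longrightarrow> continuous_on {0..T} (\<lambda>t::real. \<alpha> t x)" and ne: "\<alpha> T a \<noteq> \<alpha> 0 a"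
    using nonconstant_pure_state_path[OF a not_normal] by blast
  define d where "d = \<alpha> T a - \<alpha> 0 a"
  define w where "w c = Re (cnj d * (c - \<alpha> 0 a)) / (cmod d)\<^sup>2" for c
  have d0: "d \<noteq> 0" using ne by (simp add: d_def)
  have w_cont: "continuous_on UNIV w" unfolding w_def by (intro continuous_intros) (use d0 in simp)
  have w_meas: "w \<in> borel_measurable borel" by (rule borel_measurable_continuous_onI[OF w_cont])
  have w0: "w (\<alpha> 0 a) = 0" by (simp add: w_def)
  have w1: "w (\<alpha> T a) = 1"
  proof -
    have "cnj d * d = complex_of_real ((cmod d)\<^sup>2)" by (simp add: mult.commute flip: complex_norm_square)
    then have "Re (cnj d * d) = (cmod d)\<^sup>2" by (metis Re_complex_of_real)
    then show ?thesis using d0 by (simp add: w_def flip: d_def)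
  qed
  define f where "f t = w (\<alpha> t a)" for t
  have f_cont: "continuous_on {0..T} f"
    unfolding f_def
    by (rule continuous_on_compose2[OF w_cont cont[OF gen_in_gen_cstar[OF a]]]) simp
  define q where "q \<omega> = first_reach f T (encode \<omega>)" for \<omega>
  have q_range: "q \<omega> \<in> {0..T}" for \<omega> unfolding q_def using T by (intro first_reach_range) simp
  have q_val: "f (q \<omega>) = encode \<omega>" for \<omega>
    unfolding q_def using T encode_range
    by (intro first_reach_value f_cont) (auto simp: f_def w0 w1)
  have q_meas: "q \<in> borel_measurable branches"
    unfolding q_def[abs_def]
    using measurable_compose[OF measurable_encode borel_measurable_mono[OF mono_first_reach]] T
    by simp
  define \<Gamma> where "\<Gamma> \<omega> = r_map a (\<alpha> (q \<omega>))" for \<omega>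
  have P: "\<alpha> t \<in> P_space ?A" if "t \<in> {0..T}" for t
    using pure[OF that] pure_states_subset_P_space[OF alg] by blast
  have \<Gamma>: "\<Gamma> \<omega> \<in> topspace (Y_space a)" for \<omega>
    unfolding \<Gamma>_def topspace_Y_space using P[OF q_range] by blast
  have path: "continuous_map (top_of_set {0..T}) (product_topology (\<lambda>_. euclidean) ?A) \<alpha>"
    unfolding continuous_map_componentwise
    using pure cont by (auto simp: pure_states_def states_def dual_space_def)
  have meas: "\<Gamma> -` U \<in> sets branches" if U: "openin (Y_space a) U" for U
  proof -
    obtain W where W: "openin (product_topology (\<lambda>_. euclidean) ?A) W"
        "{\<beta> \<in> P_space ?A. r_map a \<beta> \<in> U} = W \<inter> P_space ?A"
      using U unfolding openin_Y_space openin_P_space by blast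
    have "openin (top_of_set {0..T}) {t \<in> topspace (top_of_set {0..T}). \<alpha> t \<in> W}"
      by (rule openin_continuous_map_preimage[OF path W(1)])
    then obtain V where V: "open V" "{t \<in> {0..T}. \<alpha> t \<in> W} = {0..T} \<inter> V"
      by (auto simp: openin_open)
    have "\<Gamma> \<omega> \<in> U \<longleftrightarrow> q \<omega> \<in> V" for \<omega>
      using W(2) V(2) P[OF q_range[of \<omega>]] q_range[of \<omega>] unfolding \<Gamma>_def by blast
    then have "\<Gamma> -` U = q -` V \<inter> space branches" by auto
    then show ?thesis using measurable_sets[OF q_meas, of V] V(1) by simp
  qed
  have z: "z_map a (\<Gamma> \<omega>) = \<alpha> (q \<omega>) a" for \<omega>
    unfolding \<Gamma>_def using z_map_r_map[OF P[OF q_range]] by (simp add: tau_def)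
  show ?thesis
  proof (rule spectral_decompositions_by_decoding[OF a \<Gamma> meas, where dec = "\<lambda>c n. digit n (w c)"])
    show "(\<lambda>n. digit n (w (z_map a (\<Gamma> \<omega>)))) = \<omega>" for \<omega>
      using q_val[of \<omega>] by (simp add: z f_def digit_encode)
    show "{c. prefix (\<lambda>n. digit n (w c)) m = s} \<in> sets borel" for m s
      by (rule decode_sets[OF w_meas])
  qed
qed

text \<open>
  On the zero space there are no states, so \<open>Y\<close> and \<open>\<Sigma>(a)\<close> are empty, and every operator is zero.
\<close>
context
  assumes trivial: "(id_blinfun :: 'h::complex_hilbert \<Rightarrow>\<^sub>L 'h) = 0"
begin

lemma trivial_space_zero: "(b :: 'h \<Rightarrow>\<^sub>L 'h) = 0"
proof (rule blinfun_eqI)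
  fix x :: 'h
  have "x = 0" using arg_cong[OF trivial, of "\<lambda>f. blinfun_apply f x"] by simp
  then show "blinfun_apply b x = blinfun_apply 0 x" by (simp add: blinfun.zero_right)
qed

lemma trivial_spectral_measure: "spectral_measure X (\<lambda>_. 0 :: 'h \<Rightarrow>\<^sub>L 'h)"
  unfolding spectral_measure_def using trivial by (simp add: is_projection_zero)

lemma trivial_spectral_integral: "has_spectral_integral X E f (a :: 'h \<Rightarrow>\<^sub>L 'h)"
proof -
  have "\<exists>\<U>. borel_partition X \<U>"
    by (rule borel_partition_levels[of "\<lambda>_. ()" X])
      (auto simp: borel_sets_def intro!: sigma_sets.Basic)
  moreover have "norm b < e" if "0 < e" for b :: "'h \<Rightarrow>\<^sub>L 'h" and e :: real
    using trivial_space_zero[of b] that by simp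
  ultimately show ?thesis unfolding has_spectral_integral_def by blast
qed

lemma spectral_decompositions_trivial: "spectral_decompositions (a :: 'h \<Rightarrow>\<^sub>L 'h)"
proof -
  have "scale_op 0 id_blinfun = (0 :: 'h \<Rightarrow>\<^sub>L 'h)" by (rule trivial_space_zero)
  then have "strongly_spectral (0 :: 'h \<Rightarrow>\<^sub>L 'h)"
    using strongly_spectral_scalar[of 0, where 'h = 'h] by simp
  then show ?thesis
    unfolding spectral_decompositions_def
    by (intro conjI exI[of _ "\<lambda>_. 0"] trivial_spectral_measure trivial_spectral_integral)
      (simp_all add: bounded_ops_zero)
qed

end

theorem theorem4:
  fixes a :: "'h::complex_hilbert \<Rightarrow>\<^sub>L 'h"
  assumes "a \<in> bounded_ops"
  shows "(\<exists>(E :: (('h \<Rightarrow>\<^sub>L 'h) \<Rightarrow> complex) set set \<Rightarrow> 'h \<Rightarrow>\<^sub>L 'h) j.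
            spectral_measure (Y_space a) E \<and>
            (\<forall>y \<in> topspace (Y_space a). j y \<in> bounded_ops) \<and>
            (\<forall>y \<in> topspace (Y_space a). z_map a y \<in> op_spectrum a \<longrightarrow> strongly_spectral (j y)) \<and>
            has_spectral_integral (Y_space a) E j a) \<and>
         (\<exists>(E :: complex set \<Rightarrow> 'h \<Rightarrow>\<^sub>L 'h) k.
            spectral_measure (top_of_set (Sigma_op a)) E \<and>
            (\<forall>c \<in> Sigma_op a. k c \<in> bounded_ops) \<and>
            (\<forall>c \<in> op_spectrum a. strongly_spectral (k c)) \<and>
            has_spectral_integral (top_of_set (Sigma_op a)) E k a)"
proof -
  have "spectral_decompositions a"
  proof (cases "(id_blinfun :: 'h \<Rightarrow>\<^sub>L 'h) = 0")
    case True
    then show ?thesis by (rule spectral_decompositions_trivial)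
  next
    case False
    then show ?thesis
      using spectral_decompositions_of_normal spectral_decompositions_of_nonnormal assms by blast
  qed
  then show ?thesis unfolding spectral_decompositions_def by blast
qed

end
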